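(* Let $G=(M,\mathfrak{A},\delta,R,\{\tau_t\}_{t\in\mathbb{R}})$ be a quantum group $W^*$-algebra. For any two quantized characters $\chi_1,\chi_2$ of $G$, the functional $(\chi_1\otimes\chi_2)\circ\delta$ on $M$ is a quantized character of $G$.
   Context: A quantum group $W^*$-algebra $G=(M,\mathfrak{A},\delta,R,\{\tau_t\}_{t\in\mathbb{R}})$ consists of: a von Neumann algebra $M$; a $\sigma$-weakly dense $C^*$-subalgebra $\mathfrak{A}\subset M$; a comultiplication $\delta\colon M\to M\bar\otimes M$, i.e. a unital normal $*$-homomorphism with $(\mathrm{id}\otimes\delta)\circ\delta=(\delta\otimes\mathrm{id})\circ\delta$; an involutive normal $*$-anti-homomorphism $R\colon M\to M$ (unitary antipode); a one-parameter automorphism group $\{\tau_t\}_{t\in\mathbb{R}}$ on $M$ preserving $\mathfrak{A}$ (deformation automorphism group); such that for all $t$: $\delta\circ\tau_t=(\tau_t\otimes\tau_t)\circ\delta$, $\tau_t\circ R=R\circ\tau_t$, $\delta\circ R=(R\otimes R)\circ\sigma\circ\delta$, with $\sigma$ the flip on $M\bar\otimes M$. A quantized character of $G$ is a normal $\tau$-KMS state $\chi$ on $M$ with inverse temperature $-1$: for all $x,y\in M$ there is a bounded continuous function $F$ on $\{z\in\mathbb{C}\mid-1\le\mathrm{Im}z\le0\}$, analytic in the interior, with $F(t)=\chi(x\tau_t(y))$ and $F(t-\mathrm{i})=\chi(\tau_t(y)x)$ for all $t\in\mathbb{R}$. Here $\chi_1\otimes\chi_2$ is the normal product state on $M\bar\otimes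 M$. *)

theory Defs
  imports "HOL-Analysis.Analysis"
begin

section \<open>Complex Hilbert spaces and bounded operators\<close>

(* cinner is linear in its first argument. The inherited real structure is the underlying real
   Hilbert space, so norm, topology, completeness and bounded operators are the library's. *)
class chilbert_space = real_inner + complete_space +
  fixes scaleC :: "complex \<Rightarrow> 'a \<Rightarrow> 'a" (infixr \<open>*\<^sub>C\<close> 75)
    and cinner :: "'a \<Rightarrow> 'a \<Rightarrow> complex"
  assumes scaleR_scaleC: "scaleR r x = complex_of_real r *\<^sub>C x"
    and scaleC_add_right: "c *\<^sub>C (x + y) = c *\<^sub>C x + c *\<^sub>C y"
    and scaleC_add_left: "(c + d) *\<^sub>C x = c *\<^sub>C x + d *\<^sub>C x"
    and scaleC_scaleC: "c *\<^sub>C (d *\<^sub>C x) = (c * d) *\<^sub>C x"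
    and cinner_commute: "cinner x y = cnj (cinner y x)"
    and cinner_add_left: "cinner (x + y) z = cinner x z + cinner y z"
    and cinner_scaleC_left: "cinner (c *\<^sub>C x) y = c * cinner x y"
    and inner_eq_Re_cinner: "inner x y = Re (cinner x y)"

instantiation complex :: chilbert_space
begin

definition scaleC_complex :: "complex \<Rightarrow> complex \<Rightarrow> complex"
  where "scaleC_complex c x = c * x"

definition cinner_complex :: "complex \<Rightarrow> complex \<Rightarrow> complex"
  where "cinner_complex x y = x * cnj y"

instance
  by standard
    (simp_all add: scaleC_complex_def cinner_complex_def scaleR_conv_of_real inner_complex_def
      algebra_simps)

end

(* B(H): the complex-linear ones among the bounded real-linear operators; the norm of
   blinfun is the operator norm. *)
definition bops :: "('h::chilbert_space \<Rightarrow>\<^sub>L 'h) set"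
  where "bops = {a. \<forall>c v. blinfun_apply a (c *\<^sub>C v) = c *\<^sub>C blinfun_apply a v}"

definition op_scaleC :: "complex \<Rightarrow> ('h::chilbert_space \<Rightarrow>\<^sub>L 'h) \<Rightarrow> ('h \<Rightarrow>\<^sub>L 'h)"
  where "op_scaleC c a = Blinfun (\<lambda>v. c *\<^sub>C blinfun_apply a v)"

definition op_adj :: "('h::chilbert_space \<Rightarrow>\<^sub>L 'h) \<Rightarrow> ('h \<Rightarrow>\<^sub>L 'h)"
  where "op_adj a =
    (THE b. \<forall>u v. cinner (blinfun_apply b u) v = cinner u (blinfun_apply a v))"

section \<open>Von Neumann algebras, \<open>C\<^sup>*\<close>-subalgebras and the \<open>\<sigma>\<close>-weak topology\<close>

definition commutant :: "('h::chilbert_space \<Rightarrow>\<^sub>L 'h) set \<Rightarrow> ('h \<Rightarrow>\<^sub>L 'h) set"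
  where "commutant S = {a \<in> bops. \<forall>b\<in>S. a o\<^sub>L b = b o\<^sub>L a}"

definition von_neumann_algebra :: "('h::chilbert_space \<Rightarrow>\<^sub>L 'h) set \<Rightarrow> bool"
  where "von_neumann_algebra M \<longleftrightarrow>
    (\<forall>a\<in>M. op_adj a \<in> M) \<and> commutant (commutant M) = M"

definition cstar_algebra :: "('h::chilbert_space \<Rightarrow>\<^sub>L 'h) set \<Rightarrow> bool"
  where "cstar_algebra A \<longleftrightarrow>
    A \<subseteq> bops \<and> 0 \<in> A \<and>
    (\<forall>a\<in>A. \<forall>b\<in>A. a + b \<in> A \<and> a o\<^sub>L b \<in> A) \<and>
    (\<forall>a\<in>A. op_adj a \<in> A \<and> (\<forall>c. op_scaleC c a \<in> A)) \<and>
    closed A"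

(* The topology on B(H) induced by the functionals a \<mapsto> \<Sum>n. <a (\<xi> n), \<eta> n> with
   square-summable sequences \<xi>, \<eta>. *)
definition sigma_weak :: "('h::chilbert_space \<Rightarrow>\<^sub>L 'h) topology"
  where "sigma_weak = topology_generated_by
    {{a \<in> bops. (\<Sum>n. cinner (blinfun_apply a (\<xi> n)) (\<eta> n)) \<in> U} | \<xi> \<eta> U.
      summable (\<lambda>n::nat. (norm (\<xi> n))\<^sup>2) \<and> summable (\<lambda>n. (norm (\<eta> n))\<^sup>2) \<and> open U}"

section \<open>Maps, functionals and states\<close>

(* Maps and functionals are total functions of which only the values on M matter. *)

definition linear_map_on ::
  "('h::chilbert_space \<Rightarrow>\<^sub>L 'h) set \<Rightarrow> (('h \<Rightarrow>\<^sub>L 'h) \<Rightarrow> ('k::chilbert_space \<Rightarrow>\<^sub>L 'k)) \<Rightarrow> bool"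
  where "linear_map_on M f \<longleftrightarrow>
    (\<forall>a\<in>M. \<forall>b\<in>M. f (a + b) = f a + f b) \<and>
    (\<forall>c. \<forall>a\<in>M. f (op_scaleC c a) = op_scaleC c (f a))"

definition normal_map ::
  "('h::chilbert_space \<Rightarrow>\<^sub>L 'h) set \<Rightarrow> ('k::chilbert_space \<Rightarrow>\<^sub>L 'k) set \<Rightarrow>
    (('h \<Rightarrow>\<^sub>L 'h) \<Rightarrow> ('k \<Rightarrow>\<^sub>L 'k)) \<Rightarrow> bool"
  where "normal_map M N f \<longleftrightarrow>
    continuous_map (subtopology sigma_weak M) (subtopology sigma_weak N) f"

definition star_hom ::
  "('h::chilbert_space \<Rightarrow>\<^sub>L 'h) set \<Rightarrow> ('k::chilbert_space \<Rightarrow>\<^sub>L 'k) set \<Rightarrow>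
    (('h \<Rightarrow>\<^sub>L 'h) \<Rightarrow> ('k \<Rightarrow>\<^sub>L 'k)) \<Rightarrow> bool"
  where "star_hom M N f \<longleftrightarrow>
    f ` M \<subseteq> N \<and> linear_map_on M f \<and>
    (\<forall>a\<in>M. \<forall>b\<in>M. f (a o\<^sub>L b) = f a o\<^sub>L f b) \<and>
    (\<forall>a\<in>M. f (op_adj a) = op_adj (f a))"

definition star_antihom ::
  "('h::chilbert_space \<Rightarrow>\<^sub>L 'h) set \<Rightarrow> ('k::chilbert_space \<Rightarrow>\<^sub>L 'k) set \<Rightarrow>
    (('h \<Rightarrow>\<^sub>L 'h) \<Rightarrow> ('k \<Rightarrow>\<^sub>L 'k)) \<Rightarrow> bool"
  where "star_antihom M N f \<longleftrightarrow>
    f ` M \<subseteq> N \<and> linear_map_on M f \<and>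
    (\<forall>a\<in>M. \<forall>b\<in>M. f (a o\<^sub>L b) = f b o\<^sub>L f a) \<and>
    (\<forall>a\<in>M. f (op_adj a) = op_adj (f a))"

definition star_automorphism ::
  "('h::chilbert_space \<Rightarrow>\<^sub>L 'h) set \<Rightarrow> (('h \<Rightarrow>\<^sub>L 'h) \<Rightarrow> ('h \<Rightarrow>\<^sub>L 'h)) \<Rightarrow> bool"
  where "star_automorphism M f \<longleftrightarrow> star_hom M M f \<and> bij_betw f M M"

definition normal_state ::
  "('h::chilbert_space \<Rightarrow>\<^sub>L 'h) set \<Rightarrow> (('h \<Rightarrow>\<^sub>L 'h) \<Rightarrow> complex) \<Rightarrow> bool"
  where "normal_state M chi \<longleftrightarrow>
    (\<forall>a\<in>M. \<forall>b\<in>M. chi (a + b) = chi a + chi b) \<and>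
    (\<forall>c. \<forall>a\<in>M. chi (op_scaleC c a) = c * chi a) \<and>
    (\<forall>a\<in>M. chi (op_adj a o\<^sub>L a) \<in> \<real>\<^sub>\<ge>\<^sub>0) \<and>
    chi id_blinfun = 1 \<and>
    continuous_map (subtopology sigma_weak M) euclidean chi"

section \<open>Tensor products\<close>

(* The Hilbert space tensor product, as usual only up to unique unitary isomorphism: 'k together
   with t u v = u \<otimes> v. The real span of the simple tensors is already their complex span. *)
definition hilbert_tensor ::
  "('a::chilbert_space \<Rightarrow> 'b::chilbert_space \<Rightarrow> 'k::chilbert_space) \<Rightarrow> bool"
  where "hilbert_tensor t \<longleftrightarrow>
    (\<forall>u u' v. t (u + u') v = t u v + t u' v) \<and>
    (\<forall>u v v'. t u (v + v') = t u v + t u v') \<and>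
    (\<forall>c u v. t (c *\<^sub>C u) v = c *\<^sub>C t u v \<and> t u (c *\<^sub>C v) = c *\<^sub>C t u v) \<and>
    (\<forall>u v u' v'. cinner (t u v) (t u' v') = cinner u u' * cinner v v') \<and>
    closure (span {t u v | u v. True}) = UNIV"

definition op_tensor ::
  "('a::chilbert_space \<Rightarrow> 'b::chilbert_space \<Rightarrow> 'k::chilbert_space) \<Rightarrow>
    ('a \<Rightarrow>\<^sub>L 'a) \<Rightarrow> ('b \<Rightarrow>\<^sub>L 'b) \<Rightarrow> ('k \<Rightarrow>\<^sub>L 'k)"
  where "op_tensor t a b = (THE c. c \<in> bops \<and>
    (\<forall>u v. blinfun_apply c (t u v) = t (blinfun_apply a u) (blinfun_apply b v)))"

(* The von Neumann algebra generated by the operators a \<otimes> b. *)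
definition vn_tensor ::
  "('a::chilbert_space \<Rightarrow> 'b::chilbert_space \<Rightarrow> 'k::chilbert_space) \<Rightarrow>
    ('a \<Rightarrow>\<^sub>L 'a) set \<Rightarrow> ('b \<Rightarrow>\<^sub>L 'b) set \<Rightarrow> ('k \<Rightarrow>\<^sub>L 'k) set"
  where "vn_tensor t M N =
    von_neumann_algebra hull {op_tensor t a b | a b. a \<in> M \<and> b \<in> N}"

(* f is the map \<alpha> \<otimes> \<beta>, i.e. the (unique) normal linear extension of a \<otimes> b \<mapsto> \<alpha> a \<otimes> \<beta> b. *)
definition is_tensor_map ::
  "('a::chilbert_space \<Rightarrow> 'b::chilbert_space \<Rightarrow> 'k::chilbert_space) \<Rightarrow>
    ('c::chilbert_space \<Rightarrow> 'd::chilbert_space \<Rightarrow> 'l::chilbert_space) \<Rightarrow>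
    ('a \<Rightarrow>\<^sub>L 'a) set \<Rightarrow> ('b \<Rightarrow>\<^sub>L 'b) set \<Rightarrow> ('c \<Rightarrow>\<^sub>L 'c) set \<Rightarrow> ('d \<Rightarrow>\<^sub>L 'd) set \<Rightarrow>
    (('a \<Rightarrow>\<^sub>L 'a) \<Rightarrow> ('c \<Rightarrow>\<^sub>L 'c)) \<Rightarrow> (('b \<Rightarrow>\<^sub>L 'b) \<Rightarrow> ('d \<Rightarrow>\<^sub>L 'd)) \<Rightarrow>
    (('k \<Rightarrow>\<^sub>L 'k) \<Rightarrow> ('l \<Rightarrow>\<^sub>L 'l)) \<Rightarrow> bool"
  where "is_tensor_map t s M N M' N' \<alpha> \<beta> f \<longleftrightarrow>
    linear_map_on (vn_tensor t M N) f \<and>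
    normal_map (vn_tensor t M N) (vn_tensor s M' N') f \<and>
    (\<forall>a\<in>M. \<forall>b\<in>N. f (op_tensor t a b) = op_tensor s (\<alpha> a) (\<beta> b))"

definition is_flip ::
  "('h::chilbert_space \<Rightarrow> 'h \<Rightarrow> 'k::chilbert_space) \<Rightarrow> ('h \<Rightarrow>\<^sub>L 'h) set \<Rightarrow>
    (('k \<Rightarrow>\<^sub>L 'k) \<Rightarrow> ('k \<Rightarrow>\<^sub>L 'k)) \<Rightarrow> bool"
  where "is_flip t M f \<longleftrightarrow>
    linear_map_on (vn_tensor t M M) f \<and>
    normal_map (vn_tensor t M M) (vn_tensor t M M) f \<and>
    (\<forall>a\<in>M. \<forall>b\<in>M. f (op_tensor t a b) = op_tensor t b a)"

(* Unique as a functional on the von Neumann tensor product of M and N. *)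
definition product_state ::
  "('a::chilbert_space \<Rightarrow> 'b::chilbert_space \<Rightarrow> 'k::chilbert_space) \<Rightarrow>
    ('a \<Rightarrow>\<^sub>L 'a) set \<Rightarrow> ('b \<Rightarrow>\<^sub>L 'b) set \<Rightarrow>
    (('a \<Rightarrow>\<^sub>L 'a) \<Rightarrow> complex) \<Rightarrow> (('b \<Rightarrow>\<^sub>L 'b) \<Rightarrow> complex) \<Rightarrow> ('k \<Rightarrow>\<^sub>L 'k) \<Rightarrow> complex"
  where "product_state t M N chi\<^sub>1 chi\<^sub>2 = (SOME \<psi>. normal_state (vn_tensor t M N) \<psi> \<and>
    (\<forall>a\<in>M. \<forall>b\<in>N. \<psi> (op_tensor t a b) = chi\<^sub>1 a * chi\<^sub>2 b))"

section \<open>Quantum group \<open>W\<^sup>*\<close>-algebras and quantized characters\<close>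

(* M acts on 'h; t realises H \<otimes> H on 'k, and tl, tr realise (H \<otimes> H) \<otimes> H and H \<otimes> (H \<otimes> H) on the
   same space 'l, identified by assoc. *)
locale quantum_group_Wstar =
  fixes t :: "'h::chilbert_space \<Rightarrow> 'h \<Rightarrow> 'k::chilbert_space"
    and tl :: "'k \<Rightarrow> 'h \<Rightarrow> 'l::chilbert_space"
    and tr :: "'h \<Rightarrow> 'k \<Rightarrow> 'l"
    and M :: "('h \<Rightarrow>\<^sub>L 'h) set"
    and A :: "('h \<Rightarrow>\<^sub>L 'h) set"
    and \<delta> :: "('h \<Rightarrow>\<^sub>L 'h) \<Rightarrow> ('k \<Rightarrow>\<^sub>L 'k)"
    and R :: "('h \<Rightarrow>\<^sub>L 'h) \<Rightarrow> ('h \<Rightarrow>\<^sub>L 'h)"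
    and \<tau> :: "real \<Rightarrow> ('h \<Rightarrow>\<^sub>L 'h) \<Rightarrow> ('h \<Rightarrow>\<^sub>L 'h)"
  assumes tensor_t: "hilbert_tensor t"
    and tensor_tl: "hilbert_tensor tl"
    and tensor_tr: "hilbert_tensor tr"
    and assoc: "tl (t u v) w = tr u (t v w)"
    and vn_M: "von_neumann_algebra M"
    and cstar_A: "cstar_algebra A" "A \<subseteq> M"
    and dense_A: "M \<subseteq> sigma_weak closure_of A"
    and comult_hom: "star_hom M (vn_tensor t M M) \<delta>" "\<delta> id_blinfun = id_blinfun"
    and comult_normal: "normal_map M (vn_tensor t M M) \<delta>"
    and coassoc:
      "\<exists>id_\<delta> \<delta>_id.
        is_tensor_map t tr M M M (vn_tensor t M M) (\<lambda>a. a) \<delta> id_\<delta> \<and>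
        is_tensor_map t tl M M (vn_tensor t M M) M \<delta> (\<lambda>a. a) \<delta>_id \<and>
        (\<forall>x\<in>M. id_\<delta> (\<delta> x) = \<delta>_id (\<delta> x))"
    and R_antihom: "star_antihom M M R" "normal_map M M R"
    and R_involutive: "x \<in> M \<Longrightarrow> R (R x) = x"
    and \<tau>_automorphism: "star_automorphism M (\<tau> r)"
    and \<tau>_zero: "x \<in> M \<Longrightarrow> \<tau> 0 x = x"
    and \<tau>_add: "x \<in> M \<Longrightarrow> \<tau> (r + s) x = \<tau> r (\<tau> s x)"
    and \<tau>_A: "\<tau> r ` A = A"
    and comult_\<tau>:
      "\<exists>\<tau>\<tau>. is_tensor_map t t M M M M (\<tau> r) (\<tau> r) \<tau>\<tau> \<and> (\<forall>x\<in>M. \<delta> (\<tau> r x) = \<tau>\<tau> (\<delta> x))"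
    and \<tau>_R: "x \<in> M \<Longrightarrow> \<tau> r (R x) = R (\<tau> r x)"
    and comult_R:
      "\<exists>RR \<sigma>. is_tensor_map t t M M M M R R RR \<and> is_flip t M \<sigma> \<and>
        (\<forall>x\<in>M. \<delta> (R x) = RR (\<sigma> (\<delta> x)))"

definition quantized_character ::
  "('h::chilbert_space \<Rightarrow>\<^sub>L 'h) set \<Rightarrow> (real \<Rightarrow> ('h \<Rightarrow>\<^sub>L 'h) \<Rightarrow> ('h \<Rightarrow>\<^sub>L 'h)) \<Rightarrow>
    (('h \<Rightarrow>\<^sub>L 'h) \<Rightarrow> complex) \<Rightarrow> bool"
  where "quantized_character M \<tau> chi \<longleftrightarrow>
    normal_state M chi \<and>
    (\<forall>x\<in>M. \<forall>y\<in>M. \<exists>F :: complex \<Rightarrow> complex.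
      continuous_on {z. - 1 \<le> Im z \<and> Im z \<le> 0} F \<and>
      bounded (F ` {z. - 1 \<le> Im z \<and> Im z \<le> 0}) \<and>
      F holomorphic_on {z. - 1 < Im z \<and> Im z < 0} \<and>
      (\<forall>s::real. F (of_real s) = chi (x o\<^sub>L \<tau> s y)) \<and>
      (\<forall>s::real. F (of_real s - \<i>) = chi (\<tau> s y o\<^sub>L x)))"

end

theory Submission
  imports Defs "HOL-Complex_Analysis.Complex_Analysis" "HOL-Library.Nat_Bijection"
begin

text \<open>
  The theorem has two halves. The product state exists and composes with the comultiplication to a
  normal state; and it satisfies the KMS condition for the automorphisms \<open>\<tau>\<^sub>s \<otimes> \<tau>\<^sub>s\<close>, which the
  comultiplication intertwines with \<open>\<tau>\<^sub>s\<close>. Then the KMS function of the pair \<open>\<delta> x\<close>, \<open>\<delta> y\<close> serves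
  the pair \<open>x\<close>, \<open>y\<close>.

  Both halves rest on one description of normal functionals. A \<open>\<sigma>\<close>-weakly continuous functional is a
  single matrix coefficient \<open>a \<mapsto> \<langle>(a \<otimes> 1) x, y\<rangle>\<close> on the amplification \<open>H \<otimes> \<ell>\<^sup>2\<close>
  (\<open>normal_functional_if_continuous\<close>), which makes Hilbert space geometry available. The double
  commutant argument on the amplification shows that normal functionals that agree on simple tensors
  agree on the whole von Neumann tensor product (\<open>normal_functional_eqI\<close>), and orthogonal projection
  turns this into approximation of an operator together with its adjoint, \<open>*\<close>-strongly, by linear
  combinations of simple tensors (\<open>strong_star_density\<close>).

  If two states are the coefficients of \<open>x, y\<close> and \<open>x', y'\<close>, then the coefficient of the tensor
  sequences \<open>x \<otimes> x'\<close> and \<open>y \<otimes> y'\<close> is the product functional. It is positive on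
  \<open>Z = \<Sum>\<^sub>i a\<^sub>i \<otimes> b\<^sub>i\<close>, because its value at \<open>Z\<^sup>* Z\<close> is the sum over the Schur product of the positive
  kernels \<open>\<chi>\<^sub>1(a\<^sub>j\<^sup>* a\<^sub>i)\<close> and \<open>\<chi>\<^sub>2(b\<^sub>j\<^sup>* b\<^sub>i)\<close>, and then everywhere by approximation
  (\<open>product_state_exists\<close>).

  For simple tensors a KMS function of the product is the product of the KMS functions of the
  factors, and sums of simple tensors follow by bilinearity. The passage to the closure must be
  uniform in the time parameter. A KMS state is invariant, since its KMS function for \<open>x = 1\<close> has equal
  boundary values, extends periodically to a bounded entire function and is constant
  (\<open>strip_boundary_values_equal_const\<close>). Hence the product state \<open>\<psi>\<close> and
  \<open>\<alpha>\<^sub>s = \<tau>\<^sub>s \<otimes> \<tau>\<^sub>s\<close> satisfy \<open>\<psi>(\<alpha>\<^sub>s(D)\<^sup>* \<alpha>\<^sub>s(D)) = \<psi>(D\<^sup>* D)\<close>, and the Cauchy-Schwarz inequality bounds the error of replacing an operator by an approximation on both boundary lines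
  independently of \<open>s\<close>. The error on one line involves \<open>D\<^sup>* D\<close>, on the other \<open>D D\<^sup>*\<close>, which is why
  approximation has to be \<open>*\<close>-strong. The three lines theorem carries the uniform convergence from the
  boundary into the strip (\<open>strip_boundary_values_limit\<close>).
\<close>


section \<open>Inner products, projections and adjoints\<close>

lemma scaleC_zero_left [simp]: "0 *\<^sub>C (x::'a::chilbert_space) = 0"
  using scaleR_scaleC[of 0 x] by simp

lemma scaleC_zero_right [simp]: "c *\<^sub>C (0::'a::chilbert_space) = 0"
  using scaleC_add_right[of c 0 "0::'a"] by simp

lemma scaleC_minus_right [simp]: "c *\<^sub>C (- x) = - (c *\<^sub>C (x::'a::chilbert_space))"
proof -
  have "c *\<^sub>C x + c *\<^sub>C (- x) = 0" by (simp flip: scaleC_add_right)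
  thus ?thesis by (metis add.inverse_unique)
qed

lemma scaleC_diff_right: "c *\<^sub>C (x - y) = c *\<^sub>C x - c *\<^sub>C (y::'a::chilbert_space)"
  using scaleC_add_right[of c x "-y"] by simp

lemma scaleC_sum_right: "c *\<^sub>C (sum f I) = (\<Sum>i\<in>I. c *\<^sub>C (f i ::'a::chilbert_space))"
  by (induction I rule: infinite_finite_induct) (auto simp: scaleC_add_right)

lemma cinner_add_right: "cinner x (y + z) = cinner x y + cinner x (z::'a::chilbert_space)"
  by (metis cinner_add_left cinner_commute complex_cnj_add)

lemma cinner_scaleC_right: "cinner x (c *\<^sub>C y) = cnj c * cinner x (y::'a::chilbert_space)"
  by (metis cinner_scaleC_left cinner_commute complex_cnj_mult)

lemma Im_cinner: "Im (cinner x y) = inner x (\<i> *\<^sub>C (y::'a::chilbert_space))"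
  by (simp add: inner_eq_Re_cinner cinner_scaleC_right)

lemma cinner_self: "cinner x x = of_real ((norm (x::'a::chilbert_space))\<^sup>2)"
proof (rule complex_eqI)
  show "Re (cinner x x) = Re (of_real ((norm x)\<^sup>2))"
    by (simp flip: inner_eq_Re_cinner add: power2_norm_eq_inner)
  show "Im (cinner x x) = Im (of_real ((norm x)\<^sup>2))"
    using cinner_commute[of x x] by (metis Im_complex_of_real Reals_cnj_iff complex_is_Real_iff)
qed

lemma norm_scaleC: "norm (c *\<^sub>C x) = cmod c * norm (x::'a::chilbert_space)"
proof -
  have "of_real ((norm (c *\<^sub>C x))\<^sup>2) = cinner (c *\<^sub>C x) (c *\<^sub>C x)"
    by (rule cinner_self[symmetric])
  also have "\<dots> = (c * cnj c) * cinner x x"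
    by (simp add: cinner_scaleC_left cinner_scaleC_right)
  also have "\<dots> = of_real ((cmod c * norm x)\<^sup>2)"
    by (simp add: cinner_self complex_norm_square[symmetric] power_mult_distrib)
  finally have "(norm (c *\<^sub>C x))\<^sup>2 = (cmod c * norm x)\<^sup>2"
    by (metis of_real_eq_iff)
  thus ?thesis by (simp add: power2_eq_iff_nonneg)
qed

lemma Cauchy_Schwarz_cinner: "cmod (cinner x y) \<le> norm x * norm (y::'a::chilbert_space)"
proof (cases "cinner x y = 0")
  case False
  \<comment> \<open>Rotating \<open>x\<close> by this phase makes the inner product real and nonnegative.\<close>
  define p where "p = cnj (cinner x y) / cmod (cinner x y)"
  have "cmod p = 1" using False by (simp add: p_def norm_divide)
  have "of_real (cmod (cinner x y)) = cinner (p *\<^sub>C x) y"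
    using False complex_norm_square[of "cinner x y"]
    by (simp add: cinner_scaleC_left p_def field_simps power2_eq_square)
  hence "cmod (cinner x y) = inner (p *\<^sub>C x) y"
    by (metis Re_complex_of_real inner_eq_Re_cinner)
  also have "\<dots> \<le> norm (p *\<^sub>C x) * norm y" by (rule norm_cauchy_schwarz)
  finally show ?thesis using \<open>cmod p = 1\<close> by (simp add: norm_scaleC)
qed auto

interpretation cinner: bounded_bilinear "cinner :: 'a::chilbert_space \<Rightarrow> 'a \<Rightarrow> complex"
proof
  show "\<exists>K. \<forall>a b. norm (cinner (a::'a) b) \<le> norm a * norm b * K"
    by (rule exI[of _ 1]) (simp add: Cauchy_Schwarz_cinner)
qed (auto simp: cinner_add_left cinner_add_right scaleR_scaleC cinner_scaleC_left
       cinner_scaleC_right scaleC_complex_def)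

interpretation scaleC: bounded_bilinear "scaleC :: complex \<Rightarrow> 'a::chilbert_space \<Rightarrow> 'a"
proof
  show "\<exists>K. \<forall>a (b::'a). norm (a *\<^sub>C b) \<le> norm a * norm b * K"
    by (rule exI[of _ 1]) (simp add: norm_scaleC)
qed (auto simp: scaleC_add_left scaleC_add_right scaleR_scaleC scaleC_scaleC
       scaleC_complex_def mult.commute)

lemma cinner_eqI:
  assumes "\<And>v. cinner x v = cinner y (v::'a::chilbert_space)"
  shows "x = y"
proof -
  have "cinner (x - y) (x - y) = 0" using assms by (simp add: cinner.diff_left)
  thus ?thesis by (simp add: cinner_self)
qed

text \<open>A minimising sequence is a Cauchy sequence by the parallelogram law, so completeness
  produces a nearest point; moving it inside the subspace cannot shorten the distance, which
  forces the difference to be orthogonal.\<close>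

lemma orthogonal_projection_exists:
  fixes C :: "'a::{real_inner,complete_space} set"
  assumes C: "subspace C" "closed C"
  obtains p where "p \<in> C" "\<And>c. c \<in> C \<Longrightarrow> inner (x - p) c = 0"
proof -
  define d where "d = infdist x C"
  have ne: "C \<noteq> {}" using C(1) subspace_0 by blast
  have d0: "d \<ge> 0" by (simp add: d_def infdist_nonneg)
  have dle: "d \<le> norm (x - c)" if "c \<in> C" for c
    using infdist_le[OF that, of x] by (simp add: d_def dist_norm)
  have "\<exists>c\<in>C. (norm (x - c))\<^sup>2 < d\<^sup>2 + inverse (Suc n)" for n
  proof -
    define r where "r = sqrt (d\<^sup>2 + inverse (Suc n))"
    have "d < r" unfolding r_def using d0 by (intro real_less_rsqrt) auto
    then obtain c where c: "c \<in> C" "dist x c < r"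
      unfolding d_def infdist_notempty[OF ne] using ne by (subst (asm) cINF_less_iff) auto
    have "(norm (x - c))\<^sup>2 < r\<^sup>2"
      using c(2) by (intro power_strict_mono) (auto simp: dist_norm)
    thus ?thesis using c(1) by (auto simp: r_def add_nonneg_nonneg)
  qed
  then obtain c where c: "\<And>n. c n \<in> C"
    and cd: "\<And>n. (norm (x - c n))\<^sup>2 < d\<^sup>2 + inverse (Suc n)" by metis
  have para: "(norm (c m - c n))\<^sup>2 \<le> 2 * inverse (Suc m) + 2 * inverse (Suc n)" for m n
  proof -
    have "(norm (c m - c n))\<^sup>2 =
        2 * (norm (x - c m))\<^sup>2 + 2 * (norm (x - c n))\<^sup>2 - 4 * (norm (x - (1/2) *\<^sub>R (c m + c n)))\<^sup>2"
      unfolding power2_norm_eq_inner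
      by (simp add: inner_diff_left inner_diff_right inner_add_left inner_add_right
          inner_commute algebra_simps)
    moreover have "d\<^sup>2 \<le> (norm (x - (1/2) *\<^sub>R (c m + c n)))\<^sup>2"
      using d0 C c by (intro power_mono dle subspace_scale subspace_add) auto
    ultimately show ?thesis using cd[of m] cd[of n] by linarith
  qed
  have "Cauchy c"
  proof (rule metric_CauchyI)
    fix e :: real assume e: "e > 0"
    obtain N where N: "inverse (real (Suc N)) < e\<^sup>2 / 4"
      using reals_Archimedean[of "e\<^sup>2/4"] e by auto
    show "\<exists>N. \<forall>m\<ge>N. \<forall>n\<ge>N. dist (c m) (c n) < e"
    proof (intro exI[of _ N] allI impI)
      fix m n assume "m \<ge> N" "n \<ge> N"
      hence "inverse (real (Suc m)) \<le> inverse (real (Suc N))"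
        "inverse (real (Suc n)) \<le> inverse (real (Suc N))" by (auto intro!: le_imp_inverse_le)
      hence "(norm (c m - c n))\<^sup>2 < e\<^sup>2" using para[of m n] N by linarith
      thus "dist (c m) (c n) < e" using e by (simp add: dist_norm power_less_imp_less_base)
    qed
  qed
  then obtain p where p: "c \<longlonglongrightarrow> p" using Cauchy_convergent convergent_def by blast
  have pC: "p \<in> C" using C(2) c p closed_sequentially by blast
  have "(\<lambda>n. (norm (x - c n))\<^sup>2) \<longlonglongrightarrow> (norm (x - p))\<^sup>2"
    by (intro tendsto_intros p)
  moreover have "(\<lambda>n. d\<^sup>2 + inverse (real (Suc n))) \<longlonglongrightarrow> d\<^sup>2 + 0"
    by (intro tendsto_intros LIMSEQ_inverse_real_of_nat)
  ultimately have pd: "(norm (x - p))\<^sup>2 \<le> d\<^sup>2"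
    using LIMSEQ_le[of "\<lambda>n. (norm (x - c n))\<^sup>2" _ "\<lambda>n. d\<^sup>2 + inverse (real (Suc n))"]
      less_imp_le[OF cd] by simp
  have "inner (x - p) v = 0" if v: "v \<in> C" for v
  proof (cases "v = 0")
    case False
    \<comment> \<open>The step length that minimises the distance in the direction \<open>v\<close>.\<close>
    define s where "s = inner (x - p) v / inner v v"
    have vv: "inner v v > 0" using False by simp
    have "d\<^sup>2 \<le> (norm (x - (p + s *\<^sub>R v)))\<^sup>2"
      using d0 C pC v by (intro power_mono dle subspace_scale subspace_add) auto
    also have "\<dots> = (norm (x - p))\<^sup>2 - 2 * s * inner (x - p) v + s\<^sup>2 * inner v v"
      unfolding power2_norm_eq_inner
      by (simp add: inner_diff_left inner_diff_right inner_add_left inner_add_right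
          inner_commute algebra_simps power2_eq_square)
    also have "\<dots> = (norm (x - p))\<^sup>2 - (inner (x - p) v)\<^sup>2 / inner v v"
      using vv by (simp add: s_def field_simps power2_eq_square)
    finally have "(inner (x - p) v)\<^sup>2 / inner v v \<le> 0" using pd by linarith
    hence "(inner (x - p) v)\<^sup>2 \<le> 0" using vv by (simp add: divide_le_0_iff)
    thus ?thesis by simp
  qed auto
  with pC that show ?thesis by blast
qed

text \<open>The representing vector spans the orthogonal complement of the kernel; a point outside the kernel
  minus its projection onto the kernel provides it.\<close>

lemma riesz_representation:
  fixes f :: "'a::{real_inner,complete_space} \<Rightarrow> real"
  assumes f: "bounded_linear f"
  shows "\<exists>y. \<forall>x. f x = inner y x"
proof (cases "\<forall>x. f x = 0")
  case True thus ?thesis by (intro exI[of _ 0]) auto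
next
  case False
  then obtain x0 where x0: "f x0 \<noteq> 0" by blast
  interpret f: bounded_linear f by fact
  have sub: "subspace {x. f x = 0}" by (auto simp: subspace_def f.add f.scaleR f.zero)
  have clo: "closed {x. f x = 0}"
    by (intro closed_Collect_eq continuous_intros f.continuous_on)
  obtain p where p: "f p = 0" "\<And>c. f c = 0 \<Longrightarrow> inner (x0 - p) c = 0"
    by (rule orthogonal_projection_exists[OF sub clo, of x0]) auto
  define z where "z = x0 - p"
  have fz: "f z \<noteq> 0" using x0 p by (simp add: z_def f.diff)
  have zz: "inner z z \<noteq> 0" using fz f.zero by auto
  have "f x = inner ((f z / inner z z) *\<^sub>R z) x" for x
  proof -
    have "f (x - (f x / f z) *\<^sub>R z) = 0" using fz by (simp add: f.diff f.scaleR)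
    hence "inner z (x - (f x / f z) *\<^sub>R z) = 0" unfolding z_def[symmetric]
      using p(2)[folded z_def] by blast
    thus ?thesis using fz zz by (simp add: inner_diff_right field_simps)
  qed
  thus ?thesis by blast
qed

lemma real_adjoint_exists:
  fixes a :: "'a::{real_inner,complete_space} \<Rightarrow>\<^sub>L 'a"
  obtains b :: "'a \<Rightarrow>\<^sub>L 'a" where "\<And>u v. inner (blinfun_apply b u) v = inner u (blinfun_apply a v)"
proof -
  have "\<exists>y. \<forall>v. inner u (a v) = inner y v" for u
    by (rule riesz_representation)
       (intro bounded_linear_inner_right_comp blinfun.bounded_linear_right)
  then obtain g where g: "\<And>u v. inner (g u) v = inner u (a v)" by metis
  have "bounded_linear g"
  proof (rule bounded_linear_intro[where K = "norm a"])
    show "g (x + y) = g x + g y" for x y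
      by (rule vector_eq_rdot[THEN iffD1]) (simp add: g inner_add_left inner_add_right)
    show "g (r *\<^sub>R x) = r *\<^sub>R g x" for r x
      by (rule vector_eq_rdot[THEN iffD1]) (simp add: g inner_add_left inner_add_right)
    show "norm (g x) \<le> norm x * norm a" for x
    proof (cases "g x = 0")
      case False
      have "norm (g x) * norm (g x) = inner x (a (g x))"
        by (simp flip: g add: power2_norm_eq_inner flip: power2_eq_square)
      also have "\<dots> \<le> norm x * norm (a (g x))" by (rule norm_cauchy_schwarz)
      also have "\<dots> \<le> norm x * (norm a * norm (g x))"
        by (intro mult_left_mono norm_blinfun) auto
      finally show ?thesis using False by (simp add: mult.assoc[symmetric])
    qed auto
  qed
  thus ?thesis using that[of "Blinfun g"] g by (simp add: bounded_linear_Blinfun_apply)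
qed

lemma bopsD: "a \<in> bops \<Longrightarrow> blinfun_apply a (c *\<^sub>C v) = c *\<^sub>C blinfun_apply a v"
  by (simp add: bops_def)

lemma op_scaleC_apply [simp]: "blinfun_apply (op_scaleC c a) v = c *\<^sub>C blinfun_apply a v"
  unfolding op_scaleC_def
  by (subst bounded_linear_Blinfun_apply)
     (auto intro: bounded_linear_compose[OF scaleC.bounded_linear_right blinfun.bounded_linear_right])

lemma op_adj_unique:
  assumes "\<And>u v. cinner (blinfun_apply b u) v = cinner u (blinfun_apply a v)"
  shows "op_adj a = b"
  unfolding op_adj_def
proof (rule the_equality)
  fix b' assume "\<forall>u v. cinner (blinfun_apply b' u) v = cinner u (blinfun_apply a v)"
  thus "b' = b" using assms by (auto intro!: blinfun_eqI cinner_eqI[of "b' _" "b _"])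
qed (use assms in auto)

text \<open>The real adjoint is also the complex one, because the imaginary part of the complex inner product
  is the real inner product with the vector rotated by \<open>\<i>\<close>, and the operator commutes with that
  rotation.\<close>

lemma cinner_op_adj_left:
  assumes "a \<in> bops"
  shows "cinner (blinfun_apply (op_adj a) u) v = cinner u (blinfun_apply a v)"
proof -
  obtain b where b: "\<And>u v. inner (blinfun_apply b u) v = inner u (blinfun_apply a v)"
    by (rule real_adjoint_exists[of a]) auto
  have "cinner (b u) v = cinner u (a v)" for u v
    using b[of u v] b[of u "\<i> *\<^sub>C v"] bopsD[OF assms, of \<i> v]
    by (intro complex_eqI) (simp_all add: Im_cinner flip: inner_eq_Re_cinner)
  with op_adj_unique[of b a] show ?thesis by simp
qed

lemma cinner_op_adj_right:
  assumes "a \<in> bops"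
  shows "cinner u (blinfun_apply (op_adj a) v) = cinner (blinfun_apply a u) v"
  using cinner_op_adj_left[OF assms, of v u] by (metis cinner_commute)

lemma bops_adj:
  assumes "a \<in> bops"
  shows "op_adj a \<in> bops"
  unfolding bops_def
proof (intro CollectI allI)
  show "op_adj a (c *\<^sub>C v) = c *\<^sub>C op_adj a v" for c v
    by (rule cinner_eqI) (simp add: cinner_op_adj_left[OF assms] cinner_scaleC_left)
qed

lemma op_adj_adj: "a \<in> bops \<Longrightarrow> op_adj (op_adj a) = a"
  by (rule op_adj_unique) (simp add: cinner_op_adj_right)

lemma op_adj_comp: "a \<in> bops \<Longrightarrow> b \<in> bops \<Longrightarrow> op_adj (a o\<^sub>L b) = op_adj b o\<^sub>L op_adj a"
  by (rule op_adj_unique) (simp add: cinner_op_adj_left)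

lemma op_adj_add: "a \<in> bops \<Longrightarrow> b \<in> bops \<Longrightarrow> op_adj (a + b) = op_adj a + op_adj b"
  by (rule op_adj_unique)
     (simp add: cinner_op_adj_left blinfun.add_left cinner_add_left cinner_add_right)

lemma op_adj_diff: "a \<in> bops \<Longrightarrow> b \<in> bops \<Longrightarrow> op_adj (a - b) = op_adj a - op_adj b"
  by (rule op_adj_unique)
     (simp add: cinner_op_adj_left blinfun.diff_left cinner.diff_left cinner.diff_right)

lemma op_adj_scaleR: "a \<in> bops \<Longrightarrow> op_adj (r *\<^sub>R a) = r *\<^sub>R op_adj a"
  by (rule op_adj_unique)
     (simp add: cinner_op_adj_left blinfun.scaleR_left cinner.scaleR_left cinner.scaleR_right)

lemma op_adj_scaleC: "a \<in> bops \<Longrightarrow> op_adj (op_scaleC c a) = op_scaleC (cnj c) (op_adj a)"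
  by (rule op_adj_unique) (simp add: cinner_op_adj_left cinner_scaleC_left cinner_scaleC_right)

lemma op_adj_id [simp]: "op_adj id_blinfun = id_blinfun"
  by (rule op_adj_unique) simp

lemma op_adj_zero [simp]: "op_adj 0 = 0"
  by (rule op_adj_unique) (simp add: cinner.zero_left cinner.zero_right)

lemma op_scaleC_of_real: "op_scaleC (of_real r) a = r *\<^sub>R a"
  by (rule blinfun_eqI) (simp add: scaleR_scaleC blinfun.scaleR_left)

lemma op_scaleC_zero [simp]: "op_scaleC 0 a = 0"
  by (rule blinfun_eqI) (simp)

section \<open>Commutants\<close>

lemma commutant_bops: "commutant S \<subseteq> bops"
  by (auto simp: commutant_def)

lemma commutant_id: "id_blinfun \<in> commutant S"
  by (auto simp: commutant_def bops_def intro!: blinfun_eqI)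

lemma commutant_iff: "a \<in> commutant S \<longleftrightarrow> a \<in> bops \<and> (\<forall>b\<in>S. \<forall>v. a (b v) = b (a v))"
  by (auto simp: commutant_def intro!: blinfun_eqI) (metis blinfun_apply_blinfun_compose)

lemma commutant_comp: "a \<in> commutant S \<Longrightarrow> b \<in> commutant S \<Longrightarrow> a o\<^sub>L b \<in> commutant S"
  by (auto simp: commutant_iff bops_def)

lemma commutant_add: "a \<in> commutant S \<Longrightarrow> b \<in> commutant S \<Longrightarrow> a + b \<in> commutant S"
  by (auto simp: commutant_iff bops_def blinfun.add_left blinfun.add_right scaleC_add_right)

lemma commutant_scaleC:
  assumes "S \<subseteq> bops" "a \<in> commutant S"
  shows "op_scaleC c a \<in> commutant S"
  unfolding commutant_def
proof (intro CollectI conjI ballI)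
  show "op_scaleC c a \<in> bops"
    using assms by (auto simp: commutant_def bops_def scaleC_scaleC mult.commute)
  fix b assume b: "b \<in> S"
  hence "a o\<^sub>L b = b o\<^sub>L a" using assms by (auto simp: commutant_def)
  hence "a (b v) = b (a v)" for v by (metis blinfun_apply_blinfun_compose)
  thus "op_scaleC c a o\<^sub>L b = b o\<^sub>L op_scaleC c a"
    using assms b by (intro blinfun_eqI) (auto simp: bopsD)
qed

lemma commutant_antimono: "S \<subseteq> T \<Longrightarrow> commutant T \<subseteq> commutant S"
  by (auto simp: commutant_def)

lemma bicommutant_superset: "S \<subseteq> bops \<Longrightarrow> S \<subseteq> commutant (commutant S)"
  by (auto simp: commutant_def)

lemma commutant_adj:
  assumes "S \<subseteq> bops" "\<And>b. b \<in> S \<Longrightarrow> op_adj b \<in> S" "a \<in> commutant S"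
  shows "op_adj a \<in> commutant S"
  unfolding commutant_def
proof (intro CollectI conjI ballI)
  have a: "a \<in> bops" using assms by (auto simp: commutant_def)
  show "op_adj a \<in> bops" using a by (rule bops_adj)
  fix b assume b: "b \<in> S"
  hence bb: "b \<in> bops" "op_adj b \<in> bops" using assms bops_adj by auto
  have "a o\<^sub>L op_adj b = op_adj b o\<^sub>L a" using assms b by (auto simp: commutant_def)
  hence "op_adj (a o\<^sub>L op_adj b) = op_adj (op_adj b o\<^sub>L a)" by simp
  thus "op_adj a o\<^sub>L b = b o\<^sub>L op_adj a"
    using a bb by (simp add: op_adj_comp op_adj_adj)
qed

lemma von_neumann_bicommutant:
  assumes "S \<subseteq> bops" "\<And>b. b \<in> S \<Longrightarrow> op_adj b \<in> S"
  shows "von_neumann_algebra (commutant (commutant S))"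
  unfolding von_neumann_algebra_def
proof (intro conjI ballI)
  have 1: "op_adj b \<in> commutant S" if "b \<in> commutant S" for b
    using assms that by (rule commutant_adj)
  show "op_adj a \<in> commutant (commutant S)" if "a \<in> commutant (commutant S)" for a
    using commutant_bops 1 that by (rule commutant_adj)
  have "commutant S \<subseteq> commutant (commutant (commutant S))"
    by (rule bicommutant_superset) (rule commutant_bops)
  moreover have "commutant (commutant (commutant S)) \<subseteq> commutant S"
    by (rule commutant_antimono[OF bicommutant_superset[OF assms(1)]])
  ultimately show "commutant (commutant (commutant (commutant S))) = commutant (commutant S)"
    by simp
qed

text \<open>The bicommutant is itself a von Neumann algebra, as a triple commutant is a commutant. It lies in
  every von Neumann algebra \<open>T\<close> containing the set, since taking commutants twice is monotone and
  returns \<open>T\<close>.\<close>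

lemma hull_von_neumann_algebra:
  assumes "S \<subseteq> bops" "\<And>b. b \<in> S \<Longrightarrow> op_adj b \<in> S"
  shows "von_neumann_algebra hull S = commutant (commutant S)"
proof
  show "von_neumann_algebra hull S \<subseteq> commutant (commutant S)"
    by (rule hull_minimal) (simp_all add: bicommutant_superset assms von_neumann_bicommutant)
  show "commutant (commutant S) \<subseteq> von_neumann_algebra hull S"
    unfolding hull_def
  proof (rule Inter_greatest)
    fix T assume "T \<in> {t. von_neumann_algebra t \<and> S \<subseteq> t}"
    hence T: "commutant (commutant T) = T" "S \<subseteq> T"
      by (auto simp: von_neumann_algebra_def)
    show "commutant (commutant S) \<subseteq> T"
      using commutant_antimono[OF commutant_antimono[OF T(2)]] T(1) by simp
  qed
qed

lemma
  assumes "von_neumann_algebra M"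
  shows vn_bops: "M \<subseteq> bops"
    and vn_id: "id_blinfun \<in> M"
    and vn_add: "\<And>a b. a \<in> M \<Longrightarrow> b \<in> M \<Longrightarrow> a + b \<in> M"
    and vn_comp: "\<And>a b. a \<in> M \<Longrightarrow> b \<in> M \<Longrightarrow> a o\<^sub>L b \<in> M"
    and vn_scaleC: "\<And>c a. a \<in> M \<Longrightarrow> op_scaleC c a \<in> M"
    and vn_adj: "\<And>a. a \<in> M \<Longrightarrow> op_adj a \<in> M"
proof -
  have M: "M = commutant (commutant M)" and adj: "\<And>a. a \<in> M \<Longrightarrow> op_adj a \<in> M"
    using assms unfolding von_neumann_algebra_def by auto
  show "M \<subseteq> bops" by (subst M) (rule commutant_bops)
  show "id_blinfun \<in> M" by (subst M) (rule commutant_id)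
  show "\<And>a b. a \<in> M \<Longrightarrow> b \<in> M \<Longrightarrow> a + b \<in> M" using commutant_add M by blast
  show "\<And>a b. a \<in> M \<Longrightarrow> b \<in> M \<Longrightarrow> a o\<^sub>L b \<in> M" using commutant_comp M by blast
  show "\<And>c a. a \<in> M \<Longrightarrow> op_scaleC c a \<in> M" using commutant_scaleC[OF commutant_bops] M by blast
  show "\<And>a. a \<in> M \<Longrightarrow> op_adj a \<in> M" by (rule adj)
qed

lemma
  assumes "von_neumann_algebra M"
  shows vn_scaleR: "\<And>r a. a \<in> M \<Longrightarrow> r *\<^sub>R a \<in> M"
    and vn_zero: "0 \<in> M"
    and vn_diff: "\<And>a b. a \<in> M \<Longrightarrow> b \<in> M \<Longrightarrow> a - b \<in> M"
    and vn_subspace: "subspace M"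
proof -
  show s: "\<And>r a. a \<in> M \<Longrightarrow> r *\<^sub>R a \<in> M"
    using vn_scaleC[OF assms] by (metis op_scaleC_of_real)
  show z: "0 \<in> M" using s[OF vn_id[OF assms], of 0] by simp
  show "subspace M" by (simp add: subspace_def s z vn_add[OF assms])
  thus "\<And>a b. a \<in> M \<Longrightarrow> b \<in> M \<Longrightarrow> a - b \<in> M" by (rule subspace_diff)
qed

section \<open>Square-summable sequences of vectors\<close>

lemma summable_norm_mult:
  fixes f g :: "nat \<Rightarrow> 'a::real_normed_vector"
  assumes "summable (\<lambda>n. (norm (f n))\<^sup>2)" "summable (\<lambda>n. (norm (g n))\<^sup>2)"
  shows "summable (\<lambda>n. norm (f n) * norm (g n))"
proof (rule summable_comparison_test'[OF summable_add[OF assms]])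
  fix n :: nat
  have "0 \<le> (norm (f n) - norm (g n))\<^sup>2" by simp
  moreover have "0 \<le> norm (f n) * norm (g n)" by simp
  ultimately show "norm (norm (f n) * norm (g n)) \<le> (norm (f n))\<^sup>2 + (norm (g n))\<^sup>2"
    unfolding power2_diff real_norm_def abs_mult abs_norm_cancel by linarith
qed

lemma square_summable_add:
  fixes f g :: "nat \<Rightarrow> 'a::real_normed_vector"
  assumes "summable (\<lambda>n. (norm (f n))\<^sup>2)" "summable (\<lambda>n. (norm (g n))\<^sup>2)"
  shows "summable (\<lambda>n. (norm (f n + g n))\<^sup>2)"
proof (rule summable_comparison_test')
  show "summable (\<lambda>n. (norm (f n))\<^sup>2 + (norm (g n))\<^sup>2 + 2 * (norm (f n) * norm (g n)))"
    using assms summable_norm_mult[OF assms] by (intro summable_add summable_mult)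
  fix n :: nat
  have "(norm (f n + g n))\<^sup>2 \<le> (norm (f n) + norm (g n))\<^sup>2"
    by (intro power_mono norm_triangle_ineq) auto
  thus "norm ((norm (f n + g n))\<^sup>2) \<le>
      (norm (f n))\<^sup>2 + (norm (g n))\<^sup>2 + 2 * (norm (f n) * norm (g n))"
    by (simp add: power2_sum)
qed

text \<open>The Hilbert space \<open>H \<otimes> \<ell>\<^sup>2\<close>. A normal functional on operators of \<open>H\<close> becomes a
  single matrix coefficient there.\<close>

typedef (overloaded) ('a::chilbert_space) ell2 =
  "{f :: nat \<Rightarrow> 'a. summable (\<lambda>n. (norm (f n))\<^sup>2)}"
  morphisms coord Ell2
  by (rule exI[of _ "\<lambda>_. 0"]) simp

lemma coord_summable: "summable (\<lambda>n. (norm (coord x n))\<^sup>2)"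
  using coord[of x] by simp

lemma coord_Ell2: "summable (\<lambda>n. (norm (f n))\<^sup>2) \<Longrightarrow> coord (Ell2 f) = f"
  by (simp add: Ell2_inverse)

lemma ell2_eqI: "(\<And>n. coord x n = coord y n) \<Longrightarrow> x = y"
  by (metis coord_inject ext)

instantiation ell2 :: (chilbert_space) real_inner
begin

definition zero_ell2 :: "'a ell2" where "zero_ell2 = Ell2 (\<lambda>_. 0)"
definition plus_ell2 :: "'a ell2 \<Rightarrow> 'a ell2 \<Rightarrow> 'a ell2"
  where "plus_ell2 x y = Ell2 (\<lambda>n. coord x n + coord y n)"
definition uminus_ell2 :: "'a ell2 \<Rightarrow> 'a ell2"
  where "uminus_ell2 x = Ell2 (\<lambda>n. - coord x n)"
definition minus_ell2 :: "'a ell2 \<Rightarrow> 'a ell2 \<Rightarrow> 'a ell2"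
  where "minus_ell2 x y = Ell2 (\<lambda>n. coord x n - coord y n)"
definition scaleR_ell2 :: "real \<Rightarrow> 'a ell2 \<Rightarrow> 'a ell2"
  where "scaleR_ell2 r x = Ell2 (\<lambda>n. r *\<^sub>R coord x n)"
definition inner_ell2 :: "'a ell2 \<Rightarrow> 'a ell2 \<Rightarrow> real"
  where "inner_ell2 x y = (\<Sum>n. inner (coord x n) (coord y n))"
definition norm_ell2 :: "'a ell2 \<Rightarrow> real"
  where "norm_ell2 x = sqrt (inner x x)"
definition dist_ell2 :: "'a ell2 \<Rightarrow> 'a ell2 \<Rightarrow> real"
  where "dist_ell2 x y = norm (x - y)"
definition sgn_ell2 :: "'a ell2 \<Rightarrow> 'a ell2"
  where "sgn_ell2 x = inverse (norm x) *\<^sub>R x"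
definition uniformity_ell2 :: "('a ell2 \<times> 'a ell2) filter"
  where "uniformity_ell2 = (INF e\<in>{0<..}. principal {(x, y). dist x y < e})"
definition open_ell2 :: "'a ell2 set \<Rightarrow> bool"
  where "open_ell2 U = (\<forall>x\<in>U. eventually (\<lambda>(x', y). x' = x \<longrightarrow> y \<in> U) uniformity)"

lemma coord_zero: "coord 0 n = 0"
  by (simp add: zero_ell2_def coord_Ell2)

lemma coord_add: "coord (x + y) n = coord x n + coord y n"
  by (simp add: plus_ell2_def coord_Ell2 square_summable_add coord_summable)

lemma coord_minus: "coord (- x) n = - coord x n"
  by (simp add: uminus_ell2_def coord_Ell2 coord_summable)

lemma coord_diff: "coord (x - y) n = coord x n - coord y n"
proof -
  have "summable (\<lambda>n. (norm (coord x n + - coord y n))\<^sup>2)"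
    by (rule square_summable_add) (simp_all add: coord_summable)
  thus ?thesis by (simp add: minus_ell2_def coord_Ell2)
qed

lemma coord_scaleR: "coord (r *\<^sub>R x) n = r *\<^sub>R coord x n"
  by (simp add: scaleR_ell2_def coord_Ell2 coord_summable power_mult_distrib summable_mult)

lemma summable_inner_coord: "summable (\<lambda>n. inner (coord x n) (coord y n))"
  by (rule summable_comparison_test'[OF summable_norm_mult[OF coord_summable coord_summable]])
     (use Cauchy_Schwarz_ineq2 in auto)

instance
proof
  fix x y z :: "'a ell2" and r s :: real
  show "x + y + z = x + (y + z)" "x + y = y + x" "0 + x = x" "- x + x = 0" "x - y = x + - y"
    "r *\<^sub>R (x + y) = r *\<^sub>R x + r *\<^sub>R y" "(r + s) *\<^sub>R x = r *\<^sub>R x + s *\<^sub>R x"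
    "r *\<^sub>R s *\<^sub>R x = (r * s) *\<^sub>R x" "1 *\<^sub>R x = x"
    by (auto intro!: ell2_eqI
        simp: coord_zero coord_add coord_minus coord_diff coord_scaleR algebra_simps)
  show "inner x y = inner y x" by (simp add: inner_ell2_def inner_commute)
  show "inner (x + y) z = inner x z + inner y z"
    by (simp add: inner_ell2_def coord_add inner_add_left suminf_add summable_inner_coord)
  show "inner (r *\<^sub>R x) y = r * inner x y"
    by (simp add: inner_ell2_def coord_scaleR suminf_mult summable_inner_coord)
  show "0 \<le> inner x x"
    unfolding inner_ell2_def by (rule suminf_nonneg[OF summable_inner_coord]) simp
  show "inner x x = 0 \<longleftrightarrow> x = 0"
  proof
    assume "inner x x = 0"
    hence "\<forall>n. inner (coord x n) (coord x n) = 0"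
      unfolding inner_ell2_def by (subst (asm) suminf_eq_zero_iff[OF summable_inner_coord]) auto
    thus "x = 0" by (intro ell2_eqI) (simp add: coord_zero)
  qed (simp add: inner_ell2_def coord_zero)
qed (rule norm_ell2_def dist_ell2_def sgn_ell2_def uniformity_ell2_def open_ell2_def)+

end

lemma norm_ell2_square: "(norm (x::'a::chilbert_space ell2))\<^sup>2 = (\<Sum>n. (norm (coord x n))\<^sup>2)"
  by (simp add: power2_norm_eq_inner inner_ell2_def)

lemma sum_norm_coord_le: "(\<Sum>n<N. (norm (coord x n))\<^sup>2) \<le> (norm x)\<^sup>2"
  unfolding norm_ell2_square by (rule sum_le_suminf[OF coord_summable]) auto

lemma norm_coord_le: "norm (coord x n) \<le> norm x"
proof -
  have "(norm (coord x n))\<^sup>2 \<le> (\<Sum>k<Suc n. (norm (coord x k))\<^sup>2)"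
    by (intro member_le_sum) auto
  also have "\<dots> \<le> (norm x)\<^sup>2" by (rule sum_norm_coord_le)
  finally show ?thesis by (rule power2_le_imp_le) simp
qed

lemma norm_ell2_le:
  assumes "\<And>n. norm (coord x n) \<le> K * norm (coord y n)" "K \<ge> 0"
  shows "norm x \<le> K * norm y"
proof -
  have "(norm x)\<^sup>2 \<le> (\<Sum>n. K\<^sup>2 * (norm (coord y n))\<^sup>2)"
    unfolding norm_ell2_square
  proof (rule suminf_le)
    show "(norm (coord x n))\<^sup>2 \<le> K\<^sup>2 * (norm (coord y n))\<^sup>2" for n
      unfolding power_mult_distrib[symmetric] using assms by (intro power_mono) auto
  qed (auto intro: coord_summable summable_mult)
  also have "\<dots> = (K * norm y)\<^sup>2"
    by (simp add: suminf_mult coord_summable norm_ell2_square power_mult_distrib)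
  finally show ?thesis using assms(2) by (auto intro: power2_le_imp_le)
qed

lemma bounded_linear_coord: "bounded_linear (\<lambda>x. coord x n)"
  by (rule bounded_linear_intro[where K = 1])
     (auto simp: coord_add coord_scaleR norm_coord_le)

text \<open>Coordinatewise limits exist, and the bound on finite partial sums survives in the
  coordinatewise limit, uniformly in the number of coordinates.\<close>

instance ell2 :: (chilbert_space) complete_space
proof
  fix X :: "nat \<Rightarrow> 'a ell2" assume X: "Cauchy X"
  have "convergent (\<lambda>k. coord (X k) n)" for n
    by (rule Cauchy_convergent) (rule bounded_linear.Cauchy[OF bounded_linear_coord X])
  hence "\<forall>n. \<exists>l. (\<lambda>k. coord (X k) n) \<longlonglongrightarrow> l" by (simp add: convergent_def)
  then obtain L where L: "\<And>n. (\<lambda>k. coord (X k) n) \<longlonglongrightarrow> L n"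
    by (auto dest!: choice)
  have bound: "(\<Sum>n<J. (norm (coord (X m) n - L n))\<^sup>2) \<le> e\<^sup>2"
    if N: "\<And>m k. m \<ge> N \<Longrightarrow> k \<ge> N \<Longrightarrow> norm (X m - X k) < e" and m: "m \<ge> N" for J m N e
  proof (rule LIMSEQ_le_const2)
    show "(\<lambda>k. \<Sum>n<J. (norm (coord (X m) n - coord (X k) n))\<^sup>2)
        \<longlonglongrightarrow> (\<Sum>n<J. (norm (coord (X m) n - L n))\<^sup>2)"
      by (intro tendsto_intros L)
    have "(\<Sum>n<J. (norm (coord (X m) n - coord (X k) n))\<^sup>2) \<le> e\<^sup>2" if "k \<ge> N" for k
    proof -
      have "(\<Sum>n<J. (norm (coord (X m) n - coord (X k) n))\<^sup>2) \<le> (norm (X m - X k))\<^sup>2"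
        using sum_norm_coord_le[of "X m - X k" J] by (simp add: coord_diff)
      also have "\<dots> \<le> e\<^sup>2" using N[OF m that] by (intro power_mono) auto
      finally show ?thesis .
    qed
    thus "\<exists>N. \<forall>k\<ge>N. (\<Sum>n<J. (norm (coord (X m) n - coord (X k) n))\<^sup>2) \<le> e\<^sup>2" by blast
  qed
  have summ: "summable (\<lambda>n. (norm (coord (X m) n - L n))\<^sup>2)"
    if N: "\<And>m k. m \<ge> N \<Longrightarrow> k \<ge> N \<Longrightarrow> norm (X m - X k) < e" and m: "m \<ge> N" for m N e
    by (rule bounded_imp_summable[where B = "e\<^sup>2"])
       (use bound[OF N m, of "Suc _"] in \<open>auto simp: lessThan_Suc_atMost\<close>)
  have ex: "\<exists>N. \<forall>m k. m \<ge> N \<longrightarrow> k \<ge> N \<longrightarrow> norm (X m - X k) < e" if "e > 0" for e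
    using X that unfolding Cauchy_def dist_norm by blast
  have "summable (\<lambda>n. (norm (L n))\<^sup>2)"
  proof -
    obtain N where N: "\<And>m k. m \<ge> N \<Longrightarrow> k \<ge> N \<Longrightarrow> norm (X m - X k) < 1"
      using ex[of 1] by auto
    have "summable (\<lambda>n. (norm (- (coord (X N) n - L n) + coord (X N) n))\<^sup>2)"
      by (rule square_summable_add)
         (use summ[OF N order_refl] in \<open>simp_all add: coord_summable norm_minus_commute\<close>)
    thus ?thesis by simp
  qed
  hence cL: "coord (Ell2 L) = L" by (rule coord_Ell2)
  have "X \<longlonglongrightarrow> Ell2 L"
  proof (rule metric_LIMSEQ_I)
    fix e :: real assume e: "e > 0"
    obtain N where N: "\<And>m k. m \<ge> N \<Longrightarrow> k \<ge> N \<Longrightarrow> norm (X m - X k) < e/2"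
      using ex[of "e/2"] e by auto
    have "dist (X m) (Ell2 L) < e" if m: "m \<ge> N" for m
    proof -
      have "(norm (X m - Ell2 L))\<^sup>2 \<le> (e/2)\<^sup>2"
        unfolding norm_ell2_square coord_diff cL
        using summ[OF N m] bound[OF N m] by (intro suminf_le_const) auto
      hence "norm (X m - Ell2 L) \<le> e/2" using e by (auto intro: power2_le_imp_le)
      thus ?thesis using e by (simp add: dist_norm)
    qed
    thus "\<exists>N. \<forall>m\<ge>N. dist (X m) (Ell2 L) < e" by blast
  qed
  thus "convergent X" by (auto simp: convergent_def)
qed

instantiation ell2 :: (chilbert_space) chilbert_space
begin

definition scaleC_ell2 :: "complex \<Rightarrow> 'a ell2 \<Rightarrow> 'a ell2"
  where "scaleC_ell2 c x = Ell2 (\<lambda>n. c *\<^sub>C coord x n)"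
definition cinner_ell2 :: "'a ell2 \<Rightarrow> 'a ell2 \<Rightarrow> complex"
  where "cinner_ell2 x y = (\<Sum>n. cinner (coord x n) (coord y n))"

lemma coord_scaleC: "coord (c *\<^sub>C x) n = c *\<^sub>C coord x n"
  by (simp add: scaleC_ell2_def coord_Ell2 coord_summable norm_scaleC power_mult_distrib
      summable_mult)

lemma summable_cinner_coord:
  "summable (\<lambda>n. cinner (coord x n) (coord y n))"
  by (rule summable_comparison_test'[OF summable_norm_mult[OF coord_summable coord_summable]])
     (use Cauchy_Schwarz_cinner in auto)

instance
proof
  fix x y z :: "'a ell2" and r :: real and c d :: complex
  show "r *\<^sub>R x = complex_of_real r *\<^sub>C x" "c *\<^sub>C (x + y) = c *\<^sub>C x + c *\<^sub>C y"
    "(c + d) *\<^sub>C x = c *\<^sub>C x + d *\<^sub>C x" "c *\<^sub>C d *\<^sub>C x = (c * d) *\<^sub>C x"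
    by (auto intro!: ell2_eqI simp: coord_add coord_scaleR coord_scaleC scaleR_scaleC
        scaleC_add_right scaleC_add_left scaleC_scaleC)
  show "cinner x y = cnj (cinner y x)"
  proof -
    have "(\<lambda>n. cnj (cinner (coord y n) (coord x n))) sums cnj (cinner y x)"
      unfolding cinner_ell2_def sums_cnj by (rule summable_sums[OF summable_cinner_coord])
    moreover have "cnj (cinner (coord y n) (coord x n)) = cinner (coord x n) (coord y n)" for n
      by (rule cinner_commute[symmetric])
    ultimately show ?thesis by (simp add: cinner_ell2_def sums_iff)
  qed
  show "cinner (x + y) z = cinner x z + cinner y z"
    by (simp add: cinner_ell2_def coord_add cinner_add_left suminf_add summable_cinner_coord)
  show "cinner (c *\<^sub>C x) y = c * cinner x y"
    by (simp add: cinner_ell2_def coord_scaleC cinner_scaleC_left suminf_mult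
        summable_cinner_coord)
  show "inner x y = Re (cinner x y)"
    by (simp add: cinner_ell2_def inner_ell2_def inner_eq_Re_cinner Re_suminf
        summable_cinner_coord)
qed

end

definition single :: "nat \<Rightarrow> 'a::chilbert_space \<Rightarrow> 'a ell2"
  where "single n u = Ell2 (\<lambda>m. if m = n then u else 0)"

lemma coord_single: "coord (single n u) m = (if m = n then u else 0)"
proof -
  have "summable (\<lambda>m. (norm (if m = n then u else 0))\<^sup>2)"
    by (rule summable_finite[of "{n}"]) auto
  thus ?thesis by (simp add: single_def coord_Ell2)
qed

lemma norm_single: "norm (single n u) = norm u"
proof -
  have "(norm (single n u))\<^sup>2 = (\<Sum>m\<in>{n}. (norm (coord (single n u) m))\<^sup>2)"
    unfolding norm_ell2_square by (rule suminf_finite) (auto simp: coord_single)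
  thus ?thesis by (simp add: coord_single)
qed

lemma bounded_linear_single: "bounded_linear (single n)"
  by (rule bounded_linear_intro[where K = 1])
     (auto simp: norm_single intro!: ell2_eqI simp: coord_single coord_add coord_scaleR)

lemma coord_sum: "coord (sum f I) n = (\<Sum>i\<in>I. coord (f i) n)"
  by (induction I rule: infinite_finite_induct) (auto simp: coord_add coord_zero)

text \<open>This decomposition is what lets a bounded operator on sequences be recovered from its matrix
  entries.\<close>

lemma single_sums: "(\<lambda>n. single n (coord x n)) sums x"
proof -
  have c: "coord (x - (\<Sum>n<N. single n (coord x n))) m = (if m < N then 0 else coord x m)" for N m
    by (simp add: coord_diff coord_sum coord_single)
  have "(\<Sum>m. (norm (coord x m))\<^sup>2) = (norm (x - (\<Sum>n<N. single n (coord x n))))\<^sup>2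
      + (\<Sum>m<N. (norm (coord x m))\<^sup>2)" for N
  proof -
    have "(\<lambda>m. if m \<in> {..<N} then 0 else (norm (coord x m))\<^sup>2) sums
       ((\<Sum>m. (norm (coord x m))\<^sup>2) - (\<Sum>m<N. (norm (coord x m))\<^sup>2))"
      by (rule sums_If_finite_set'[OF summable_sums[OF coord_summable]]) (auto simp: sum_negf)
    moreover have "(\<lambda>m. (norm (coord (x - (\<Sum>n<N. single n (coord x n))) m))\<^sup>2) =
        (\<lambda>m. if m \<in> {..<N} then 0 else (norm (coord x m))\<^sup>2)"
      unfolding c by (auto simp: fun_eq_iff)
    ultimately show ?thesis by (simp add: norm_ell2_square sums_iff)
  qed
  hence eq: "(norm (x - (\<Sum>n<N. single n (coord x n))))\<^sup>2 =
      (\<Sum>m. (norm (coord x m))\<^sup>2) - (\<Sum>m<N. (norm (coord x m))\<^sup>2)" for N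
    by (metis add_diff_cancel_right')
  have "(\<lambda>N. (\<Sum>m. (norm (coord x m))\<^sup>2) - (\<Sum>m<N. (norm (coord x m))\<^sup>2)) \<longlonglongrightarrow>
      (\<Sum>m. (norm (coord x m))\<^sup>2) - (\<Sum>m. (norm (coord x m))\<^sup>2)"
    by (intro tendsto_intros summable_LIMSEQ coord_summable)
  hence "(\<lambda>N. (norm (x - (\<Sum>n<N. single n (coord x n))))\<^sup>2) \<longlonglongrightarrow> 0" by (simp add: eq)
  hence "(\<lambda>N. sqrt ((norm (x - (\<Sum>n<N. single n (coord x n))))\<^sup>2)) \<longlonglongrightarrow> sqrt 0"
    by (rule tendsto_real_sqrt)
  hence "(\<lambda>N. norm ((\<Sum>n<N. single n (coord x n)) - x)) \<longlonglongrightarrow> 0"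
    by (simp add: norm_minus_commute)
  thus ?thesis unfolding sums_def
    using LIM_zero_cancel tendsto_norm_zero_iff by blast
qed

text \<open>Places a sequence on a prescribed infinite set of indices, so that two sequences can live
  orthogonally in the same space.\<close>

definition spread :: "(nat \<Rightarrow> nat) \<Rightarrow> 'a::chilbert_space ell2 \<Rightarrow> 'a ell2"
  where "spread g x = Ell2 (\<lambda>n. if n \<in> range g then coord x (inv g n) else 0)"

lemma coord_spread:
  assumes g: "strict_mono g"
  shows "coord (spread g x) n = (if n \<in> range g then coord x (inv g n) else 0)"
proof -
  let ?f = "\<lambda>n. if n \<in> range g then coord x (inv g n) else 0"
  have "(\<lambda>n. (norm (?f (g n)))\<^sup>2) = (\<lambda>n. (norm (coord x n))\<^sup>2)"
    using strict_mono_imp_inj_on[OF g] by (simp add: inv_f_f)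
  hence "summable (\<lambda>n. (norm (?f (g n)))\<^sup>2)" by (simp only: coord_summable)
  hence "summable (\<lambda>n. (norm (?f n))\<^sup>2)"
    by (subst (asm) summable_mono_reindex[OF g]) auto
  thus ?thesis unfolding spread_def by (subst coord_Ell2) auto
qed

lemma cinner_spread:
  assumes g: "strict_mono g"
  shows "cinner (spread g x) (spread g y) = cinner x y"
proof -
  have "cinner (spread g x) (spread g y) =
      (\<Sum>n. cinner (coord (spread g x) (g n)) (coord (spread g y) (g n)))"
    unfolding cinner_ell2_def
    by (rule suminf_mono_reindex[OF g, symmetric])
       (simp add: coord_spread[OF g] cinner.zero_left)
  also have "\<dots> = cinner x y"
    using strict_mono_imp_inj_on[OF g] by (simp add: coord_spread[OF g] inv_f_f cinner_ell2_def)
  finally show ?thesis .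
qed

lemma cinner_spread_disjoint:
  assumes "strict_mono g" "strict_mono h" "range g \<inter> range h = {}"
  shows "cinner (spread g x) (spread h y) = 0"
proof -
  have "cinner (coord (spread g x) n) (coord (spread h y) n) = 0" for n
    using assms by (auto simp: coord_spread cinner.zero_left cinner.zero_right)
  thus ?thesis by (simp add: cinner_ell2_def)
qed

section \<open>Amplified operators\<close>

definition amp :: "('a::chilbert_space \<Rightarrow>\<^sub>L 'a) \<Rightarrow> 'a ell2 \<Rightarrow> 'a ell2"
  where "amp a x = Ell2 (\<lambda>n. blinfun_apply a (coord x n))"

lemma coord_amp: "coord (amp a x) n = blinfun_apply a (coord x n)"
proof -
  have "summable (\<lambda>n. (norm (blinfun_apply a (coord x n)))\<^sup>2)"
  proof (rule summable_comparison_test')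
    show "summable (\<lambda>n. (norm a)\<^sup>2 * (norm (coord x n))\<^sup>2)"
      by (intro summable_mult coord_summable)
    show "norm ((norm (blinfun_apply a (coord x n)))\<^sup>2) \<le> (norm a)\<^sup>2 * (norm (coord x n))\<^sup>2" for n
      using power_mono[OF norm_blinfun, of a "coord x n" 2] by (simp add: power_mult_distrib)
  qed
  thus ?thesis by (simp add: amp_def coord_Ell2)
qed

lemma bounded_linear_amp: "bounded_linear (amp a)"
proof (rule bounded_linear_intro[where K = "norm a"])
  show "norm (amp a x) \<le> norm x * norm a" for x
    using norm_ell2_le[of "amp a x" "norm a" x] norm_blinfun[of a]
    by (simp add: coord_amp mult.commute)
qed (auto intro!: ell2_eqI simp: coord_amp coord_add coord_scaleR blinfun.add_right
       blinfun.scaleR_right)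

lemma amp_id: "amp id_blinfun x = x"
  by (rule ell2_eqI) (simp add: coord_amp)

lemma amp_comp: "amp (a o\<^sub>L b) x = amp a (amp b x)"
  by (rule ell2_eqI) (simp add: coord_amp)

lemma amp_add: "amp (a + b) x = amp a x + amp b x"
  by (rule ell2_eqI) (simp add: coord_amp coord_add blinfun.add_left)

lemma amp_diff: "amp (a - b) x = amp a x - amp b x"
  by (rule ell2_eqI) (simp add: coord_amp coord_diff blinfun.diff_left)

lemma amp_scaleR: "amp (r *\<^sub>R a) x = r *\<^sub>R amp a x"
  by (rule ell2_eqI) (simp add: coord_amp coord_scaleR blinfun.scaleR_left)

lemma amp_scaleC: "amp (op_scaleC c a) x = c *\<^sub>C amp a x"
  by (rule ell2_eqI) (simp add: coord_amp coord_scaleC)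

lemma amp_zero: "amp 0 x = 0"
  by (rule ell2_eqI) (simp add: coord_amp coord_zero)

lemma amp_single: "amp a (single n u) = single n (blinfun_apply a u)"
  by (rule ell2_eqI) (simp add: coord_amp coord_single)

lemma amp_spread: "strict_mono g \<Longrightarrow> amp a (spread g x) = spread g (amp a x)"
  by (rule ell2_eqI) (simp add: coord_amp coord_spread)

lemma cinner_amp_adj_left: "a \<in> bops \<Longrightarrow> cinner (amp (op_adj a) x) y = cinner x (amp a y)"
  by (simp add: cinner_ell2_def coord_amp cinner_op_adj_left)

lemma cinner_amp_adj_right: "a \<in> bops \<Longrightarrow> cinner x (amp (op_adj a) y) = cinner (amp a x) y"
  by (simp add: cinner_ell2_def coord_amp cinner_op_adj_right)

section \<open>The density theorem\<close>

lemma subspace_closure: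
  fixes V :: "'a::real_normed_vector set"
  assumes V: "subspace V"
  shows "subspace (closure V)"
  unfolding subspace_def
proof (intro conjI ballI allI)
  show "0 \<in> closure V" using subspace_0[OF V] closure_subset by blast
next
  fix x y assume "x \<in> closure V" "y \<in> closure V"
  then obtain f g where "\<And>n. f n \<in> V" "f \<longlonglongrightarrow> x" "\<And>n. g n \<in> V" "g \<longlonglongrightarrow> y"
    unfolding closure_sequential by blast
  thus "x + y \<in> closure V" unfolding closure_sequential
    using V by (intro exI[of _ "\<lambda>n. f n + g n"]) (auto intro: tendsto_add subspace_add)
next
  fix c x assume "x \<in> closure V"
  then obtain f where "\<And>n. f n \<in> V" "f \<longlonglongrightarrow> x"
    unfolding closure_sequential by blast
  thus "c *\<^sub>R x \<in> closure V" unfolding closure_sequential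
    using V by (intro exI[of _ "\<lambda>n. c *\<^sub>R f n"]) (auto intro: tendsto_scaleR subspace_scale)
qed

lemma closed_subspace_minimal:
  fixes G :: "'a::real_normed_vector set"
  assumes "G \<subseteq> T" "subspace T" "closed T"
  shows "closure (span G) \<subseteq> T"
  using assms by (intro closure_minimal span_minimal)

text \<open>Products with complex scalars belong to the set, so its real span is a complex unital
  \<open>*\<close>-algebra.\<close>

locale star_submonoid =
  fixes S :: "('a::chilbert_space \<Rightarrow>\<^sub>L 'a) set"
  assumes bops: "S \<subseteq> bops"
    and one: "id_blinfun \<in> S"
    and comp: "a \<in> S \<Longrightarrow> b \<in> S \<Longrightarrow> a o\<^sub>L b \<in> S"
    and adj: "a \<in> S \<Longrightarrow> op_adj a \<in> S"
    and scale: "a \<in> S \<Longrightarrow> op_scaleC c a \<in> S"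
begin

text \<open>The projection onto the closed orbit of a vector commutes with the amplified operators, so
  its matrix entries belong to the commutant. An operator in the bicommutant commutes with the
  entries, hence its amplification commutes with the projection.\<close>

lemma bicommutant_orbit:
  assumes Y: "Y \<in> commutant (commutant S)"
  shows "amp Y x \<in> closure (span ((\<lambda>Z. amp Z x) ` S))"
proof -
  define C where "C = closure (span ((\<lambda>Z. amp Z x) ` S))"
  have subC: "subspace C" and cloC: "closed C"
    unfolding C_def by (auto intro: subspace_closure)
  have base: "amp Z x \<in> C" if "Z \<in> S" for Z
    unfolding C_def by (rule subsetD[OF closure_subset]) (auto intro: span_base that)
  have stable: "T v \<in> C" if T: "bounded_linear T" "\<And>Z. Z \<in> S \<Longrightarrow> T (amp Z x) \<in> C" and v: "v \<in> C"
    for T :: "'a ell2 \<Rightarrow> 'a ell2" and v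
  proof -
    interpret T: bounded_linear T by fact
    have "closure (span ((\<lambda>Z. amp Z x) ` S)) \<subseteq> T -` C"
    proof (rule closed_subspace_minimal)
      show "subspace (T -` C)"
        using subC by (auto simp: subspace_def T.zero T.add T.scaleR)
      show "closed (T -` C)"
        by (rule closed_vimage[OF cloC linear_continuous_on[OF T(1)]])
    qed (use T in auto)
    hence "C \<subseteq> T -` C" by (simp add: C_def)
    thus ?thesis using v by auto
  qed
  have ampC: "amp W v \<in> C" if "W \<in> S" "v \<in> C" for W v
  proof (rule stable[OF bounded_linear_amp _ that(2)])
    show "amp W (amp Z x) \<in> C" if "Z \<in> S" for Z
      unfolding amp_comp[symmetric] by (rule base) (rule comp[OF \<open>W \<in> S\<close> that])
  qed
  have scaleCC: "c *\<^sub>C v \<in> C" if "v \<in> C" for c v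
  proof (rule stable[OF scaleC.bounded_linear_right _ that])
    show "c *\<^sub>C amp Z x \<in> C" if "Z \<in> S" for Z
      unfolding amp_scaleC[symmetric] by (rule base) (rule scale[OF that])
  qed
  have "\<exists>p. p \<in> C \<and> (\<forall>c\<in>C. inner (v - p) c = 0)" for v
    by (rule orthogonal_projection_exists[OF subC cloC, of v]) auto
  then obtain P where PC: "\<And>v. P v \<in> C" and Po: "\<And>v c. c \<in> C \<Longrightarrow> inner (v - P v) c = 0"
    by metis
  have P_unique: "P v = p" if "p \<in> C" "\<And>c. c \<in> C \<Longrightarrow> inner (v - p) c = 0" for v p
  proof -
    have *: "P v - p \<in> C" by (rule subspace_diff[OF subC PC that(1)])
    have "inner (P v - p) (P v - p) = inner (v - p) (P v - p) - inner (v - P v) (P v - p)"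
      by (simp add: inner_diff_left)
    also have "\<dots> = 0" using that(2)[OF *] Po[OF *] by simp
    finally show ?thesis by simp
  qed
  have P_add: "P (u + v) = P u + P v" for u v
  proof (rule P_unique)
    show "inner (u + v - (P u + P v)) c = 0" if "c \<in> C" for c
      using Po[OF that, of u] Po[OF that, of v] by (simp add: inner_diff_left inner_add_left)
  qed (intro subspace_add[OF subC] PC)
  have P_scaleR: "P (r *\<^sub>R v) = r *\<^sub>R P v" for r v
  proof (rule P_unique)
    show "inner (r *\<^sub>R v - r *\<^sub>R P v) c = 0" if "c \<in> C" for c
      using Po[OF that, of v] by (simp flip: scaleR_diff_right)
  qed (intro subspace_scale[OF subC] PC)
  have P_scaleC: "P (c *\<^sub>C v) = c *\<^sub>C P v" for c v
  proof (rule P_unique)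
    fix d assume d: "d \<in> C"
    have "inner (c *\<^sub>C v - c *\<^sub>C P v) d = Re (cinner (v - P v) (cnj c *\<^sub>C d))"
      by (simp add: inner_eq_Re_cinner cinner_scaleC_right cinner_scaleC_left flip: scaleC_diff_right)
    thus "inner (c *\<^sub>C v - c *\<^sub>C P v) d = 0"
      using Po[OF scaleCC[OF d]] by (simp add: inner_eq_Re_cinner)
  qed (intro scaleCC PC)
  have P_amp: "P (amp W v) = amp W (P v)" if W: "W \<in> S" for W v
  proof (rule P_unique)
    fix c assume c: "c \<in> C"
    have "cinner (amp W v - amp W (P v)) c = cinner (v - P v) (amp (op_adj W) c)"
      using W bops
      by (auto simp: cinner_amp_adj_right cinner.diff_left)
    thus "inner (amp W v - amp W (P v)) c = 0"
      using Po[OF ampC[OF adj[OF W] c]] by (simp add: inner_eq_Re_cinner)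
  qed (intro ampC PC W)
  have blP: "bounded_linear P"
  proof (rule bounded_linear_intro[where K = 1])
    show "norm (P v) \<le> norm v * 1" for v
    proof -
      have "norm (P v) * norm (P v) = inner v (P v)"
        using Po[OF PC, of v v] by (simp add: inner_diff_left flip: power2_norm_eq_inner power2_eq_square)
      also have "\<dots> \<le> norm v * norm (P v)" by (rule norm_cauchy_schwarz)
      finally show ?thesis by (cases "P v = 0") auto
    qed
  qed (rule P_add P_scaleR)+
  have blPm: "bounded_linear (\<lambda>v. coord (P v) m)" for m
    by (rule bounded_linear_compose[OF bounded_linear_coord blP])
  define Q where "Q m n = Blinfun (\<lambda>u. coord (P (single n u)) m)" for m n
  have Q: "blinfun_apply (Q m n) u = coord (P (single n u)) m" for m n u
    unfolding Q_def
    by (rule bounded_linear_Blinfun_apply[THEN fun_cong])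
       (rule bounded_linear_compose[OF blPm bounded_linear_single])
  have Qcomm: "Q m n \<in> commutant S" for m n
    unfolding commutant_iff
  proof (intro conjI ballI allI)
    have "single n (c *\<^sub>C u) = c *\<^sub>C single n u" for c and u :: 'a
      by (rule ell2_eqI) (simp add: coord_single coord_scaleC)
    thus "Q m n \<in> bops" by (simp add: bops_def Q P_scaleC coord_scaleC)
    show "Q m n (W u) = W (Q m n u)" if "W \<in> S" for W u
      using that by (simp add: Q P_amp coord_amp flip: amp_single)
  qed
  have "coord (P (amp Y x)) m = coord (amp Y (P x)) m" for m
  proof -
    have "(\<lambda>n. Q m n (coord (amp Y x) n)) sums coord (P (amp Y x)) m"
      unfolding Q by (rule bounded_linear.sums[OF blPm single_sums])
    moreover have "(\<lambda>n. Y (Q m n (coord x n))) sums Y (coord (P x) m)"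
      unfolding Q
      by (rule bounded_linear.sums[OF blinfun.bounded_linear_right])
         (rule bounded_linear.sums[OF blPm single_sums])
    moreover have "Q m n (coord (amp Y x) n) = Y (Q m n (coord x n))" for n
      using Y Qcomm[of m n] by (simp add: coord_amp commutant_iff[of Y])
    ultimately show ?thesis by (simp add: coord_amp sums_iff)
  qed
  hence "P (amp Y x) = amp Y (P x)" by (rule ell2_eqI)
  moreover have "P x = x"
    by (rule P_unique) (use base[OF one] in \<open>auto simp: amp_id\<close>)
  ultimately have "amp Y x = P (amp Y x)" by simp
  thus ?thesis using PC C_def by metis
qed

lemma bicommutant_vanishing:
  assumes "Y \<in> commutant (commutant S)" "\<And>Z. Z \<in> S \<Longrightarrow> cinner (amp Z x) y = 0"
  shows "cinner (amp Y x) y = 0"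
proof -
  have "closure (span ((\<lambda>Z. amp Z x) ` S)) \<subseteq> {v. cinner v y = 0}"
  proof (rule closed_subspace_minimal)
    show "subspace {v. cinner v y = 0}"
      by (auto simp: subspace_def cinner.zero_left cinner_add_left cinner.scaleR_left)
    show "closed {v. cinner v y = 0}"
      by (intro closed_Collect_eq continuous_intros cinner.continuous_on)
  qed (use assms in auto)
  thus ?thesis using bicommutant_orbit[OF assms(1)] by blast
qed

end

section \<open>Normal functionals\<close>

text \<open>On a von Neumann algebra these are exactly the \<open>\<sigma>\<close>-weakly continuous linear functionals. The two
  vectors are allowed to differ, so a positive functional need not be given by an expression that
  is visibly positive.\<close>

definition normal_functional ::
  "('a::chilbert_space \<Rightarrow>\<^sub>L 'a) set \<Rightarrow> (('a \<Rightarrow>\<^sub>L 'a) \<Rightarrow> complex) \<Rightarrow> bool"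
  where "normal_functional M f \<longleftrightarrow> (\<exists>x y. \<forall>a\<in>M. f a = cinner (amp a x) y)"

lemma normal_functional_coefficient: "normal_functional M (\<lambda>a. cinner (amp a x) y)"
  by (auto simp: normal_functional_def)

lemma normal_functional_cong:
  "normal_functional M f \<Longrightarrow> (\<And>a. a \<in> M \<Longrightarrow> f a = g a) \<Longrightarrow> normal_functional M g"
  unfolding normal_functional_def by metis

text \<open>Both coefficients are moved to mutually orthogonal copies of the sequence space, one on the even
  and one on the odd indices, so that the cross terms vanish.\<close>

lemma normal_functional_add:
  assumes "normal_functional M f" "normal_functional M g"
  shows "normal_functional M (\<lambda>a. f a + g a)"
proof -
  obtain x y where xy: "\<And>a. a \<in> M \<Longrightarrow> f a = cinner (amp a x) y"
    using assms(1) by (auto simp: normal_functional_def)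
  obtain x' y' where xy': "\<And>a. a \<in> M \<Longrightarrow> g a = cinner (amp a x') y'"
    using assms(2) by (auto simp: normal_functional_def)
  define e d :: "nat \<Rightarrow> nat" where ed: "e = (\<lambda>n. 2 * n)" "d = (\<lambda>n. 2 * n + 1)"
  have e: "strict_mono e" and d: "strict_mono d" by (auto simp: ed strict_mono_def)
  have "range e \<inter> range d = {}" by (auto simp: ed, presburger)
  hence orth: "cinner (spread e u) (spread d v) = 0" "cinner (spread d u) (spread e v) = 0"
    for u v :: "'a ell2"
    using cinner_spread_disjoint e d by (metis, metis Int_commute)
  have "f a + g a = cinner (amp a (spread e x + spread d x')) (spread e y + spread d y')"
    if "a \<in> M" for a
    using that
    by (simp add: xy xy' linear_simps(1)[OF bounded_linear_amp] amp_spread e d orth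
        cinner_add_left cinner_add_right cinner_spread)
  thus ?thesis unfolding normal_functional_def by blast
qed

lemma normal_functional_scale:
  assumes "normal_functional M f"
  shows "normal_functional M (\<lambda>a. c * f a)"
proof -
  obtain x y where "\<And>a. a \<in> M \<Longrightarrow> f a = cinner (amp a x) y"
    using assms by (auto simp: normal_functional_def)
  thus ?thesis unfolding normal_functional_def
    by (intro exI[of _ x] exI[of _ "cnj c *\<^sub>C y"]) (simp add: cinner_scaleC_right)
qed

lemma normal_functional_zero: "normal_functional M (\<lambda>a. 0)"
  unfolding normal_functional_def by (rule exI[of _ 0], rule exI[of _ 0]) (simp add: cinner.zero_right)

lemma normal_functional_sum:
  "(\<And>i. i \<in> I \<Longrightarrow> normal_functional M (f i)) \<Longrightarrow> normal_functional M (\<lambda>a. \<Sum>i\<in>I. f i a)"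
  by (induction I rule: infinite_finite_induct)
     (auto intro: normal_functional_zero normal_functional_add)

lemma normal_functional_left_mult:
  assumes "normal_functional M f" "\<And>a. a \<in> M \<Longrightarrow> b o\<^sub>L a \<in> M" "b \<in> bops"
  shows "normal_functional M (\<lambda>a. f (b o\<^sub>L a))"
proof -
  obtain x y where "\<And>a. a \<in> M \<Longrightarrow> f a = cinner (amp a x) y"
    using assms by (auto simp: normal_functional_def)
  thus ?thesis unfolding normal_functional_def
    by (intro exI[of _ x] exI[of _ "amp (op_adj b) y"])
       (simp add: amp_comp cinner_amp_adj_right assms)
qed

lemma normal_functional_adj:
  assumes "normal_functional M f" "\<And>a. a \<in> M \<Longrightarrow> op_adj a \<in> M" "M \<subseteq> bops"
  shows "normal_functional M (\<lambda>a. cnj (f (op_adj a)))"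
proof -
  obtain x y where "\<And>a. a \<in> M \<Longrightarrow> f a = cinner (amp a x) y"
    using assms by (auto simp: normal_functional_def)
  thus ?thesis unfolding normal_functional_def
    using assms(3) by (intro exI[of _ y] exI[of _ x])
      (auto simp: cinner_commute[symmetric] cinner_amp_adj_right assms(2))
qed

context star_submonoid
begin

lemma normal_functional_eqI:
  assumes f: "normal_functional (commutant (commutant S)) f"
    and g: "normal_functional (commutant (commutant S)) g"
    and eq: "\<And>Z. Z \<in> S \<Longrightarrow> f Z = g Z"
    and Y: "Y \<in> commutant (commutant S)"
  shows "f Y = g Y"
proof -
  have "normal_functional (commutant (commutant S)) (\<lambda>a. f a + (-1) * g a)"
    by (intro normal_functional_add normal_functional_scale f g)
  then obtain x y where xy: "\<And>a. a \<in> commutant (commutant S) \<Longrightarrow> f a + (-1) * g a = cinner (amp a x) y"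
    unfolding normal_functional_def by blast
  have "cinner (amp Y x) y = 0"
  proof (rule bicommutant_vanishing[OF Y])
    show "cinner (amp Z x) y = 0" if "Z \<in> S" for Z
      using xy[of Z] eq[OF that] bicommutant_superset[OF bops] that by auto
  qed
  thus ?thesis using xy[OF Y] by simp
qed

lemma span_subset_bicommutant: "span S \<subseteq> commutant (commutant S)"
  by (rule span_minimal[OF bicommutant_superset[OF bops]])
     (rule vn_subspace[OF von_neumann_bicommutant[OF bops adj]])

text \<open>The pair of an operator and its adjoint, both applied to given vectors, depends only
  real-linearly on the operator. A vector that is real-orthogonal to all such pairs from the span
  still defines a complex-linear normal functional vanishing on the generators, hence on the
  bicommutant. This gives approximation in the \<open>*\<close>-strong sense.\<close>

lemma strong_star_density:
  assumes Y: "Y \<in> commutant (commutant S)" and e: "e > 0"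
  obtains Z where "Z \<in> span S"
    "norm (amp (Y - Z) x) < e" "norm (amp (Y - Z) y) < e"
    "norm (amp (op_adj (Y - Z)) x) < e" "norm (amp (op_adj (Y - Z)) y) < e"
proof -
  define J where "J Z = ((amp Z x, amp Z y), (amp (op_adj Z) x, amp (op_adj Z) y))" for Z
  define V where "V = J ` span S"
  have sb: "span S \<subseteq> bops" and Yb: "Y \<in> bops"
    using span_subset_bicommutant commutant_bops Y by blast+
  have subV: "subspace V"
    unfolding subspace_def V_def
  proof (intro conjI ballI allI)
    show "0 \<in> J ` span S"
      by (rule image_eqI[of _ _ 0]) (auto simp: J_def amp_zero span_zero zero_prod_def)
    fix u v assume "u \<in> J ` span S" "v \<in> J ` span S"
    then obtain a b where ab: "a \<in> span S" "b \<in> span S" "u = J a" "v = J b" by blast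
    have "u + v = J (a + b)"
      using ab sb by (auto simp: J_def amp_add op_adj_add subset_iff)
    thus "u + v \<in> J ` span S" using ab by (auto intro: span_add)
  next
    fix r u assume "u \<in> J ` span S"
    then obtain a where a: "a \<in> span S" "u = J a" by blast
    have "r *\<^sub>R u = J (r *\<^sub>R a)"
      using a sb by (auto simp: J_def amp_scaleR op_adj_scaleR subset_iff)
    thus "r *\<^sub>R u \<in> J ` span S" using a by (auto intro: span_scale)
  qed
  obtain p where p: "p \<in> closure V" "\<And>c. c \<in> closure V \<Longrightarrow> inner (J Y - p) c = 0"
    by (rule orthogonal_projection_exists[of "closure V" "J Y"])
       (auto intro: subspace_closure subV)
  obtain w1 w2 w3 w4 where w: "J Y - p = ((w1, w2), (w3, w4))" by (metis surj_pair)
  \<comment> \<open>The components paired with adjoints enter conjugated, which makes \<open>g\<close> linear over the complex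
    numbers; its real part is the real inner product with the residual.\<close>
  define g where "g Z = (cinner (amp Z x) w1 + cinner (amp Z y) w2)
      + (cinner (amp Z w3) x + cinner (amp Z w4) y)" for Z
  have re: "Re (g Z) = inner (J Y - p) (J Z)" if "Z \<in> bops" for Z
  proof -
    have "inner (J Y - p) (J Z) = (inner (amp Z x) w1 + inner (amp Z y) w2)
        + (inner w3 (amp (op_adj Z) x) + inner w4 (amp (op_adj Z) y))"
      unfolding w by (simp add: J_def inner_commute[of w1 "amp Z x"] inner_commute[of w2 "amp Z y"])
    thus ?thesis using that by (simp add: g_def inner_eq_Re_cinner cinner_amp_adj_right)
  qed
  have "g Z = 0" if Z: "Z \<in> S" for Z
  proof -
    have *: "Re (g W) = 0" if "W \<in> S" for W
    proof -
      have "J W \<in> closure V" using that closure_subset[of V] by (auto simp: V_def span_base)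
      thus ?thesis using re[of W] p(2) that bops by auto
    qed
    have "g (op_scaleC \<i> Z) = \<i> * g Z"
      by (simp add: g_def amp_scaleC cinner_scaleC_left algebra_simps)
    hence "Im (g Z) = 0" using *[OF scale[OF Z, of \<i>]] by simp
    thus ?thesis using *[OF Z] by (simp add: complex_eq_iff)
  qed
  moreover have "normal_functional (commutant (commutant S)) g"
    unfolding g_def by (intro normal_functional_add normal_functional_coefficient)
  ultimately have "g Y = 0"
    using normal_functional_eqI[OF _ normal_functional_zero _ Y, of g] by blast
  hence "inner (J Y - p) (J Y) = 0" using re[OF Yb] by simp
  hence "inner (J Y - p) (J Y - p) = 0" using p by (simp add: inner_diff_right)
  hence "J Y \<in> closure V" using p by simp
  then obtain v where "v \<in> V" "dist v (J Y) < e"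
    using e closure_approachable by blast
  then obtain Z where Z: "Z \<in> span S" "norm (J Y - J Z) < e"
    by (auto simp: V_def dist_norm norm_minus_commute)
  have J: "J Y - J Z = J (Y - Z)"
    using Z sb Yb by (auto simp: J_def amp_diff op_adj_diff subset_iff)
  have "norm a < e" if "norm ((a, b), (c, d)) < e" for a b c d :: "'a ell2"
    using that norm_fst_le[of "(a, b)" "(c, d)"] norm_fst_le[of a b] by linarith
  moreover have "norm b < e" if "norm ((a, b), (c, d)) < e" for a b c d :: "'a ell2"
    using that norm_fst_le[of "(a, b)" "(c, d)"] norm_snd_le[of b a] by linarith
  moreover have "norm c < e" if "norm ((a, b), (c, d)) < e" for a b c d :: "'a ell2"
    using that norm_snd_le[of "(c, d)" "(a, b)"] norm_fst_le[of c d] by linarith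
  moreover have "norm d < e" if "norm ((a, b), (c, d)) < e" for a b c d :: "'a ell2"
    using that norm_snd_le[of "(c, d)" "(a, b)"] norm_snd_le[of d c] by linarith
  ultimately show ?thesis
    using that[OF Z(1)] Z(2)[unfolded J, unfolded J_def] by blast
qed

end

section \<open>Normal functionals are the \<open>\<sigma>\<close>-weakly continuous ones\<close>

lemma continuous_normal_functional:
  assumes M: "M \<subseteq> bops" and f: "normal_functional M f"
  shows "continuous_map (subtopology sigma_weak M) euclidean f"
proof -
  obtain x y where xy: "\<And>a. a \<in> M \<Longrightarrow> f a = cinner (amp a x) y"
    using f by (auto simp: normal_functional_def)
  have "openin sigma_weak {a \<in> bops. (\<Sum>n. cinner (blinfun_apply a (coord x n)) (coord y n)) \<in> U}"
    if "open U" for U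
    unfolding sigma_weak_def
    by (rule topology_generated_by_Basis) (use that coord_summable in blast)
  hence op: "openin sigma_weak {a \<in> bops. cinner (amp a x) y \<in> U}" if "open U" for U
    using that by (simp add: cinner_ell2_def coord_amp)
  have "openin (subtopology sigma_weak M) {a \<in> topspace (subtopology sigma_weak M). f a \<in> U}"
    if "open U" for U
  proof -
    have "{a \<in> topspace (subtopology sigma_weak M). f a \<in> U} =
        {a \<in> bops. cinner (amp a x) y \<in> U} \<inter> M"
      using M openin_subset[OF op[OF that]] openin_subset[OF op[OF open_UNIV]] xy
      by auto
    thus ?thesis using op[OF that] by (auto simp: openin_subtopology)
  qed
  thus ?thesis by (simp add: continuous_map_def)
qed

lemma topspace_sigma_weak_superset: "bops \<subseteq> topspace (sigma_weak :: ('a::chilbert_space \<Rightarrow>\<^sub>L 'a) topology)"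
proof -
  have "openin sigma_weak {a \<in> bops. (\<Sum>n. cinner (blinfun_apply a (0 :: 'a)) (0 :: 'a)) \<in> UNIV}"
    unfolding sigma_weak_def
    by (rule topology_generated_by_Basis)
       (rule CollectI, rule exI[of _ "\<lambda>_. 0"], rule exI[of _ "\<lambda>_. 0"], rule exI[of _ UNIV], simp)
  thus ?thesis using openin_subset by fastforce
qed

lemma sigma_weak_neighbourhood:
  assumes W: "openin sigma_weak W" "0 \<in> W"
  obtains e L where "e > 0" "finite L"
    "\<And>a. a \<in> bops \<Longrightarrow> (\<And>x y. (x, y) \<in> L \<Longrightarrow> cmod (cinner (amp a x) y) < e) \<Longrightarrow> a \<in> W"
proof -
  let ?B = "{{a \<in> bops. (\<Sum>n. cinner (blinfun_apply a (\<xi> n)) (\<eta> n)) \<in> U} | \<xi> \<eta> U.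
      summable (\<lambda>n::nat. (norm (\<xi> n))\<^sup>2) \<and> summable (\<lambda>n. (norm (\<eta> n))\<^sup>2) \<and> open U}"
  define nb :: "('a \<Rightarrow>\<^sub>L 'a) set \<Rightarrow> real \<Rightarrow> ('a ell2 \<times> 'a ell2) set \<Rightarrow> bool"
    where "nb W e L \<longleftrightarrow> e > 0 \<and> finite L \<and>
      (\<forall>a\<in>bops. (\<forall>(x, y)\<in>L. cmod (cinner (amp a x) y) < e) \<longrightarrow> a \<in> W)" for W e L
  have "generate_topology_on ?B W"
    using W(1) by (simp add: sigma_weak_def openin_topology_generated_by_iff)
  hence "0 \<in> W \<longrightarrow> (\<exists>e L. nb W e L)"
  proof induction
    case Empty thus ?case by simp
  next
    case (Int a b)
    show ?case
    proof
      assume "0 \<in> a \<inter> b"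
      then obtain e L e' L' where nb: "nb a e L" "nb b e' L'" using Int.IH by auto
      have "nb (a \<inter> b) (min e e') (L \<union> L')"
        using nb unfolding nb_def by (simp add: case_prod_unfold)
      thus "\<exists>e L. nb (a \<inter> b) e L" by blast
    qed
  next
    case (UN K)
    show ?case
    proof
      assume "0 \<in> \<Union>K"
      then obtain k e L where k: "k \<in> K" "nb k e L" using UN.IH by blast
      hence "nb (\<Union>K) e L" unfolding nb_def by auto
      thus "\<exists>e L. nb (\<Union>K) e L" by blast
    qed
  next
    case (Basis s)
    then obtain \<xi> \<eta> U where s: "s = {a \<in> bops. (\<Sum>n. cinner (blinfun_apply a (\<xi> n)) (\<eta> n)) \<in> U}"
      and summ: "summable (\<lambda>n::nat. (norm (\<xi> n))\<^sup>2)" "summable (\<lambda>n. (norm (\<eta> n))\<^sup>2)"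
      and U: "open U" by blast
    have c: "cinner (amp a (Ell2 \<xi>)) (Ell2 \<eta>) = (\<Sum>n. cinner (blinfun_apply a (\<xi> n)) (\<eta> n))" for a
      by (simp add: cinner_ell2_def coord_amp coord_Ell2 summ)
    show ?case
    proof
      assume "0 \<in> s"
      hence "0 \<in> U" by (auto simp: s cinner.zero_left)
      then obtain e where e: "e > 0" "ball 0 e \<subseteq> U" using U open_contains_ball by blast
      have "nb s e {(Ell2 \<xi>, Ell2 \<eta>)}"
        using e by (auto simp: nb_def s c subset_iff)
      thus "\<exists>e L. nb s e L" by blast
    qed
  qed
  then obtain e L where "nb W e L" using W(2) by blast
  thus ?thesis using that[of e L] by (fastforce simp: nb_def)
qed

definition complex_linear_on ::
  "('a::chilbert_space \<Rightarrow>\<^sub>L 'a) set \<Rightarrow> (('a \<Rightarrow>\<^sub>L 'a) \<Rightarrow> complex) \<Rightarrow> bool"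
  where "complex_linear_on M f \<longleftrightarrow>
    (\<forall>a\<in>M. \<forall>b\<in>M. f (a + b) = f a + f b) \<and> (\<forall>c. \<forall>a\<in>M. f (op_scaleC c a) = c * f a)"

lemma complex_linear_on_coefficient: "complex_linear_on M (\<lambda>a. cinner (amp a x) y)"
  by (auto simp: complex_linear_on_def amp_add amp_scaleC cinner_add_left cinner_scaleC_left)

text \<open>Induction on the number of functionals: on the kernel of one of them the remaining ones suffice,
  and the coefficient of that one is read off at a single point outside its kernel.\<close>

lemma linear_functional_in_span:
  fixes M :: "('a::chilbert_space \<Rightarrow>\<^sub>L 'a) set"
  assumes "finite L"
    and "\<And>a b. a \<in> M \<Longrightarrow> b \<in> M \<Longrightarrow> a + b \<in> M" "\<And>c a. a \<in> M \<Longrightarrow> op_scaleC c a \<in> M"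
    and "\<And>l. l \<in> L \<Longrightarrow> complex_linear_on M (g l)" "complex_linear_on M f"
    and "\<And>a. a \<in> M \<Longrightarrow> (\<And>l. l \<in> L \<Longrightarrow> g l a = 0) \<Longrightarrow> f a = 0"
  shows "\<exists>c. \<forall>a\<in>M. f a = (\<Sum>l\<in>L. c l * g l a)"
  using assms
proof (induction L arbitrary: M rule: finite_induct)
  case empty
  thus ?case by auto
next
  case (insert l L)
  note add = insert.prems(1) and scale = insert.prems(2)
  have gl: "complex_linear_on M (g l)" and f: "complex_linear_on M f"
    using insert.prems by auto
  define M' where "M' = {a \<in> M. g l a = 0}"
  have "\<exists>c. \<forall>a\<in>M'. f a = (\<Sum>l\<in>L. c l * g l a)"
  proof (rule insert.IH)
    show "\<And>a b. a \<in> M' \<Longrightarrow> b \<in> M' \<Longrightarrow> a + b \<in> M'"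
      using add gl by (auto simp: M'_def complex_linear_on_def)
    show "\<And>c a. a \<in> M' \<Longrightarrow> op_scaleC c a \<in> M'"
      using scale gl by (auto simp: M'_def complex_linear_on_def)
    show "\<And>k. k \<in> L \<Longrightarrow> complex_linear_on M' (g k)" "complex_linear_on M' f"
      using insert.prems by (auto simp: M'_def complex_linear_on_def)
    show "f a = 0" if "a \<in> M'" "\<And>k. k \<in> L \<Longrightarrow> g k a = 0" for a
      using that insert.prems(5)[of a] by (auto simp: M'_def)
  qed
  then obtain c where c: "\<And>a. a \<in> M' \<Longrightarrow> f a = (\<Sum>l\<in>L. c l * g l a)" by blast
  show ?case
  proof (cases "\<exists>a\<in>M. g l a \<noteq> 0")
    case False
    hence "M' = M" by (auto simp: M'_def)
    thus ?thesis using c False insert.hyps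
      by (intro exI[of _ c]) auto
  next
    case True
    then obtain b where b: "b \<in> M" "g l b \<noteq> 0" by blast
    \<comment> \<open>The coefficient that makes the combination correct at \<open>b\<close>.\<close>
    define d where "d = (f b - (\<Sum>k\<in>L. c k * g k b)) / g l b"
    have "f a = (\<Sum>k\<in>insert l L. (c(l := d)) k * g k a)" if a: "a \<in> M" for a
    proof -
      \<comment> \<open>With this factor \<open>a + s b\<close> lies in the kernel of \<open>g l\<close>.\<close>
      define s where "s = - (g l a / g l b)"
      have sb: "op_scaleC s b \<in> M" using scale b by blast
      have lin: "h (a + op_scaleC s b) = h a + s * h b" if "complex_linear_on M h" for h
        using that a b sb by (auto simp: complex_linear_on_def)
      have "a + op_scaleC s b \<in> M'"
        using add[OF a sb] lin[OF gl] b by (simp add: M'_def s_def)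
      from c[OF this] have "f a + s * f b = (\<Sum>k\<in>L. c k * (g k a + s * g k b))"
        using lin[OF f] lin[of "g _"] insert.prems(3) by (simp cong: sum.cong)
      hence "f a = (\<Sum>k\<in>L. c k * g k a) - s * (f b - (\<Sum>k\<in>L. c k * g k b))"
        by (simp add: algebra_simps sum.distrib sum_distrib_left)
      also have "- s * (f b - (\<Sum>k\<in>L. c k * g k b)) = d * g l a"
        by (simp add: s_def d_def)
      hence "(\<Sum>k\<in>L. c k * g k a) - s * (f b - (\<Sum>k\<in>L. c k * g k b)) =
          (\<Sum>k\<in>L. c k * g k a) + d * g l a" by simp
      also have "(\<Sum>k\<in>L. c k * g k a) = (\<Sum>k\<in>L. (c(l := d)) k * g k a)"
        using insert.hyps by (intro sum.cong) auto
      finally show ?thesis using insert.hyps by simp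
    qed
    thus ?thesis by blast
  qed
qed

text \<open>A \<open>\<sigma>\<close>-weak neighbourhood of 0 is controlled by finitely many matrix coefficients, so
  the functional vanishes on their common kernel and is a combination of them.\<close>

lemma normal_functional_if_continuous:
  assumes bops: "M \<subseteq> bops" and zero: "0 \<in> M"
    and add: "\<And>a b. a \<in> M \<Longrightarrow> b \<in> M \<Longrightarrow> a + b \<in> M"
    and scale: "\<And>c a. a \<in> M \<Longrightarrow> op_scaleC c a \<in> M"
    and lin: "complex_linear_on M f"
    and cont: "continuous_map (subtopology sigma_weak M) euclidean f"
  shows "normal_functional M f"
proof -
  have f0: "f 0 = 0"
    using lin zero unfolding complex_linear_on_def by (metis mult_zero_left op_scaleC_zero)
  have top: "M \<subseteq> topspace sigma_weak"
    using bops topspace_sigma_weak_superset by blast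
  have "openin (subtopology sigma_weak M) {a \<in> topspace (subtopology sigma_weak M). f a \<in> ball 0 1}"
    by (rule openin_continuous_map_preimage[OF cont]) simp
  then obtain W where W: "openin sigma_weak W"
    and WM: "{a \<in> topspace (subtopology sigma_weak M). f a \<in> ball 0 1} = W \<inter> M"
    by (auto simp: openin_subtopology)
  have "0 \<in> W" using WM zero f0 top by auto
  then obtain e L where e: "e > 0" and L: "finite L"
    and nb: "\<And>a. a \<in> bops \<Longrightarrow> (\<And>x y. (x, y) \<in> L \<Longrightarrow> cmod (cinner (amp a x) y) < e) \<Longrightarrow> a \<in> W"
    using sigma_weak_neighbourhood[OF W] by metis
  have "\<exists>c. \<forall>a\<in>M. f a = (\<Sum>l\<in>L. c l * (\<lambda>l a. cinner (amp a (fst l)) (snd l)) l a)"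
  proof (rule linear_functional_in_span[OF L add scale _ lin])
    show "complex_linear_on M (\<lambda>a. cinner (amp a (fst l)) (snd l))" for l
      by (rule complex_linear_on_coefficient)
    fix a assume a: "a \<in> M" and ker: "\<And>l. l \<in> L \<Longrightarrow> cinner (amp a (fst l)) (snd l) = 0"
    show "f a = 0"
    proof (rule ccontr)
      assume fa: "f a \<noteq> 0"
      \<comment> \<open>The common kernel is invariant under scaling, so \<open>f\<close> would have to be smaller than 1 at a
    point where it equals 1.\<close>
      define b where "b = op_scaleC (1 / f a) a"
      have b: "b \<in> M" unfolding b_def by (rule scale[OF a])
      have "b \<in> W"
        using ker e b bops by (intro nb) (force simp: b_def amp_scaleC cinner_scaleC_left)+
      hence "f b \<in> ball 0 1" using WM b by auto
      moreover have "f b = 1" using lin a fa by (simp add: b_def complex_linear_on_def)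
      ultimately show False by simp
    qed
  qed
  then obtain c where "\<forall>a\<in>M. f a = (\<Sum>l\<in>L. c l * cinner (amp a (fst l)) (snd l))" by auto
  moreover have "normal_functional M (\<lambda>a. \<Sum>l\<in>L. c l * cinner (amp a (fst l)) (snd l))"
    by (intro normal_functional_sum normal_functional_scale normal_functional_coefficient)
  ultimately show ?thesis by (elim normal_functional_cong) auto
qed

section \<open>Positive kernels and the Schur product\<close>

definition positive_kernel :: "'i set \<Rightarrow> ('i \<Rightarrow> 'i \<Rightarrow> complex) \<Rightarrow> bool"
  where "positive_kernel I K \<longleftrightarrow>
    (\<forall>c. (\<Sum>i\<in>I. \<Sum>j\<in>I. c i * cnj (c j) * K i j) \<in> \<real>\<^sub>\<ge>\<^sub>0)"

text \<open>Positivity tested on vectors supported at two indices. Choosing the two coefficients gives hermitian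
  symmetry and the Cauchy-Schwarz inequality.\<close>

lemma positive_kernel_two:
  assumes K: "positive_kernel I K" and I: "finite I" "i \<in> I" "j \<in> I" "i \<noteq> j"
  shows "a * cnj a * K i i + a * cnj b * K i j + b * cnj a * K j i + b * cnj b * K j j \<in> \<real>\<^sub>\<ge>\<^sub>0"
proof -
  define c where "c k = (if k = i then a else if k = j then b else 0)" for k
  have "(\<Sum>k\<in>I. \<Sum>l\<in>I. c k * cnj (c l) * K k l) = (\<Sum>k\<in>{i,j}. \<Sum>l\<in>I. c k * cnj (c l) * K k l)"
    using I by (intro sum.mono_neutral_right) (auto simp: c_def)
  also have "\<dots> = (\<Sum>k\<in>{i,j}. \<Sum>l\<in>{i,j}. c k * cnj (c l) * K k l)"
    using I by (intro sum.cong refl sum.mono_neutral_right) (auto simp: c_def)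
  also have "\<dots> = a * cnj a * K i i + a * cnj b * K i j + b * cnj a * K j i + b * cnj b * K j j"
    using I(4) by (auto simp: c_def algebra_simps)
  finally show ?thesis using K[unfolded positive_kernel_def, rule_format, of c] by simp
qed

lemma positive_kernel_diagonal:
  assumes K: "positive_kernel I K" and I: "finite I" "i \<in> I"
  shows "K i i \<in> \<real>\<^sub>\<ge>\<^sub>0"
proof -
  define c where "c k = (if k = i then 1 else 0 :: complex)" for k
  have "(\<Sum>k\<in>I. \<Sum>l\<in>I. c k * cnj (c l) * K k l) = (\<Sum>k\<in>{i}. \<Sum>l\<in>I. c k * cnj (c l) * K k l)"
    using I by (intro sum.mono_neutral_right) (auto simp: c_def)
  also have "\<dots> = (\<Sum>k\<in>{i}. \<Sum>l\<in>{i}. c k * cnj (c l) * K k l)"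
    using I by (intro sum.cong refl sum.mono_neutral_right) (auto simp: c_def)
  also have "\<dots> = K i i" by (simp add: c_def)
  finally show ?thesis using K[unfolded positive_kernel_def, rule_format, of c] by simp
qed

lemma positive_kernel_hermitian:
  assumes K: "positive_kernel I K" and I: "finite I" "i \<in> I" "j \<in> I"
  shows "K j i = cnj (K i j)"
proof (cases "i = j")
  case True
  thus ?thesis using positive_kernel_diagonal[OF K I(1,2)]
    by (auto simp: complex_nonneg_Reals_iff complex_eq_iff)
next
  case False
  note two = positive_kernel_two[OF K I False]
  have "Im (K i i) = 0" "Im (K j j) = 0"
    using positive_kernel_diagonal[OF K I(1)] I by (auto simp: complex_nonneg_Reals_iff)
  moreover have "Im (K i i + K i j + K j i + K j j) = 0"
    using two[of 1 1] by (simp add: complex_nonneg_Reals_iff)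
  moreover have "Im (K i i - \<i> * K i j + \<i> * K j i + K j j) = 0"
    using two[of 1 \<i>] by (simp add: complex_nonneg_Reals_iff)
  ultimately show ?thesis by (simp add: complex_eq_iff)
qed

lemma positive_kernel_Cauchy_Schwarz:
  assumes K: "positive_kernel I K" and I: "finite I" "i \<in> I" "j \<in> I"
  shows "(cmod (K i j))\<^sup>2 \<le> Re (K i i) * Re (K j j)"
proof (cases "i = j")
  case True
  thus ?thesis using positive_kernel_diagonal[OF K I(1,2)]
    by (simp add: complex_nonneg_Reals_iff cmod_def power2_eq_square)
next
  case False
  define k where "k = (cmod (K i j))\<^sup>2"
  have im: "Im (K i i) = 0" "Im (K j j) = 0" "0 \<le> Re (K i i)" "0 \<le> Re (K j j)"
    using positive_kernel_diagonal[OF K I(1)] I by (auto simp: complex_nonneg_Reals_iff)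
  have quad: "0 \<le> s\<^sup>2 * k * Re (K i i) + 2 * s * k + Re (K j j)" for s
  proof -
    define a where "a = of_real s * cnj (K i j)"
    have kk: "K i j * cnj (K i j) = of_real k" unfolding k_def by (rule complex_norm_square[symmetric])
    have "a * cnj a * K i i + a * cnj 1 * K i j + 1 * cnj a * K j i + 1 * cnj 1 * K j j =
        of_real (s\<^sup>2) * (K i j * cnj (K i j)) * K i i + 2 * of_real s * (K i j * cnj (K i j)) + K j j"
      by (simp add: a_def positive_kernel_hermitian[OF K I] power2_eq_square algebra_simps)
    also have "\<dots> = of_real (s\<^sup>2 * k) * K i i + of_real (2 * s * k) + K j j"
      by (simp add: kk)
    finally have "of_real (s\<^sup>2 * k) * K i i + of_real (2 * s * k) + K j j \<in> \<real>\<^sub>\<ge>\<^sub>0"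
      using positive_kernel_two[OF K I False, of a 1] by simp
    thus ?thesis using im by (simp add: complex_nonneg_Reals_iff)
  qed
  have k0: "k \<ge> 0" by (simp add: k_def)
  have "k \<le> Re (K i i) * Re (K j j)"
  proof (cases "k = 0")
    case False
    hence k: "k > 0" using k0 by simp
    show ?thesis
    proof (cases "Re (K i i) = 0")
      case True
      \<comment> \<open>With a vanishing quadratic term the estimate is linear in \<open>s\<close>, so \<open>k > 0\<close> is refuted by a
        negative enough \<open>s\<close>.\<close>
      have "0 \<le> - 2 - Re (K j j)" using quad[of "- (1 + Re (K j j)) / k"] True k by simp
      thus ?thesis using im by linarith
    next
      case False
      hence p: "Re (K i i) > 0" using im by linarith
      \<comment> \<open>The minimum of the quadratic estimate.\<close>
      have "0 \<le> - (k / Re (K i i)) + Re (K j j)"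
        using quad[of "- (1 / Re (K i i))"] p by (simp add: power2_eq_square field_simps)
      thus ?thesis using p by (simp add: field_simps)
    qed
  qed (use im in auto)
  thus ?thesis by (simp add: k_def)
qed

lemma double_sum_insert:
  assumes "finite J" "p \<notin> J"
  shows "(\<Sum>i\<in>insert p J. \<Sum>j\<in>insert p J. (f i j :: complex)) =
    (\<Sum>i\<in>J. \<Sum>j\<in>J. f i j) + (\<Sum>i\<in>J. f i p) + (\<Sum>j\<in>J. f p j) + f p p"
  using assms by (simp add: sum.distrib algebra_simps)

text \<open>Eliminating one index by a Schur complement splits a kernel into a rank-one kernel and a
  positive kernel on the remaining indices. The product of a rank-one kernel with a positive kernel
  is positive by rescaling the coefficients.\<close>

lemma positive_kernel_mult:
  assumes "finite I" "positive_kernel I K" "positive_kernel I L"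
  shows "positive_kernel I (\<lambda>i j. K i j * L i j)"
  using assms
proof (induction I arbitrary: K rule: finite_induct)
  case empty
  thus ?case by (simp add: positive_kernel_def)
next
  case (insert p J)
  note K = insert.prems(1) and L = insert.prems(2)
  have fin: "finite (insert p J)" using insert.hyps by simp
  note herm = positive_kernel_hermitian[OF K fin]
  note CS = positive_kernel_Cauchy_Schwarz[OF K fin]
  define k where "k = Re (K p p)"
  have k: "k \<ge> 0" "K p p = of_real k"
    using positive_kernel_diagonal[OF K fin, of p] by (auto simp: k_def complex_nonneg_Reals_iff complex_eq_iff)
  have k0: "K i p = 0" if "k = 0" "i \<in> insert p J" for i
    using CS[OF that(2), of p] that(1) by (simp add: k_def)
  \<comment> \<open>If the pivot vanishes, then so does its whole row by the Cauchy-Schwarz inequality, and nothing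
    has to be subtracted.\<close>
  define u where "u i = (if k = 0 then 0 else K i p / of_real (sqrt k))" for i
  define K' where "K' i j = K i j - u i * cnj (u j)" for i j
  have ss: "of_real (sqrt k) * of_real (sqrt k) = (of_real k :: complex)"
    using k(1) by (simp flip: of_real_mult)
  have uu: "u i * cnj (u j) * of_real k = K i p * cnj (K j p)"
    if "i \<in> insert p J" "j \<in> insert p J" for i j
    using k0 that by (auto simp: u_def ss[symmetric])
  have K'p: "K' i p = 0" "K' p i = 0" if i: "i \<in> insert p J" for i
  proof -
    have "u i * cnj (u p) = K i p"
    proof (cases "k = 0")
      case False
      have "u i * cnj (u p) * of_real k = K i p * of_real k"
        using uu[OF i, of p] k(2) by simp
      thus ?thesis using False by simp
    qed (use k0 i in \<open>auto simp: u_def\<close>)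
    thus "K' i p = 0" by (simp add: K'_def)
    thus "K' p i = 0" using herm[OF i, of p] by (simp add: K'_def)
  qed
  have "positive_kernel J K'"
    unfolding positive_kernel_def
  proof
    fix c
    define s where "s = (\<Sum>i\<in>J. c i * K i p)"
    \<comment> \<open>The coefficient at the pivot that completes the square.\<close>
    define d where "d = c(p := if k = 0 then 0 else - s / of_real k)"
    have dJ: "d i = c i" if "i \<in> J" for i using that insert.hyps by (auto simp: d_def)
    have dp: "d p * of_real k = (if k = 0 then 0 else - s)" by (simp add: d_def)
    have s0: "s = 0" if "k = 0" using k0 that by (simp add: s_def)
    have "(\<Sum>i\<in>insert p J. \<Sum>j\<in>insert p J. d i * cnj (d j) * K i j) =
       (\<Sum>i\<in>J. \<Sum>j\<in>J. c i * cnj (c j) * K i j) + (\<Sum>i\<in>J. c i * cnj (d p) * K i p)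
        + (\<Sum>j\<in>J. d p * cnj (c j) * K p j) + d p * cnj (d p) * K p p"
      using insert.hyps by (subst double_sum_insert) (auto simp: dJ cong: sum.cong)
    also have "(\<Sum>i\<in>J. c i * cnj (d p) * K i p) = s * cnj (d p)"
      by (simp add: s_def sum_distrib_left mult_ac)
    also have "(\<Sum>j\<in>J. d p * cnj (c j) * K p j) = d p * cnj s"
      using herm[of _ p] by (simp add: s_def sum_distrib_left mult_ac cong: sum.cong)
    also have "(\<Sum>i\<in>J. \<Sum>j\<in>J. c i * cnj (c j) * K i j) + s * cnj (d p) + d p * cnj s
        + d p * cnj (d p) * K p p =
      (\<Sum>i\<in>J. \<Sum>j\<in>J. c i * cnj (c j) * K i j) - (\<Sum>i\<in>J. \<Sum>j\<in>J. c i * cnj (c j) * (u i * cnj (u j)))"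
    proof -
      have "(\<Sum>i\<in>J. \<Sum>j\<in>J. c i * cnj (c j) * (u i * cnj (u j))) =
          (\<Sum>i\<in>J. c i * u i) * cnj (\<Sum>i\<in>J. c i * u i)"
        by (simp add: sum_product mult_ac)
      also have "(\<Sum>i\<in>J. c i * u i) = (if k = 0 then 0 else s / of_real (sqrt k))"
        by (simp add: u_def s_def sum_divide_distrib)
      finally show ?thesis
        using s0 k ss by (auto simp: d_def k(2) field_simps)
    qed
    also have "\<dots> = (\<Sum>i\<in>J. \<Sum>j\<in>J. c i * cnj (c j) * K' i j)"
      by (simp add: K'_def algebra_simps sum_subtractf)
    finally show "(\<Sum>i\<in>J. \<Sum>j\<in>J. c i * cnj (c j) * K' i j) \<in> \<real>\<^sub>\<ge>\<^sub>0"
      using K[unfolded positive_kernel_def, rule_format, of d] by simp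
  qed
  moreover have "positive_kernel J L"
    unfolding positive_kernel_def
  proof
    fix c
    have "(\<Sum>i\<in>insert p J. \<Sum>j\<in>insert p J. (c(p := 0)) i * cnj ((c(p := 0)) j) * L i j) =
        (\<Sum>i\<in>J. \<Sum>j\<in>J. c i * cnj (c j) * L i j)"
      using insert.hyps by (subst double_sum_insert) (auto intro!: sum.cong)
    thus "(\<Sum>i\<in>J. \<Sum>j\<in>J. c i * cnj (c j) * L i j) \<in> \<real>\<^sub>\<ge>\<^sub>0"
      using L[unfolded positive_kernel_def, rule_format, of "c(p := 0)"] by simp
  qed
  ultimately have IH: "positive_kernel J (\<lambda>i j. K' i j * L i j)" by (rule insert.IH)
  show ?case
    unfolding positive_kernel_def
  proof
    fix c
    have "(\<Sum>i\<in>insert p J. \<Sum>j\<in>insert p J. c i * cnj (c j) * (K i j * L i j)) =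
        (\<Sum>i\<in>insert p J. \<Sum>j\<in>insert p J. c i * cnj (c j) * (K' i j * L i j)) +
        (\<Sum>i\<in>insert p J. \<Sum>j\<in>insert p J. (c i * u i) * cnj (c j * u j) * L i j)"
      unfolding sum.distrib[symmetric] by (intro sum.cong refl) (simp add: K'_def algebra_simps)
    also have "(\<Sum>i\<in>insert p J. \<Sum>j\<in>insert p J. c i * cnj (c j) * (K' i j * L i j)) =
        (\<Sum>i\<in>J. \<Sum>j\<in>J. c i * cnj (c j) * (K' i j * L i j))"
      using insert.hyps K'p by (subst double_sum_insert) auto
    finally show "(\<Sum>i\<in>insert p J. \<Sum>j\<in>insert p J. c i * cnj (c j) * (K i j * L i j)) \<in> \<real>\<^sub>\<ge>\<^sub>0"
      using IH[unfolded positive_kernel_def, rule_format, of c]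
        L[unfolded positive_kernel_def, rule_format, of "\<lambda>i. c i * u i"] by simp
  qed
qed

lemma positive_kernel_sum:
  assumes "positive_kernel I K"
  shows "(\<Sum>i\<in>I. \<Sum>j\<in>I. K i j) \<in> \<real>\<^sub>\<ge>\<^sub>0"
  using assms[unfolded positive_kernel_def, rule_format, of "\<lambda>_. 1"] by simp

lemma cinner_sum_sum:
  "cinner (\<Sum>i\<in>I. c i *\<^sub>C f i) (\<Sum>j\<in>J. d j *\<^sub>C g j) =
    (\<Sum>i\<in>I. \<Sum>j\<in>J. c i * cnj (d j) * cinner (f i) (g j))"
  by (simp only: cinner.sum_left, simp only: cinner.sum_right)
     (simp add: cinner_scaleC_left cinner_scaleC_right mult_ac)

lemma positive_kernel_gram: "positive_kernel I (\<lambda>i j. cinner (u i) (u j))"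
  unfolding positive_kernel_def cinner_sum_sum[symmetric] by (simp add: cinner_self)

section \<open>Tensor products of Hilbert spaces and of operators\<close>

text \<open>Both factors of the kernel difference are positive, the first because \<open>a\<close> is bounded by
  its norm and the second as a Gram kernel; their Schur product compares the two norms.\<close>

lemma norm_sum_tensor_le:
  fixes t :: "'a::chilbert_space \<Rightarrow> 'b::chilbert_space \<Rightarrow> 'k::chilbert_space"
  assumes t: "\<And>u v u' v'. cinner (t u v) (t u' v') = cinner u u' * cinner v v'"
    and a: "a \<in> bops" and I: "finite I"
  shows "norm (\<Sum>i\<in>I. t (blinfun_apply a (u i)) (v i)) \<le> norm a * norm (\<Sum>i\<in>I. t (u i) (v i))"
proof -
  have ns: "of_real ((norm (\<Sum>i\<in>I. t (f i) (v i)))\<^sup>2) =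
      (\<Sum>i\<in>I. \<Sum>j\<in>I. cinner (f i) (f j) * cinner (v i) (v j))" for f
    unfolding cinner_self[symmetric]
    by (simp only: cinner.sum_left, simp only: cinner.sum_right) (simp add: t)
  have "positive_kernel I (\<lambda>i j. of_real ((norm a)\<^sup>2) * cinner (u i) (u j) - cinner (a (u i)) (a (u j)))"
    unfolding positive_kernel_def
  proof
    fix c
    define w where "w = (\<Sum>i\<in>I. c i *\<^sub>C u i)"
    have aw: "a w = (\<Sum>i\<in>I. c i *\<^sub>C a (u i))"
      by (simp add: w_def blinfun.sum_right bopsD[OF a])
    have "(\<Sum>i\<in>I. \<Sum>j\<in>I. c i * cnj (c j) *
        (of_real ((norm a)\<^sup>2) * cinner (u i) (u j) - cinner (a (u i)) (a (u j)))) =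
        of_real ((norm a)\<^sup>2) * cinner w w - cinner (a w) (a w)"
      unfolding aw unfolding w_def cinner_sum_sum sum_distrib_left sum_subtractf[symmetric]
      by (intro sum.cong refl) (simp add: algebra_simps)
    also have "\<dots> = of_real ((norm a * norm w)\<^sup>2 - (norm (a w))\<^sup>2)"
      by (simp add: cinner_self power_mult_distrib)
    also have "\<dots> \<in> \<real>\<^sub>\<ge>\<^sub>0"
      unfolding nonneg_Reals_of_real_iff using power_mono[OF norm_blinfun, of a w 2] by simp
    finally show "(\<Sum>i\<in>I. \<Sum>j\<in>I. c i * cnj (c j) *
        (of_real ((norm a)\<^sup>2) * cinner (u i) (u j) - cinner (a (u i)) (a (u j)))) \<in> \<real>\<^sub>\<ge>\<^sub>0" .
  qed
  from positive_kernel_sum[OF positive_kernel_mult[OF I this positive_kernel_gram[of I v]]]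
  have "of_real ((norm a)\<^sup>2 * (norm (\<Sum>i\<in>I. t (u i) (v i)))\<^sup>2
      - (norm (\<Sum>i\<in>I. t (a (u i)) (v i)))\<^sup>2) \<in> (\<real>\<^sub>\<ge>\<^sub>0 :: complex set)"
    unfolding of_real_diff of_real_mult ns
    by (simp add: algebra_simps sum_subtractf sum_distrib_left)
  hence "(norm (\<Sum>i\<in>I. t (a (u i)) (v i)))\<^sup>2 \<le> (norm a * norm (\<Sum>i\<in>I. t (u i) (v i)))\<^sup>2"
    unfolding nonneg_Reals_of_real_iff power_mult_distrib by linarith
  thus ?thesis by (rule power2_le_imp_le) simp
qed

text \<open>The bound passes to the closure of the graph, which is therefore again a graph; by completeness
  its domain is closed, hence everything.\<close>

lemma bounded_graph_extension:
  fixes G :: "('a::real_normed_vector \<times> 'b::{real_normed_vector,complete_space}) set"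
  assumes G: "subspace G" and K: "\<And>x y. (x, y) \<in> G \<Longrightarrow> norm y \<le> K * norm x"
    and dense: "closure (fst ` G) = UNIV"
  shows "\<exists>T :: 'a \<Rightarrow>\<^sub>L 'b. \<forall>(x, y)\<in>G. blinfun_apply T x = y"
proof -
  have sub: "subspace (closure G)" by (rule subspace_closure[OF G])
  have "closure G \<subseteq> {z. norm (snd z) \<le> K * norm (fst z)}"
    using K by (intro closure_minimal closed_Collect_le continuous_intros) auto
  hence bound: "norm y \<le> K * norm x" if "(x, y) \<in> closure G" for x y using that by auto
  have "\<exists>y. (x, y) \<in> closure G" for x
  proof -
    obtain f where f: "\<And>n. f n \<in> fst ` G" "f \<longlonglongrightarrow> x"
      using dense closure_sequential[of x "fst ` G"] by auto
    have "\<exists>y. (f n, y) \<in> G" for n using f(1)[of n] by force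
    then obtain g where g: "\<And>n. (f n, g n) \<in> G" by metis
    have gb: "norm (g m - g n) \<le> \<bar>K\<bar> * norm (f m - f n)" for m n
    proof -
      have "(f m - f n, g m - g n) \<in> G" using subspace_diff[OF G g[of m] g[of n]] by simp
      hence "norm (g m - g n) \<le> K * norm (f m - f n)" by (rule K)
      also have "\<dots> \<le> \<bar>K\<bar> * norm (f m - f n)" by (intro mult_right_mono) auto
      finally show ?thesis .
    qed
    have "Cauchy g"
    proof (rule metric_CauchyI)
      fix e :: real assume e: "e > 0"
      have "Cauchy f" using f(2) by (rule LIMSEQ_imp_Cauchy)
      then obtain N where N: "\<And>m n. m \<ge> N \<Longrightarrow> n \<ge> N \<Longrightarrow> dist (f m) (f n) < e / (\<bar>K\<bar> + 1)"
        using e metric_CauchyD[of f "e / (\<bar>K\<bar> + 1)"] by (auto simp: add_nonneg_pos)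
      have "dist (g m) (g n) < e" if "m \<ge> N" "n \<ge> N" for m n
      proof -
        have "dist (g m) (g n) \<le> (\<bar>K\<bar> + 1) * dist (f m) (f n)"
          using gb[of m n] norm_ge_zero[of "f m - f n"]
          unfolding dist_norm distrib_right by linarith
        also have "\<dots> < (\<bar>K\<bar> + 1) * (e / (\<bar>K\<bar> + 1))"
          using N[OF that] by (intro mult_strict_left_mono) auto
        also have "\<dots> = e" by (simp add: field_simps)
        finally show ?thesis .
      qed
      thus "\<exists>N. \<forall>m\<ge>N. \<forall>n\<ge>N. dist (g m) (g n) < e" by blast
    qed
    then obtain y where "g \<longlonglongrightarrow> y" using Cauchy_convergent by (auto simp: convergent_def)
    hence "(\<lambda>n. (f n, g n)) \<longlonglongrightarrow> (x, y)" using f(2) by (intro tendsto_Pair)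
    hence "(x, y) \<in> closure G"
      unfolding closure_sequential using g by (intro exI[of _ "\<lambda>n. (f n, g n)"]) simp
    thus ?thesis by blast
  qed
  then obtain T where T: "\<And>x. (x, T x) \<in> closure G" by metis
  have uniq: "T x = y" if "(x, y) \<in> closure G" for x y
  proof -
    have "(0, T x - y) \<in> closure G" using subspace_diff[OF sub T[of x] that] by simp
    from bound[OF this] show ?thesis by simp
  qed
  have "bounded_linear T"
  proof (rule bounded_linear_intro[where K = K])
    show "T (x + y) = T x + T y" for x y
      using subspace_add[OF sub T[of x] T[of y]] by (intro uniq) simp
    show "T (r *\<^sub>R x) = r *\<^sub>R T x" for r x
      using subspace_scale[OF sub T[of x], of r] by (intro uniq) simp
    show "norm (T x) \<le> norm x * K" for x
      using bound[OF T[of x]] by (simp add: mult.commute)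
  qed
  hence "blinfun_apply (Blinfun T) x = y" if "(x, y) \<in> G" for x y
    using uniq[of x y] that closure_subset[of G] by (auto simp: bounded_linear_Blinfun_apply)
  thus ?thesis by blast
qed

locale tensor_product =
  fixes t :: "'a::chilbert_space \<Rightarrow> 'b::chilbert_space \<Rightarrow> 'k::chilbert_space"
  assumes hilbert_tensor: "hilbert_tensor t"
begin

lemma
  shows add_left: "t (u + u') v = t u v + t u' v"
    and add_right: "t u (v + v') = t u v + t u v'"
    and scaleC_left: "t (c *\<^sub>C u) v = c *\<^sub>C t u v"
    and cinner_tensor: "cinner (t u v) (t u' v') = cinner u u' * cinner v v'"
    and dense: "closure (span {t u v | u v. True}) = UNIV"
  using hilbert_tensor unfolding hilbert_tensor_def by blast+

lemma norm_tensor: "norm (t u v) = norm u * norm v"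
proof -
  have "complex_of_real ((norm (t u v))\<^sup>2) = of_real ((norm u * norm v)\<^sup>2)"
    by (simp only: cinner_self[symmetric] cinner_tensor)
       (simp add: cinner_self power_mult_distrib)
  hence "(norm (t u v))\<^sup>2 = (norm u * norm v)\<^sup>2" by (simp only: of_real_eq_iff)
  thus ?thesis by (simp add: power2_eq_iff_nonneg)
qed

lemma blinfun_tensor_eqI:
  fixes f g :: "'k \<Rightarrow>\<^sub>L 'c::real_normed_vector"
  assumes "\<And>u v. f (t u v) = g (t u v)"
  shows "f = g"
proof (rule blinfun_eqI)
  have "closure (span {t u v | u v. True}) \<subseteq> {x. f x = g x}"
  proof (rule closed_subspace_minimal)
    show "subspace {x. f x = g x}"
      by (auto simp: subspace_def blinfun.add_right blinfun.scaleR_right)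
    show "closed {x. f x = g x}" by (intro closed_Collect_eq continuous_intros)
  qed (use assms in auto)
  thus "f x = g x" for x using dense by auto
qed

lemma tensor_vector_eqI:
  assumes "\<And>u v. cinner x (t u v) = cinner y (t u v)"
  shows "x = y"
proof (rule cinner_eqI)
  have "closure (span {t u v | u v. True}) \<subseteq> {w. cinner x w = cinner y w}"
  proof (rule closed_subspace_minimal)
    show "subspace {w. cinner x w = cinner y w}"
      by (auto simp: subspace_def cinner.zero_right cinner_add_right cinner.scaleR_right)
    show "closed {w. cinner x w = cinner y w}"
      by (intro closed_Collect_eq continuous_intros cinner.continuous_on)
  qed (use assms in auto)
  thus "cinner x w = cinner y w" for w using dense by auto
qed

text \<open>On finite sums of simple tensors the product operator is applied one factor at a time, and
  \<open>norm_sum_tensor_le\<close> bounds each application. In particular the value does not depend on the chosen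
  representation as a sum.\<close>

lemma op_tensor_exists:
  assumes a: "a \<in> bops" and b: "b \<in> bops"
  shows "\<exists>c\<in>bops. \<forall>u v. c (t u v) = t (a u) (b v)"
proof -
  define E where "E = {(t u v, t (a u) (b v)) | u v. True}"
  have scaleR: "r *\<^sub>R t u v = t (r *\<^sub>R u) v" for r u v by (simp add: scaleR_scaleC scaleC_left)
  have bound: "norm y \<le> norm a * norm b * norm x" if "(x, y) \<in> span E" for x y
  proof -
    define z where "z = (x, y)"
    have "z \<in> span E" using that by (simp add: z_def)
    then obtain F r where F: "finite F" "F \<subseteq> E" and "z = (\<Sum>e\<in>F. r e *\<^sub>R e)"
      by (auto simp: span_explicit)
    hence xy: "(x, y) = (\<Sum>e\<in>F. r e *\<^sub>R e)" by (simp only: z_def)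
    have "\<forall>e\<in>F. \<exists>u v. e = (t u v, t (a u) (b v))" using F by (auto simp: E_def)
    then obtain u v where uv: "\<And>e. e \<in> F \<Longrightarrow> e = (t (u e) (v e), t (a (u e)) (b (v e)))" by metis
    have x: "x = (\<Sum>e\<in>F. t (r e *\<^sub>R u e) (v e))"
    proof -
      have "x = (\<Sum>e\<in>F. r e *\<^sub>R fst e)" using arg_cong[OF xy, of fst] by (simp add: fst_sum)
      also have "\<dots> = (\<Sum>e\<in>F. t (r e *\<^sub>R u e) (v e))"
        by (intro sum.cong refl) (metis uv fst_conv scaleR)
      finally show ?thesis .
    qed
    have y: "y = (\<Sum>e\<in>F. t (a (r e *\<^sub>R u e)) (b (v e)))"
    proof -
      have "y = (\<Sum>e\<in>F. r e *\<^sub>R snd e)" using arg_cong[OF xy, of snd] by (simp add: snd_sum)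
      also have "\<dots> = (\<Sum>e\<in>F. t (a (r e *\<^sub>R u e)) (b (v e)))"
        by (intro sum.cong refl) (metis uv snd_conv scaleR blinfun.scaleR_right)
      finally show ?thesis .
    qed
    have "norm y \<le> norm a * norm (\<Sum>e\<in>F. t (r e *\<^sub>R u e) (b (v e)))"
      unfolding y by (rule norm_sum_tensor_le[OF cinner_tensor a F(1)])
    also have "\<dots> \<le> norm a * (norm b * norm (\<Sum>e\<in>F. t (r e *\<^sub>R u e) (v e)))"
      using norm_sum_tensor_le[of "\<lambda>v u. t u v", OF _ b F(1)]
      by (intro mult_left_mono) (auto simp: cinner_tensor mult.commute)
    finally show ?thesis by (simp add: x mult.assoc)
  qed
  have fst_dense: "closure (fst ` span E) = UNIV"
  proof -
    have "fst ` span E = span (fst ` E)"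
      by (rule linear_span_image[symmetric]) (simp add: linear_iff)
    also have "fst ` E = {t u v | u v. True}" by (force simp: E_def)
    finally show ?thesis using dense by simp
  qed
  have "\<exists>c :: 'k \<Rightarrow>\<^sub>L 'k. \<forall>(x, y)\<in>span E. c x = y"
    by (rule bounded_graph_extension[OF subspace_span _ fst_dense]) (rule bound)
  then obtain c :: "'k \<Rightarrow>\<^sub>L 'k" where cE: "\<forall>(x, y)\<in>span E. c x = y"
    by blast
  have c: "c x = y" if "(x, y) \<in> span E" for x y using cE that by auto
  have ct: "c (t u v) = t (a u) (b v)" for u v
    by (rule c) (auto simp: E_def intro: span_base)
  have "c o\<^sub>L op_scaleC z id_blinfun = op_scaleC z c" for z
    by (rule blinfun_tensor_eqI) (simp add: ct flip: scaleC_left, simp add: bopsD[OF a])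
  hence "c (z *\<^sub>C x) = z *\<^sub>C c x" for z x
    by (metis blinfun_apply_blinfun_compose op_scaleC_apply blinfun_apply_id_blinfun id_apply)
  hence "c \<in> bops" by (simp add: bops_def)
  thus ?thesis using ct by blast
qed

lemma
  assumes "a \<in> bops" "b \<in> bops"
  shows op_tensor_bops: "op_tensor t a b \<in> bops"
    and op_tensor_apply: "op_tensor t a b (t u v) = t (a u) (b v)"
proof -
  let ?P = "\<lambda>c. c \<in> bops \<and> (\<forall>u v. blinfun_apply c (t u v) = t (a u) (b v))"
  have "\<exists>!c. ?P c"
  proof (rule ex_ex1I)
    show "\<exists>c. ?P c" using op_tensor_exists[OF assms] by blast
    show "c = d" if "?P c" "?P d" for c d
      using that by (intro blinfun_tensor_eqI) simp
  qed
  from theI'[OF this] show "op_tensor t a b \<in> bops" "op_tensor t a b (t u v) = t (a u) (b v)"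
    unfolding op_tensor_def by auto
qed

lemma op_tensor_comp:
  assumes "a \<in> bops" "b \<in> bops" "a' \<in> bops" "b' \<in> bops"
  shows "op_tensor t a b o\<^sub>L op_tensor t a' b' = op_tensor t (a o\<^sub>L a') (b o\<^sub>L b')"
proof -
  have "a o\<^sub>L a' \<in> bops" "b o\<^sub>L b' \<in> bops" using assms by (auto simp: bops_def)
  thus ?thesis using assms by (intro blinfun_tensor_eqI) (simp add: op_tensor_apply)
qed

lemma op_tensor_adj:
  assumes "a \<in> bops" "b \<in> bops"
  shows "op_adj (op_tensor t a b) = op_tensor t (op_adj a) (op_adj b)"
proof (intro blinfun_tensor_eqI tensor_vector_eqI)
  show "cinner (op_adj (op_tensor t a b) (t u v)) (t u' v') =
      cinner (op_tensor t (op_adj a) (op_adj b) (t u v)) (t u' v')" for u v u' v'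
    using assms
    by (simp add: op_tensor_apply op_tensor_bops bops_adj cinner_op_adj_left cinner_tensor)
qed

lemma op_tensor_id: "op_tensor t id_blinfun id_blinfun = id_blinfun"
proof (rule blinfun_tensor_eqI)
  have "id_blinfun \<in> bops" by (simp add: bops_def)
  thus "op_tensor t id_blinfun id_blinfun (t u v) = id_blinfun (t u v)" for u v
    by (simp add: op_tensor_apply bops_def)
qed

lemma op_tensor_scaleC:
  assumes "a \<in> bops" "b \<in> bops"
  shows "op_scaleC c (op_tensor t a b) = op_tensor t (op_scaleC c a) b"
proof (rule blinfun_tensor_eqI)
  have "op_scaleC c a \<in> bops" using assms by (auto simp: bops_def scaleC_scaleC mult.commute)
  thus "op_scaleC c (op_tensor t a b) (t u v) = op_tensor t (op_scaleC c a) b (t u v)" for u v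
    using assms by (simp add: op_tensor_apply scaleC_left)
qed

end

section \<open>Normal states\<close>

lemma vn_sum:
  assumes "von_neumann_algebra M" "\<And>i. i \<in> I \<Longrightarrow> a i \<in> M"
  shows "(\<Sum>i\<in>I. a i) \<in> M"
  using subspace_sum[OF vn_subspace[OF assms(1)], of I a] assms(2) by blast

lemma op_adj_sum:
  assumes "\<And>i. i \<in> I \<Longrightarrow> a i \<in> bops"
  shows "op_adj (\<Sum>i\<in>I. a i) = (\<Sum>i\<in>I. op_adj (a i))"
  by (rule op_adj_unique)
     (simp add: blinfun.sum_left cinner.sum_left cinner.sum_right cinner_op_adj_left assms)

locale vn_state =
  fixes M :: "('a::chilbert_space \<Rightarrow>\<^sub>L 'a) set" and chi :: "('a \<Rightarrow>\<^sub>L 'a) \<Rightarrow> complex"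
  assumes vn: "von_neumann_algebra M" and state: "normal_state M chi"
begin

lemma add: "a \<in> M \<Longrightarrow> b \<in> M \<Longrightarrow> chi (a + b) = chi a + chi b"
  and scaleC: "a \<in> M \<Longrightarrow> chi (op_scaleC c a) = c * chi a"
  and positive: "a \<in> M \<Longrightarrow> chi (op_adj a o\<^sub>L a) \<in> \<real>\<^sub>\<ge>\<^sub>0"
  and unit: "chi id_blinfun = 1"
  using state unfolding normal_state_def by auto

lemma bops: "a \<in> M \<Longrightarrow> a \<in> bops"
  using vn_bops[OF vn] by blast

lemma scaleR: "a \<in> M \<Longrightarrow> chi (r *\<^sub>R a) = of_real r * chi a"
  by (metis scaleC op_scaleC_of_real)

lemma diff: "a \<in> M \<Longrightarrow> b \<in> M \<Longrightarrow> chi (a - b) = chi a - chi b"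
  using add[of "a - b" b] vn_diff[OF vn] by simp

lemma zero: "chi 0 = 0"
  using diff[of 0 0] vn_zero[OF vn] by simp

lemma sum: "(\<And>i. i \<in> I \<Longrightarrow> a i \<in> M) \<Longrightarrow> chi (\<Sum>i\<in>I. a i) = (\<Sum>i\<in>I. chi (a i))"
  by (induction I rule: infinite_finite_induct) (auto simp: zero add vn_sum[OF vn])

lemma complex_linear: "complex_linear_on M chi"
  by (simp add: complex_linear_on_def add scaleC)

lemma normal: "normal_functional M chi"
  using state vn_bops[OF vn] vn_zero[OF vn] vn_add[OF vn] vn_scaleC[OF vn] complex_linear
  by (intro normal_functional_if_continuous) (auto simp: normal_state_def)

text \<open>This one fact yields the hermitian symmetry and the Cauchy-Schwarz inequality of a state as well as
  the kernels to which the Schur product is applied.\<close>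

lemma positive_kernel_state:
  assumes a: "\<And>i. i \<in> I \<Longrightarrow> a i \<in> M"
  shows "positive_kernel I (\<lambda>i j. chi (op_adj (a j) o\<^sub>L a i))"
  unfolding positive_kernel_def
proof
  fix c
  define X where "X = (\<Sum>i\<in>I. op_scaleC (c i) (a i))"
  have XM: "X \<in> M" unfolding X_def by (intro vn_sum[OF vn] vn_scaleC[OF vn] a)
  have ca: "op_scaleC (c i) (a i) \<in> bops" if "i \<in> I" for i
    using that by (intro bops vn_scaleC[OF vn] a)
  have "op_adj X = (\<Sum>j\<in>I. op_scaleC (cnj (c j)) (op_adj (a j)))"
    unfolding X_def using ca a bops by (simp add: op_adj_sum op_adj_scaleC cong: sum.cong)
  note adjX = this
  have "op_adj X o\<^sub>L X =
      (\<Sum>j\<in>I. \<Sum>i\<in>I. op_scaleC (c i * cnj (c j)) (op_adj (a j) o\<^sub>L a i))"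
  proof (rule blinfun_eqI)
    fix v
    have "(op_adj X o\<^sub>L X) v = (\<Sum>j\<in>I. cnj (c j) *\<^sub>C op_adj (a j) (X v))"
      by (simp add: adjX blinfun.sum_left)
    also have "\<dots> = (\<Sum>j\<in>I. \<Sum>i\<in>I. (c i * cnj (c j)) *\<^sub>C op_adj (a j) (a i v))"
    proof (rule sum.cong[OF refl])
      fix j assume "j \<in> I"
      hence "op_adj (a j) \<in> bops" by (intro bops_adj bops a)
      thus "cnj (c j) *\<^sub>C op_adj (a j) (X v) =
          (\<Sum>i\<in>I. (c i * cnj (c j)) *\<^sub>C op_adj (a j) (a i v))"
        by (simp add: X_def blinfun.sum_left blinfun.sum_right bopsD scaleC_scaleC
            scaleC_sum_right mult.commute)
    qed
    also have "\<dots> = (\<Sum>j\<in>I. \<Sum>i\<in>I. op_scaleC (c i * cnj (c j)) (op_adj (a j) o\<^sub>L a i)) v"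
      by (simp add: blinfun.sum_left)
    finally show "(op_adj X o\<^sub>L X) v =
        (\<Sum>j\<in>I. \<Sum>i\<in>I. op_scaleC (c i * cnj (c j)) (op_adj (a j) o\<^sub>L a i)) v" .
  qed
  also have "\<dots> = (\<Sum>i\<in>I. \<Sum>j\<in>I. op_scaleC (c i * cnj (c j)) (op_adj (a j) o\<^sub>L a i))"
    by (rule sum.swap)
  finally have "chi (op_adj X o\<^sub>L X) =
      (\<Sum>i\<in>I. \<Sum>j\<in>I. c i * cnj (c j) * chi (op_adj (a j) o\<^sub>L a i))"
    using a by (simp add: sum scaleC vn_sum[OF vn] vn_scaleC[OF vn] vn_comp[OF vn] vn_adj[OF vn]
        cong: sum.cong)
  thus "(\<Sum>i\<in>I. \<Sum>j\<in>I. c i * cnj (c j) * chi (op_adj (a j) o\<^sub>L a i)) \<in> \<real>\<^sub>\<ge>\<^sub>0"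
    using positive[OF XM] by simp
qed

lemma adj:
  assumes "a \<in> M"
  shows "chi (op_adj a) = cnj (chi a)"
proof -
  have "positive_kernel (UNIV :: bool set)
      (\<lambda>i j. chi (op_adj (if j then a else id_blinfun) o\<^sub>L (if i then a else id_blinfun)))"
    by (rule positive_kernel_state) (use assms vn_id[OF vn] in auto)
  from positive_kernel_hermitian[OF this, of True False]
  have "chi (op_adj a o\<^sub>L id_blinfun) = cnj (chi (id_blinfun o\<^sub>L a))" by simp
  moreover have "op_adj a o\<^sub>L id_blinfun = op_adj a" "id_blinfun o\<^sub>L a = a"
    by (auto intro: blinfun_eqI)
  ultimately show ?thesis by simp
qed

lemma Cauchy_Schwarz:
  assumes "a \<in> M" "b \<in> M"
  shows "(cmod (chi (op_adj b o\<^sub>L a)))\<^sup>2 \<le> Re (chi (op_adj a o\<^sub>L a)) * Re (chi (op_adj b o\<^sub>L b))"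
proof -
  have "positive_kernel (UNIV :: bool set)
      (\<lambda>i j. chi (op_adj (if j then a else b) o\<^sub>L (if i then a else b)))"
    by (rule positive_kernel_state) (use assms in auto)
  from positive_kernel_Cauchy_Schwarz[OF this, of True False] show ?thesis
    by simp
qed

end

section \<open>The product of normal states\<close>

lemma prod_decode_sums:
  fixes f g :: "nat \<Rightarrow> 'a::{real_normed_field,banach}"
  assumes f: "summable (\<lambda>n. norm (f n))" and g: "summable (\<lambda>n. norm (g n))"
  shows "(\<lambda>n. f (fst (prod_decode n)) * g (snd (prod_decode n))) sums (suminf f * suminf g)"
proof -
  have fs: "(f has_sum suminf f) UNIV" and gs: "(g has_sum suminf g) UNIV"
    using f g by (auto intro!: norm_summable_imp_has_sum summable_sums summable_norm_cancel)
  have fa: "(\<lambda>x. norm (f x)) summable_on UNIV" and ga: "(\<lambda>y. norm (g y)) summable_on UNIV"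
    using f g by (auto simp: summable_on_UNIV_nonneg_real_iff)
  let ?F = "\<lambda>(i, j). f i * g j"
  have "(\<lambda>z. norm (?F z)) summable_on UNIV \<times> UNIV"
    unfolding Infinite_Sum.abs_summable_on_Sigma_iff
  proof (intro conjI ballI)
    show "(\<lambda>y. norm (?F (x, y))) summable_on UNIV" for x
      using ga by (simp add: norm_mult summable_on_cmult_right)
    show "(\<lambda>x. norm (\<Sum>\<^sub>\<infinity>y\<in>UNIV. norm (?F (x, y)))) summable_on UNIV"
      using fa ga by (simp add: norm_mult infsum_cmult_right infsum_nonneg summable_on_cmult_left)
  qed
  hence Fs: "?F summable_on UNIV \<times> UNIV" by (rule abs_summable_summable)
  have "infsum ?F (UNIV \<times> UNIV) = (\<Sum>\<^sub>\<infinity>x. \<Sum>\<^sub>\<infinity>y. ?F (x, y))"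
    by (rule infsum_Sigma_banach[OF Fs, symmetric])
  also have "\<dots> = (\<Sum>\<^sub>\<infinity>x. f x * suminf g)"
    using gs by (simp add: infsum_cmult_right has_sum_imp_summable infsumI)
  also have "\<dots> = suminf f * suminf g"
    using fs by (simp add: infsum_cmult_left has_sum_imp_summable infsumI)
  finally have "(?F has_sum suminf f * suminf g) UNIV"
    using has_sum_infsum[OF Fs] by simp
  hence "((\<lambda>n. ?F (prod_decode n)) has_sum suminf f * suminf g) UNIV"
    by (subst has_sum_reindex_bij_betw[OF bij_prod_decode])
  from has_sum_imp_sums[OF this] show ?thesis by (simp add: case_prod_unfold)
qed

definition simple_tensors ::
  "('a::chilbert_space \<Rightarrow> 'b::chilbert_space \<Rightarrow> 'k::chilbert_space) \<Rightarrow>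
    ('a \<Rightarrow>\<^sub>L 'a) set \<Rightarrow> ('b \<Rightarrow>\<^sub>L 'b) set \<Rightarrow> ('k \<Rightarrow>\<^sub>L 'k) set"
  where "simple_tensors t M N = {op_tensor t a b | a b. a \<in> M \<and> b \<in> N}"

definition tensor_seq ::
  "('a::chilbert_space \<Rightarrow> 'b::chilbert_space \<Rightarrow> 'k::chilbert_space) \<Rightarrow>
    'a ell2 \<Rightarrow> 'b ell2 \<Rightarrow> 'k ell2"
  where "tensor_seq t x y =
    Ell2 (\<lambda>n. t (coord x (fst (prod_decode n))) (coord y (snd (prod_decode n))))"

locale vn_tensor_product = tensor_product t
  for t :: "'a::chilbert_space \<Rightarrow> 'b::chilbert_space \<Rightarrow> 'k::chilbert_space" +
  fixes M :: "('a \<Rightarrow>\<^sub>L 'a) set" and N :: "('b \<Rightarrow>\<^sub>L 'b) set"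
  assumes vn_M: "von_neumann_algebra M" and vn_N: "von_neumann_algebra N"
begin

lemma bops_M: "a \<in> M \<Longrightarrow> a \<in> bops" and bops_N: "b \<in> N \<Longrightarrow> b \<in> bops"
  using vn_bops[OF vn_M] vn_bops[OF vn_N] by auto

sublocale simple: star_submonoid "simple_tensors t M N"
proof
  show "simple_tensors t M N \<subseteq> bops"
    by (auto simp: simple_tensors_def intro: op_tensor_bops bops_M bops_N)
  show "id_blinfun \<in> simple_tensors t M N"
    unfolding simple_tensors_def using vn_id[OF vn_M] vn_id[OF vn_N] op_tensor_id
    by (metis (mono_tags, lifting) mem_Collect_eq)
next
  fix x y assume "x \<in> simple_tensors t M N" "y \<in> simple_tensors t M N"
  then obtain a b c d where "a \<in> M" "b \<in> N" "c \<in> M" "d \<in> N"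
    and "x = op_tensor t a b" "y = op_tensor t c d" by (auto simp: simple_tensors_def)
  thus "x o\<^sub>L y \<in> simple_tensors t M N"
    by (auto simp: simple_tensors_def op_tensor_comp bops_M bops_N
        intro: vn_comp[OF vn_M] vn_comp[OF vn_N])
next
  fix x assume "x \<in> simple_tensors t M N"
  then obtain a b where ab: "a \<in> M" "b \<in> N" "x = op_tensor t a b"
    by (auto simp: simple_tensors_def)
  thus "op_adj x \<in> simple_tensors t M N"
    by (auto simp: simple_tensors_def op_tensor_adj bops_M bops_N
        intro: vn_adj[OF vn_M] vn_adj[OF vn_N])
  show "op_scaleC c x \<in> simple_tensors t M N" for c
    using ab by (auto simp: simple_tensors_def op_tensor_scaleC bops_M bops_N
        intro: vn_scaleC[OF vn_M])
qed

lemma vn_tensor_eq: "vn_tensor t M N = commutant (commutant (simple_tensors t M N))"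
  unfolding vn_tensor_def simple_tensors_def[symmetric]
  by (rule hull_von_neumann_algebra) (rule simple.bops, rule simple.adj)

lemma vn_vn_tensor: "von_neumann_algebra (vn_tensor t M N)"
  unfolding vn_tensor_eq by (rule von_neumann_bicommutant) (rule simple.bops, rule simple.adj)

lemma op_tensor_in: "a \<in> M \<Longrightarrow> b \<in> N \<Longrightarrow> op_tensor t a b \<in> vn_tensor t M N"
  unfolding vn_tensor_eq using bicommutant_superset[OF simple.bops]
  by (auto simp: simple_tensors_def)

lemma normal_functional_vn_tensor_eqI:
  assumes "normal_functional (vn_tensor t M N) f" "normal_functional (vn_tensor t M N) g"
    and "\<And>a b. a \<in> M \<Longrightarrow> b \<in> N \<Longrightarrow> f (op_tensor t a b) = g (op_tensor t a b)"
    and "X \<in> vn_tensor t M N"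
  shows "f X = g X"
  by (rule simple.normal_functional_eqI[OF assms(1,2)[unfolded vn_tensor_eq] _
        assms(4)[unfolded vn_tensor_eq]])
     (auto simp: simple_tensors_def assms(3))

lemma span_simple_tensors:
  assumes "Z \<in> span (simple_tensors t M N)"
  obtains F :: "('k \<Rightarrow>\<^sub>L 'k) set" and a b where "finite F" "\<And>i. i \<in> F \<Longrightarrow> a i \<in> M"
    "\<And>i. i \<in> F \<Longrightarrow> b i \<in> N" "Z = (\<Sum>i\<in>F. op_tensor t (a i) (b i))"
proof -
  obtain F r where F: "finite F" "F \<subseteq> simple_tensors t M N" and Z: "Z = (\<Sum>e\<in>F. r e *\<^sub>R e)"
    using assms by (auto simp: span_explicit)
  have "\<forall>e\<in>F. \<exists>a b. a \<in> M \<and> b \<in> N \<and> e = op_tensor t a b"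
    using F(2) unfolding simple_tensors_def by blast
  then obtain a b where ab: "\<And>e. e \<in> F \<Longrightarrow> a e \<in> M" "\<And>e. e \<in> F \<Longrightarrow> b e \<in> N"
      "\<And>e. e \<in> F \<Longrightarrow> e = op_tensor t (a e) (b e)"
    by metis
  have "Z = (\<Sum>e\<in>F. op_tensor t (op_scaleC (of_real (r e)) (a e)) (b e))"
    unfolding Z
  proof (rule sum.cong[OF refl])
    fix e assume e: "e \<in> F"
    have "r e *\<^sub>R e = op_scaleC (of_real (r e)) (op_tensor t (a e) (b e))"
      using ab(3)[OF e] by (simp add: op_scaleC_of_real)
    thus "r e *\<^sub>R e = op_tensor t (op_scaleC (of_real (r e)) (a e)) (b e)"
      using ab(1,2)[OF e] by (simp add: op_tensor_scaleC bops_M bops_N)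
  qed
  thus ?thesis
    using that[of F "\<lambda>e. op_scaleC (of_real (r e)) (a e)" b] F(1) ab(1,2) vn_scaleC[OF vn_M]
    by blast
qed

lemma coord_tensor_seq:
  "coord (tensor_seq t x y) n = t (coord x (fst (prod_decode n))) (coord y (snd (prod_decode n)))"
proof -
  have "(\<lambda>n. (norm (coord x (fst (prod_decode n))))\<^sup>2 * (norm (coord y (snd (prod_decode n))))\<^sup>2)
      sums ((\<Sum>n. (norm (coord x n))\<^sup>2) * (\<Sum>n. (norm (coord y n))\<^sup>2))"
    by (rule prod_decode_sums) (simp_all add: coord_summable)
  hence "summable (\<lambda>n. (norm (t (coord x (fst (prod_decode n))) (coord y (snd (prod_decode n)))))\<^sup>2)"
    by (simp add: norm_tensor power_mult_distrib sums_iff)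
  thus ?thesis by (simp add: tensor_seq_def coord_Ell2)
qed

lemma cinner_amp_tensor_seq:
  assumes "a \<in> bops" "b \<in> bops"
  shows "cinner (amp (op_tensor t a b) (tensor_seq t x x')) (tensor_seq t y y') =
    cinner (amp a x) y * cinner (amp b x') y'"
proof -
  have summ: "summable (\<lambda>n. cmod (cinner (coord u n) (coord v n)))" for u v :: "'c::chilbert_space ell2"
    by (rule summable_comparison_test'[OF summable_norm_mult[OF coord_summable coord_summable]])
       (use Cauchy_Schwarz_cinner in auto)
  have "(\<lambda>n. cinner (coord (amp a x) (fst (prod_decode n))) (coord y (fst (prod_decode n))) *
      cinner (coord (amp b x') (snd (prod_decode n))) (coord y' (snd (prod_decode n))))
      sums (cinner (amp a x) y * cinner (amp b x') y')"
    unfolding cinner_ell2_def by (rule prod_decode_sums) (rule summ)+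
  thus ?thesis using assms
    by (simp add: cinner_ell2_def[of "amp (op_tensor t a b) _"] coord_amp coord_tensor_seq
        op_tensor_apply cinner_tensor sums_iff)
qed

text \<open>A product state is a matrix coefficient at tensor products of square-summable sequences.
  The left and the right sequence of such a coefficient may differ, so positivity is not visible
  from the formula: on sums of simple tensors it is the Schur product of the two kernels given by
  the factors, and it passes to the closure.\<close>

lemma product_state_exists:
  assumes chi1: "normal_state M chi1" and chi2: "normal_state N chi2"
  shows "\<exists>\<psi>. normal_state (vn_tensor t M N) \<psi> \<and>
    (\<forall>a\<in>M. \<forall>b\<in>N. \<psi> (op_tensor t a b) = chi1 a * chi2 b)"
proof -
  interpret c1: vn_state M chi1 by standard (rule vn_M, rule chi1)
  interpret c2: vn_state N chi2 by standard (rule vn_N, rule chi2)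
  obtain x y where xy: "\<And>a. a \<in> M \<Longrightarrow> chi1 a = cinner (amp a x) y"
    using c1.normal by (auto simp: normal_functional_def)
  obtain x' y' where xy': "\<And>b. b \<in> N \<Longrightarrow> chi2 b = cinner (amp b x') y'"
    using c2.normal by (auto simp: normal_functional_def)
  define \<xi> \<eta> where "\<xi> = tensor_seq t x x'" and "\<eta> = tensor_seq t y y'"
  define \<psi> where "\<psi> c = cinner (amp c \<xi>) \<eta>" for c
  have prod: "\<psi> (op_tensor t a b) = chi1 a * chi2 b" if "a \<in> M" "b \<in> N" for a b
    using that by (simp add: \<psi>_def \<xi>_def \<eta>_def cinner_amp_tensor_seq bops_M bops_N xy xy')
  have adj: "\<psi> (op_adj X o\<^sub>L Y) = cinner (amp Y \<xi>) (amp X \<eta>)" if "X \<in> bops" for X Y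
    using that by (simp add: \<psi>_def amp_comp cinner_amp_adj_left)
  have pos_span: "cinner (amp Z \<xi>) (amp Z \<eta>) \<in> \<real>\<^sub>\<ge>\<^sub>0" if "Z \<in> span (simple_tensors t M N)" for Z
  proof -
    obtain F :: "('k \<Rightarrow>\<^sub>L 'k) set" and a b where F: "finite F"
      and ab: "\<And>i. i \<in> F \<Longrightarrow> a i \<in> M" "\<And>i. i \<in> F \<Longrightarrow> b i \<in> N"
      and Z: "Z = (\<Sum>i\<in>F. op_tensor t (a i) (b i))"
      using span_simple_tensors[OF \<open>Z \<in> _\<close>] by metis
    have amp_sum: "amp Z v = (\<Sum>i\<in>F. amp (op_tensor t (a i) (b i)) v)" for v
      unfolding Z by (rule ell2_eqI) (simp add: coord_amp coord_sum blinfun.sum_left)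
    have "cinner (amp Z \<xi>) (amp Z \<eta>) = (\<Sum>i\<in>F. \<Sum>j\<in>F.
        cinner (amp (op_tensor t (a i) (b i)) \<xi>) (amp (op_tensor t (a j) (b j)) \<eta>))"
      unfolding amp_sum by (simp only: cinner.sum_left, simp only: cinner.sum_right)
    also have "\<dots> = (\<Sum>i\<in>F. \<Sum>j\<in>F. chi1 (op_adj (a j) o\<^sub>L a i) * chi2 (op_adj (b j) o\<^sub>L b i))"
    proof (intro sum.cong refl)
      fix i j assume ij: "i \<in> F" "j \<in> F"
      have "cinner (amp (op_tensor t (a i) (b i)) \<xi>) (amp (op_tensor t (a j) (b j)) \<eta>) =
          \<psi> (op_adj (op_tensor t (a j) (b j)) o\<^sub>L op_tensor t (a i) (b i))"
        using ij ab by (simp add: adj op_tensor_bops bops_M bops_N)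
      also have "op_adj (op_tensor t (a j) (b j)) o\<^sub>L op_tensor t (a i) (b i) =
          op_tensor t (op_adj (a j) o\<^sub>L a i) (op_adj (b j) o\<^sub>L b i)"
        using ij ab by (simp add: op_tensor_adj op_tensor_comp bops_M bops_N bops_adj)
      also have "\<psi> \<dots> = chi1 (op_adj (a j) o\<^sub>L a i) * chi2 (op_adj (b j) o\<^sub>L b i)"
        using ij ab by (intro prod vn_comp[OF vn_M] vn_comp[OF vn_N] vn_adj[OF vn_M] vn_adj[OF vn_N])
      finally show "cinner (amp (op_tensor t (a i) (b i)) \<xi>) (amp (op_tensor t (a j) (b j)) \<eta>) =
          chi1 (op_adj (a j) o\<^sub>L a i) * chi2 (op_adj (b j) o\<^sub>L b i)" .
    qed
    also have "\<dots> \<in> \<real>\<^sub>\<ge>\<^sub>0"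
      by (intro positive_kernel_sum positive_kernel_mult F c1.positive_kernel_state
          c2.positive_kernel_state ab)
    finally show ?thesis .
  qed
  have pos: "\<psi> (op_adj X o\<^sub>L X) \<in> \<real>\<^sub>\<ge>\<^sub>0" if X: "X \<in> vn_tensor t M N" for X
  proof -
    have "\<exists>Z. Z \<in> span (simple_tensors t M N) \<and>
        norm (amp (X - Z) \<xi>) < inverse (Suc n) \<and> norm (amp (X - Z) \<eta>) < inverse (Suc n)" for n
      by (rule simple.strong_star_density[of X "inverse (Suc n)" \<xi> \<eta>])
         (use X[unfolded vn_tensor_eq] in auto)
    then obtain Z where Z: "\<And>n. Z n \<in> span (simple_tensors t M N)"
      and lim: "\<And>n. norm (amp (X - Z n) \<xi>) < inverse (Suc n)"
        "\<And>n. norm (amp (X - Z n) \<eta>) < inverse (Suc n)"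
      by metis
    have conv: "(\<lambda>n. amp (Z n) v) \<longlonglongrightarrow> amp X v"
      if v: "\<And>n. norm (amp (X - Z n) v) < inverse (Suc n)" for v
    proof (rule LIM_zero_cancel, rule Lim_null_comparison[OF _ LIMSEQ_inverse_real_of_nat])
      show "\<forall>\<^sub>F n in sequentially. norm (amp (Z n) v - amp X v) \<le> inverse (real (Suc n))"
        using v by (intro always_eventually allI) (simp add: amp_diff norm_minus_commute less_imp_le)
    qed
    have "(\<lambda>n. cinner (amp (Z n) \<xi>) (amp (Z n) \<eta>)) \<longlonglongrightarrow> cinner (amp X \<xi>) (amp X \<eta>)"
      by (intro cinner.tendsto conv lim)
    hence "cinner (amp X \<xi>) (amp X \<eta>) \<in> \<real>\<^sub>\<ge>\<^sub>0"
      by (rule closed_sequentially[OF closed_nonneg_Reals_complex pos_span[OF Z]])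
    thus ?thesis using adj vn_bops[OF vn_vn_tensor] X by auto
  qed
  have "normal_functional (vn_tensor t M N) \<psi>"
    unfolding \<psi>_def by (rule normal_functional_coefficient)
  moreover have "\<psi> id_blinfun = 1"
    using prod[OF vn_id[OF vn_M] vn_id[OF vn_N]] by (simp add: op_tensor_id c1.unit c2.unit)
  ultimately have "normal_state (vn_tensor t M N) \<psi>"
    unfolding normal_state_def
    using pos continuous_normal_functional[OF vn_bops[OF vn_vn_tensor]]
    by (auto simp: \<psi>_def amp_add amp_scaleC cinner_add_left cinner_scaleC_left)
  thus ?thesis using prod by blast
qed

lemma product_state:
  assumes "normal_state M chi1" "normal_state N chi2"
  shows "normal_state (vn_tensor t M N) (product_state t M N chi1 chi2)"
    and "a \<in> M \<Longrightarrow> b \<in> N \<Longrightarrow> product_state t M N chi1 chi2 (op_tensor t a b) = chi1 a * chi2 b"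
  using someI_ex[OF product_state_exists[OF assms]] unfolding product_state_def by auto

end

section \<open>Boundary values of bounded analytic functions on the strip\<close>

abbreviation strip :: "complex set"
  where "strip \<equiv> {z. - 1 \<le> Im z \<and> Im z \<le> 0}"

text \<open>The factor \<open>exp (- \<epsilon> w\<^sup>2)\<close> has modulus at most \<open>exp \<epsilon>\<close> on the strip and decays along it, so
  the maximum principle applies on a long rectangle whose short sides are harmless; then \<open>\<epsilon>\<close> tends
  to 0.\<close>

lemma three_lines:
  assumes cont: "continuous_on strip F" and bdd: "bounded (F ` strip)"
    and hol: "F holomorphic_on {z. - 1 < Im z \<and> Im z < 0}"
    and top: "\<And>s::real. cmod (F (of_real s)) \<le> B"
    and bot: "\<And>s::real. cmod (F (of_real s - \<i>)) \<le> B"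
    and z: "z \<in> strip"
  shows "cmod (F z) \<le> B"
proof (rule dense_ge)
  \<comment> \<open>A bound above \<open>B\<close> is positive even for \<open>B = 0\<close>, which is what the decay has to be compared with.\<close>
  fix B' assume B': "B < B'"
  obtain C where C: "C > 0" "\<And>w. w \<in> strip \<Longrightarrow> cmod (F w) \<le> C"
    using bdd unfolding bounded_pos by auto
  have B0: "B' > 0" using B' top[of 0] norm_ge_zero[of "F (of_real 0)"] by linarith
  have est: "cmod (F z) \<le> B' * exp (\<epsilon> * (1 + (Re z)\<^sup>2))" if e: "\<epsilon> > 0" for \<epsilon>
  proof -
    \<comment> \<open>Large enough for the rectangle to contain \<open>z\<close> and for the decay to beat the bound \<open>C\<close>.\<close>
    define T where "T = \<bar>Re z\<bar> + sqrt (C / (B' * \<epsilon>))"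
    have "0 \<le> sqrt (C / (B' * \<epsilon>))" using C B0 e by simp
    hence zT: "\<bar>Re z\<bar> \<le> T" unfolding T_def by linarith
    have "sqrt (C / (B' * \<epsilon>)) \<le> T" by (simp add: T_def)
    hence "(sqrt (C / (B' * \<epsilon>)))\<^sup>2 \<le> T\<^sup>2" using C B0 e by (intro power_mono) auto
    hence "C / (B' * \<epsilon>) \<le> T\<^sup>2" using C B0 e by simp
    hence "C / B' \<le> \<epsilon> * T\<^sup>2" using B0 e by (simp add: field_simps)
    also have "\<dots> \<le> exp (\<epsilon> * T\<^sup>2)" using exp_ge_add_one_self[of "\<epsilon> * T\<^sup>2"] by linarith
    finally have CT: "C \<le> B' * exp (\<epsilon> * T\<^sup>2)" using B0 by (simp add: field_simps)
    define G where "G w = F w * exp (- (of_real \<epsilon> * w\<^sup>2))" for w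
    have G: "cmod (G w) = cmod (F w) * exp (- (\<epsilon> * ((Re w)\<^sup>2 - (Im w)\<^sup>2)))" for w
      by (simp add: G_def norm_mult Re_power2)
    define Q where "Q = cbox (Complex (- T) (- 1)) (Complex T 0)"
    have Q: "Q \<subseteq> strip" "interior Q \<subseteq> {w. - 1 < Im w \<and> Im w < 0}"
      by (auto simp: Q_def in_cbox_complex_iff in_box_complex_iff interior_cbox)
    have "cmod (G z) \<le> B' * exp \<epsilon>"
    proof (rule maximum_modulus_frontier[of G Q])
      show "G holomorphic_on interior Q"
        unfolding G_def by (intro holomorphic_intros holomorphic_on_subset[OF hol] Q)
      show "continuous_on (closure Q) G"
        unfolding G_def using Q
        by (intro continuous_intros continuous_on_subset[OF cont]) (simp add: Q_def closure_cbox)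
      show "bounded Q" by (simp add: Q_def)
      show "z \<in> Q"
        using z zT by (auto simp: Q_def in_cbox_complex_iff)
    next
      fix w assume "w \<in> frontier Q"
      hence w: "w \<in> Q" "w \<notin> interior Q" by (auto simp: frontier_def Q_def closure_cbox)
      have im: "(Im w)\<^sup>2 \<le> 1"
        using w Q by (auto simp: abs_square_le_1)
      consider "Im w = 0" | "Im w = - 1" | "(Re w)\<^sup>2 = T\<^sup>2"
        using w by (auto simp: Q_def interior_cbox in_cbox_complex_iff in_box_complex_iff
            power2_eq_iff not_less)
      thus "cmod (G w) \<le> B' * exp \<epsilon>"
      proof cases
        assume "Im w = 0"
        hence "w = of_real (Re w)" by (simp add: complex_eq_iff)
        hence "cmod (F w) \<le> B'" using top[of "Re w"] B' by simp
        moreover have "- (\<epsilon> * ((Re w)\<^sup>2 - (Im w)\<^sup>2)) \<le> \<epsilon>"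
          using mult_left_mono[OF im, of \<epsilon>] e by (simp add: algebra_simps add_increasing2)
        ultimately show ?thesis unfolding G using B0 by (intro mult_mono) auto
      next
        assume "Im w = - 1"
        hence "w = of_real (Re w) - \<i>" by (simp add: complex_eq_iff)
        hence "cmod (F w) \<le> B'" using bot[of "Re w"] B' by simp
        moreover have "- (\<epsilon> * ((Re w)\<^sup>2 - (Im w)\<^sup>2)) \<le> \<epsilon>"
          using mult_left_mono[OF im, of \<epsilon>] e by (simp add: algebra_simps add_increasing2)
        ultimately show ?thesis unfolding G using B0 by (intro mult_mono) auto
      next
        assume T: "(Re w)\<^sup>2 = T\<^sup>2"
        have "cmod (F w) \<le> C" using C w Q by blast
        also note CT
        finally have "cmod (G w) \<le> (B' * exp (\<epsilon> * T\<^sup>2)) * exp (- (\<epsilon> * (T\<^sup>2 - (Im w)\<^sup>2)))"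
          unfolding G T by (rule mult_right_mono) simp
        also have "\<dots> = B' * exp (\<epsilon> * (Im w)\<^sup>2)"
          by (simp add: algebra_simps flip: exp_add)
        also have "\<dots> \<le> B' * exp \<epsilon>"
          using mult_left_mono[OF im, of \<epsilon>] e B0 by (intro mult_left_mono) auto
        finally show ?thesis .
      qed
    qed
    hence "cmod (F z) * exp (- (\<epsilon> * ((Re z)\<^sup>2 - (Im z)\<^sup>2))) \<le> B' * exp \<epsilon>" by (simp only: G)
    hence "(cmod (F z) * exp (- (\<epsilon> * ((Re z)\<^sup>2 - (Im z)\<^sup>2)))) * exp (\<epsilon> * ((Re z)\<^sup>2 - (Im z)\<^sup>2))
        \<le> (B' * exp \<epsilon>) * exp (\<epsilon> * ((Re z)\<^sup>2 - (Im z)\<^sup>2))"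
      by (rule mult_right_mono) simp
    hence "cmod (F z) \<le> B' * exp \<epsilon> * exp (\<epsilon> * ((Re z)\<^sup>2 - (Im z)\<^sup>2))"
      by (simp only: mult.assoc exp_add[symmetric]) simp
    also have "\<dots> = B' * exp (\<epsilon> + \<epsilon> * ((Re z)\<^sup>2 - (Im z)\<^sup>2))"
      by (simp add: exp_add)
    also have "\<dots> \<le> B' * exp (\<epsilon> * (1 + (Re z)\<^sup>2))"
      using B0 e by (intro mult_left_mono) (auto simp: algebra_simps)
    finally show ?thesis .
  qed
  have "(\<lambda>n. B' * exp (inverse (real (Suc n)) * (1 + (Re z)\<^sup>2))) \<longlonglongrightarrow> B' * exp (0 * (1 + (Re z)\<^sup>2))"
    by (intro tendsto_intros LIMSEQ_inverse_real_of_nat)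
  hence "(\<lambda>n. B' * exp (inverse (real (Suc n)) * (1 + (Re z)\<^sup>2))) \<longlonglongrightarrow> B'" by simp
  thus "cmod (F z) \<le> B'"
    by (rule LIMSEQ_le_const) (intro exI[of _ 0] allI impI est, simp)
qed

text \<open>The analytic part of the KMS condition at inverse temperature -1, detached from operators: \<open>u\<close> is
  attained on the upper and \<open>v\<close> on the lower boundary line.\<close>

definition strip_boundary_values :: "(real \<Rightarrow> complex) \<Rightarrow> (real \<Rightarrow> complex) \<Rightarrow> bool"
  where "strip_boundary_values u v \<longleftrightarrow> (\<exists>F. continuous_on strip F \<and> bounded (F ` strip) \<and>
    F holomorphic_on {z. - 1 < Im z \<and> Im z < 0} \<and>
    (\<forall>s::real. F (of_real s) = u s) \<and> (\<forall>s::real. F (of_real s - \<i>) = v s))"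

lemma bounded_image_binop:
  assumes "bounded (F ` A)" "bounded (G ` A)"
    and "\<And>z. norm (H z) \<le> norm (F z) + norm (G z) \<or> norm (H z) \<le> norm (F z) * norm (G z)"
  shows "bounded (H ` A)"
proof -
  obtain a b where ab: "\<And>z. z \<in> A \<Longrightarrow> norm (F z) \<le> a" "\<And>z. z \<in> A \<Longrightarrow> norm (G z) \<le> b"
    using assms(1,2) unfolding bounded_iff by auto
  have "norm (H z) \<le> max (a + b) (a * b)" if z: "z \<in> A" for z
  proof -
    have "norm (F z) + norm (G z) \<le> a + b" using ab z by (intro add_mono) auto
    moreover have "norm (F z) * norm (G z) \<le> a * b"
      using ab z order_trans[OF norm_ge_zero ab(1)[OF z]] by (intro mult_mono) auto
    ultimately show ?thesis using assms(3)[of z] by linarith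
  qed
  thus ?thesis unfolding bounded_iff by auto
qed

lemma strip_boundary_values_mult:
  assumes "strip_boundary_values u v" "strip_boundary_values u' v'"
  shows "strip_boundary_values (\<lambda>s. u s * u' s) (\<lambda>s. v s * v' s)"
proof -
  obtain F where F: "continuous_on strip F" "bounded (F ` strip)"
    "F holomorphic_on {z. - 1 < Im z \<and> Im z < 0}"
    "\<And>s::real. F (of_real s) = u s" "\<And>s::real. F (of_real s - \<i>) = v s"
    using assms(1) unfolding strip_boundary_values_def by auto
  obtain G where G: "continuous_on strip G" "bounded (G ` strip)"
    "G holomorphic_on {z. - 1 < Im z \<and> Im z < 0}"
    "\<And>s::real. G (of_real s) = u' s" "\<And>s::real. G (of_real s - \<i>) = v' s"
    using assms(2) unfolding strip_boundary_values_def by auto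
  show ?thesis unfolding strip_boundary_values_def
    using F G by (intro exI[of _ "\<lambda>z. F z * G z"])
      (auto intro!: continuous_intros holomorphic_intros bounded_image_binop[OF F(2) G(2)]
        simp: norm_mult)
qed

lemma strip_boundary_values_add:
  assumes "strip_boundary_values u v" "strip_boundary_values u' v'"
  shows "strip_boundary_values (\<lambda>s. u s + u' s) (\<lambda>s. v s + v' s)"
proof -
  obtain F where F: "continuous_on strip F" "bounded (F ` strip)"
    "F holomorphic_on {z. - 1 < Im z \<and> Im z < 0}"
    "\<And>s::real. F (of_real s) = u s" "\<And>s::real. F (of_real s - \<i>) = v s"
    using assms(1) unfolding strip_boundary_values_def by auto
  obtain G where G: "continuous_on strip G" "bounded (G ` strip)"
    "G holomorphic_on {z. - 1 < Im z \<and> Im z < 0}"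
    "\<And>s::real. G (of_real s) = u' s" "\<And>s::real. G (of_real s - \<i>) = v' s"
    using assms(2) unfolding strip_boundary_values_def by auto
  show ?thesis unfolding strip_boundary_values_def
    using F G by (intro exI[of _ "\<lambda>z. F z + G z"])
      (auto intro!: continuous_intros holomorphic_intros bounded_image_binop[OF F(2) G(2)]
        norm_triangle_ineq)
qed

lemma strip_boundary_values_const: "strip_boundary_values (\<lambda>s. c) (\<lambda>s. c)"
  unfolding strip_boundary_values_def
  by (intro exI[of _ "\<lambda>z. c"]) (auto intro: bounded_subset[of "{c}"])

lemma strip_boundary_values_cmult:
  "strip_boundary_values u v \<Longrightarrow> strip_boundary_values (\<lambda>s. c * u s) (\<lambda>s. c * v s)"
  by (rule strip_boundary_values_mult[OF strip_boundary_values_const])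

text \<open>By the three lines theorem uniform convergence on the boundary propagates to the strip.\<close>

lemma strip_boundary_values_limit:
  assumes "\<And>e. e > 0 \<Longrightarrow> \<exists>u' v'. strip_boundary_values u' v' \<and>
    (\<forall>s. cmod (u s - u' s) \<le> e \<and> cmod (v s - v' s) \<le> e)"
  shows "strip_boundary_values u v"
proof -
  define h where "h n = inverse (real (Suc n))" for n
  have h0: "h n > 0" for n by (simp add: h_def)
  define near where "near n F \<longleftrightarrow> continuous_on strip F \<and> bounded (F ` strip) \<and>
      F holomorphic_on {z. - 1 < Im z \<and> Im z < 0} \<and>
      (\<forall>s::real. cmod (u s - F (of_real s)) \<le> h n) \<and>
      (\<forall>s::real. cmod (v s - F (of_real s - \<i>)) \<le> h n)" for n F
  have "\<exists>F. near n F" for n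
  proof -
    obtain u' v' where uv: "strip_boundary_values u' v'"
      and uv_near: "\<And>s. cmod (u s - u' s) \<le> h n" "\<And>s. cmod (v s - v' s) \<le> h n"
      using assms[OF h0[of n]] by blast
    obtain F where F: "continuous_on strip F" "bounded (F ` strip)"
      "F holomorphic_on {z. - 1 < Im z \<and> Im z < 0}"
      "\<And>s::real. F (of_real s) = u' s" "\<And>s::real. F (of_real s - \<i>) = v' s"
      using uv unfolding strip_boundary_values_def by auto
    show ?thesis using F uv_near by (intro exI[of _ F]) (simp add: near_def)
  qed
  then obtain F where F: "\<And>n. near n (F n)" by metis
  have cont: "continuous_on strip (F n)" and bdd: "bounded (F n ` strip)"
    and hol: "F n holomorphic_on {z. - 1 < Im z \<and> Im z < 0}"
    and u: "cmod (u s - F n (of_real s)) \<le> h n"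
    and v: "cmod (v s - F n (of_real s - \<i>)) \<le> h n" for n and s :: real
    using F[of n] unfolding near_def by blast+
  have diff: "cmod (F m z - F n z) \<le> h m + h n" if z: "z \<in> strip" for m n z
  proof (rule three_lines[where F = "\<lambda>z. F m z - F n z"])
    show "continuous_on strip (\<lambda>z. F m z - F n z)" by (intro continuous_intros cont)
    show "bounded ((\<lambda>z. F m z - F n z) ` strip)"
      by (rule bounded_image_binop[OF bdd[of m] bdd[of n]]) (auto intro: norm_triangle_ineq4)
    show "(\<lambda>z. F m z - F n z) holomorphic_on {z. - 1 < Im z \<and> Im z < 0}"
      by (intro holomorphic_intros hol)
    show "cmod (F m (of_real s) - F n (of_real s)) \<le> h m + h n" for s
      using norm_triangle_ineq4[of "u s - F n (of_real s)" "u s - F m (of_real s)"]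
        u[of s m] u[of s n] by simp
    show "cmod (F m (of_real s - \<i>) - F n (of_real s - \<i>)) \<le> h m + h n" for s
      using norm_triangle_ineq4[of "v s - F n (of_real s - \<i>)" "v s - F m (of_real s - \<i>)"]
        v[of s m] v[of s n] by simp
  qed (rule z)
  have hlim: "h \<longlonglongrightarrow> 0" unfolding h_def by (rule LIMSEQ_inverse_real_of_nat)
  have "uniformly_Cauchy_on strip F"
  proof (rule uniformly_Cauchy_onI)
    fix e :: real assume "e > 0"
    then obtain N where N: "\<And>n. n \<ge> N \<Longrightarrow> h n < e/2"
      using order_tendstoD(2)[OF hlim, of "e/2"] by (auto simp: eventually_sequentially)
    show "\<exists>M. \<forall>z\<in>strip. \<forall>m\<ge>M. \<forall>n\<ge>M. dist (F m z) (F n z) < e"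
    proof (intro exI[of _ N] ballI allI impI)
      fix z m n assume "z \<in> strip" "m \<ge> N" "n \<ge> N"
      thus "dist (F m z) (F n z) < e"
        using diff[of z m n] N[of m] N[of n] by (simp add: dist_norm)
    qed
  qed
  then obtain L where L: "uniform_limit strip F L sequentially"
    using Cauchy_uniformly_convergent unfolding uniformly_convergent_on_def by blast
  have Lpt: "(\<lambda>n. F n z) \<longlonglongrightarrow> L z" if "z \<in> strip" for z
    by (rule tendsto_uniform_limitI[OF L that])
  have "continuous_on strip L"
    by (rule uniform_limit_theorem[OF _ L]) (auto intro: always_eventually cont)
  moreover have "bounded (L ` strip)"
  proof -
    obtain N where N: "\<And>z. z \<in> strip \<Longrightarrow> dist (F N z) (L z) < 1"
      using uniform_limitD[OF L, of 1] by (auto simp: eventually_sequentially)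
    obtain K where K: "\<And>z. z \<in> strip \<Longrightarrow> cmod (F N z) \<le> K"
      using bdd[of N] unfolding bounded_iff by auto
    have "cmod (L z) \<le> K + 1" if "z \<in> strip" for z
      using N[OF that] K[OF that] norm_triangle_ineq2[of "L z" "F N z"]
      by (simp add: dist_norm norm_minus_commute)
    thus ?thesis unfolding bounded_iff by blast
  qed
  moreover have "L holomorphic_on {z. - 1 < Im z \<and> Im z < 0}"
  proof (rule holomorphic_uniform_sequence[OF _ hol])
    show op: "open {z. - 1 < Im z \<and> Im z < 0}"
      by (intro open_Collect_conj open_halfspace_Im_gt open_halfspace_Im_lt)
    fix z assume "z \<in> {z. - 1 < Im z \<and> Im z < 0}"
    then obtain d where d: "d > 0" "cball z d \<subseteq> {z. - 1 < Im z \<and> Im z < 0}"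
      using op open_contains_cball by blast
    moreover have "uniform_limit (cball z d) F L sequentially"
      by (rule uniform_limit_on_subset[OF L]) (use d(2) in \<open>auto simp: subset_iff less_imp_le\<close>)
    ultimately show "\<exists>d>0. cball z d \<subseteq> {z. - 1 < Im z \<and> Im z < 0} \<and>
        uniform_limit (cball z d) F L sequentially" by blast
  qed
  moreover have "L (of_real s) = u s" for s :: real
  proof (rule LIMSEQ_unique[OF Lpt])
    show "(\<lambda>n. F n (of_real s)) \<longlonglongrightarrow> u s"
      by (rule LIM_zero_cancel, rule Lim_null_comparison[OF _ hlim])
         (use u in \<open>auto intro!: always_eventually simp: norm_minus_commute\<close>)
  qed auto
  moreover have "L (of_real s - \<i>) = v s" for s :: real
  proof (rule LIMSEQ_unique[OF Lpt])
    show "(\<lambda>n. F n (of_real s - \<i>)) \<longlonglongrightarrow> v s"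
      by (rule LIM_zero_cancel, rule Lim_null_comparison[OF _ hlim])
         (use v in \<open>auto intro!: always_eventually simp: norm_minus_commute\<close>)
  qed auto
  ultimately show ?thesis unfolding strip_boundary_values_def by blast
qed

text \<open>Equal boundary values let the function continue periodically across all lines with integral
  imaginary part; the result is bounded and entire.\<close>

lemma strip_boundary_values_equal_const:
  assumes "strip_boundary_values u u"
  shows "u s = u 0"
proof -
  obtain F where F: "continuous_on strip F" "bounded (F ` strip)"
    "F holomorphic_on {z. - 1 < Im z \<and> Im z < 0}"
    "\<And>s::real. F (of_real s) = u s" "\<And>s::real. F (of_real s - \<i>) = u s"
    using assms unfolding strip_boundary_values_def by auto
  define G where "G z = F (z - of_int \<lceil>Im z\<rceil> * \<i>)" for z
  \<comment> \<open>The periodic continuation is given by the same formula on the whole closed strip below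
    each line; on the lower line this is where equality of the boundary values enters.\<close>
  have Gn: "G z = F (z - of_int n * \<i>)" if z: "of_int n - 1 \<le> Im z" "Im z \<le> of_int n" for z n
  proof (cases "Im z = of_int n - 1")
    case False
    hence "\<lceil>Im z\<rceil> = n" using z by (intro ceiling_unique) auto
    thus ?thesis by (simp add: G_def)
  next
    case True
    hence c: "\<lceil>Im z\<rceil> = n - 1" by (metis ceiling_of_int of_int_1 of_int_diff)
    have "G z = F (of_real (Re z))"
      unfolding G_def c by (rule arg_cong[of _ _ F]) (simp add: complex_eq_iff True)
    moreover have "F (z - of_int n * \<i>) = F (of_real (Re z) - \<i>)"
      by (rule arg_cong[of _ _ F]) (simp add: complex_eq_iff True)
    ultimately show ?thesis using F(4,5) by simp
  qed
  have cont: "continuous_on {z. of_int n - 1 \<le> Im z \<and> Im z \<le> of_int n} G" for n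
  proof -
    have "continuous_on {z. of_int n - 1 \<le> Im z \<and> Im z \<le> of_int n} (\<lambda>z. F (z - of_int n * \<i>))"
      by (rule continuous_on_compose2[OF F(1)]) (auto intro!: continuous_intros)
    thus ?thesis by (rule continuous_on_eq) (auto simp: Gn)
  qed
  have hol: "G holomorphic_on {z. of_int n - 1 < Im z \<and> Im z < of_int n}" for n
  proof -
    have "(F \<circ> (\<lambda>z. z - of_int n * \<i>)) holomorphic_on {z. of_int n - 1 < Im z \<and> Im z < of_int n}"
      by (rule holomorphic_on_compose_gen[OF _ F(3)]) (auto intro!: holomorphic_intros)
    thus ?thesis by (rule holomorphic_transform) (auto intro!: Gn[symmetric])
  qed
  have holS: "G holomorphic_on {z. of_int n - 1 < Im z \<and> Im z < of_int n + 1}" for n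
  proof (rule holomorphic_on_paste_across_line[of _ \<i> _ "of_int n"])
    show "open {z. of_int n - 1 < Im z \<and> Im z < of_int n + 1}"
      by (intro open_Collect_conj open_halfspace_Im_gt open_halfspace_Im_lt)
    show "G holomorphic_on {z. of_int n - 1 < Im z \<and> Im z < of_int n + 1} \<inter> {z. \<i> \<bullet> z < of_int n}"
      by (rule holomorphic_on_subset[OF hol[of n]]) (auto simp: inner_complex_def)
    show "G holomorphic_on {z. of_int n - 1 < Im z \<and> Im z < of_int n + 1} \<inter> {z. of_int n < \<i> \<bullet> z}"
      by (rule holomorphic_on_subset[OF hol[of "n + 1"]]) (auto simp: inner_complex_def)
    have "continuous_on ({z. of_int n - 1 \<le> Im z \<and> Im z \<le> of_int n} \<union>
        {z. of_int (n + 1) - 1 \<le> Im z \<and> Im z \<le> of_int (n + 1)}) G"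
      by (intro continuous_on_closed_Un cont closed_Collect_conj closed_halfspace_Im_ge
          closed_halfspace_Im_le)
    thus "continuous_on {z. of_int n - 1 < Im z \<and> Im z < of_int n + 1} G"
      by (rule continuous_on_subset) auto
  qed auto
  have "G holomorphic_on UNIV"
    unfolding holomorphic_on_def
  proof
    fix z :: complex
    have "open {w. of_int \<lceil>Im z\<rceil> - 1 < Im w \<and> Im w < of_int \<lceil>Im z\<rceil> + 1}"
      by (intro open_Collect_conj open_halfspace_Im_gt open_halfspace_Im_lt)
    moreover have "z \<in> {w. of_int \<lceil>Im z\<rceil> - 1 < Im w \<and> Im w < of_int \<lceil>Im z\<rceil> + 1}"
      using ceiling_correct[of "Im z"] by (intro CollectI conjI; linarith)
    ultimately show "G field_differentiable at z within UNIV"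
      using holomorphic_on_imp_differentiable_at[OF holS[of "\<lceil>Im z\<rceil>"]] by blast
  qed
  moreover have "bounded (range G)"
  proof (rule bounded_subset[OF F(2)])
    show "range G \<subseteq> F ` strip"
    proof
      fix w assume "w \<in> range G"
      then obtain z where w: "w = F (z - of_int \<lceil>Im z\<rceil> * \<i>)" by (auto simp: G_def)
      have "z - of_int \<lceil>Im z\<rceil> * \<i> \<in> strip"
        using ceiling_correct[of "Im z"] by auto
      thus "w \<in> F ` strip" using w by blast
    qed
  qed
  ultimately have "G constant_on UNIV" by (rule Liouville_theorem)
  hence "G (of_real s) = G (of_real 0)" unfolding constant_on_def by auto
  thus ?thesis using F(4)[of s] F(4)[of 0] by (simp add: G_def)
qed

section \<open>KMS states and their products\<close>

lemma normal_map_in: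
  assumes "normal_map M N f" "von_neumann_algebra M" "a \<in> M"
  shows "f a \<in> N"
proof -
  have "a \<in> topspace (subtopology sigma_weak M)"
    using assms vn_bops topspace_sigma_weak_superset by fastforce
  hence "f a \<in> topspace (subtopology sigma_weak N)"
    using assms(1) continuous_map_image_subset_topspace unfolding normal_map_def by blast
  thus ?thesis by simp
qed

text \<open>The composite is continuous and linear, hence a matrix coefficient on the source algebra, although
  the map itself is given by no formula on vectors.\<close>

lemma normal_functional_normal_map:
  assumes f: "normal_map M N f" "linear_map_on M f"
    and M: "von_neumann_algebra M" and N: "von_neumann_algebra N"
    and g: "normal_functional N g"
  shows "normal_functional M (\<lambda>a. g (f a))"
proof (rule normal_functional_if_continuous)
  show "M \<subseteq> bops" "0 \<in> M" using vn_bops[OF M] vn_zero[OF M] by auto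
  show "\<And>a b. a \<in> M \<Longrightarrow> b \<in> M \<Longrightarrow> a + b \<in> M" by (rule vn_add[OF M])
  show "\<And>c a. a \<in> M \<Longrightarrow> op_scaleC c a \<in> M" by (rule vn_scaleC[OF M])
  obtain x y where xy: "\<And>a. a \<in> N \<Longrightarrow> g a = cinner (amp a x) y"
    using g by (auto simp: normal_functional_def)
  show "complex_linear_on M (\<lambda>a. g (f a))"
    using f(2) unfolding linear_map_on_def complex_linear_on_def
    by (simp add: xy normal_map_in[OF f(1) M] vn_add[OF N] vn_scaleC[OF N] amp_add amp_scaleC
        cinner_add_left cinner_scaleC_left)
  show "continuous_map (subtopology sigma_weak M) euclidean (\<lambda>a. g (f a))"
    using continuous_map_compose[OF f(1)[unfolded normal_map_def]
        continuous_normal_functional[OF vn_bops[OF N] g]]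
    by (simp add: o_def)
qed

definition kms_pair ::
  "(('a::chilbert_space \<Rightarrow>\<^sub>L 'a) \<Rightarrow> complex) \<Rightarrow> (real \<Rightarrow> ('a \<Rightarrow>\<^sub>L 'a) \<Rightarrow> ('a \<Rightarrow>\<^sub>L 'a)) \<Rightarrow>
    ('a \<Rightarrow>\<^sub>L 'a) \<Rightarrow> ('a \<Rightarrow>\<^sub>L 'a) \<Rightarrow> bool"
  where "kms_pair chi \<tau> x y \<longleftrightarrow>
    strip_boundary_values (\<lambda>s. chi (x o\<^sub>L \<tau> s y)) (\<lambda>s. chi (\<tau> s y o\<^sub>L x))"

lemma quantized_character_iff:
  "quantized_character M \<tau> chi \<longleftrightarrow> normal_state M chi \<and> (\<forall>x\<in>M. \<forall>y\<in>M. kms_pair chi \<tau> x y)"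
  unfolding quantized_character_def kms_pair_def strip_boundary_values_def by simp

text \<open>Taken with \<open>x = 1\<close>, the two boundary values of the KMS function coincide.\<close>

lemma kms_invariant:
  assumes "von_neumann_algebra M" "quantized_character M \<tau> chi" "y \<in> M"
  shows "chi (\<tau> s y) = chi (\<tau> 0 y)"
proof -
  have "kms_pair chi \<tau> id_blinfun y"
    using assms vn_id by (auto simp: quantized_character_iff)
  moreover have "id_blinfun o\<^sub>L a = a" "a o\<^sub>L id_blinfun = a" for a :: "'a \<Rightarrow>\<^sub>L 'a"
    by (auto intro: blinfun_eqI)
  ultimately have "strip_boundary_values (\<lambda>s. chi (\<tau> s y)) (\<lambda>s. chi (\<tau> s y))"
    by (simp add: kms_pair_def)
  thus ?thesis by (rule strip_boundary_values_equal_const)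
qed

locale kms_product = vn_tensor_product t M N
  for t :: "'a::chilbert_space \<Rightarrow> 'b::chilbert_space \<Rightarrow> 'k::chilbert_space"
    and M :: "('a \<Rightarrow>\<^sub>L 'a) set" and N :: "('b \<Rightarrow>\<^sub>L 'b) set" +
  fixes \<tau>1 :: "real \<Rightarrow> ('a \<Rightarrow>\<^sub>L 'a) \<Rightarrow> ('a \<Rightarrow>\<^sub>L 'a)" and \<tau>2 :: "real \<Rightarrow> ('b \<Rightarrow>\<^sub>L 'b) \<Rightarrow> ('b \<Rightarrow>\<^sub>L 'b)"
    and chi1 chi2 \<tau> \<psi>
  assumes hom1: "star_hom M M (\<tau>1 s)" and hom2: "star_hom N N (\<tau>2 s)"
    and zero1: "a \<in> M \<Longrightarrow> \<tau>1 0 a = a" and zero2: "b \<in> N \<Longrightarrow> \<tau>2 0 b = b"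
    and kms1: "quantized_character M \<tau>1 chi1" and kms2: "quantized_character N \<tau>2 chi2"
    and tensor_map: "is_tensor_map t t M N M N (\<tau>1 s) (\<tau>2 s) (\<tau> s)"
    and state: "normal_state (vn_tensor t M N) \<psi>"
    and product: "a \<in> M \<Longrightarrow> b \<in> N \<Longrightarrow> \<psi> (op_tensor t a b) = chi1 a * chi2 b"
begin

abbreviation "MN \<equiv> vn_tensor t M N"

sublocale vn_state MN \<psi>
  by standard (rule vn_vn_tensor, rule state)

lemma \<tau>_normal: "normal_map MN MN (\<tau> s)" and \<tau>_linear: "linear_map_on MN (\<tau> s)"
  and \<tau>_tensor: "a \<in> M \<Longrightarrow> b \<in> N \<Longrightarrow> \<tau> s (op_tensor t a b) = op_tensor t (\<tau>1 s a) (\<tau>2 s b)"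
  using tensor_map[of s] unfolding is_tensor_map_def by auto

lemma \<tau>_in: "X \<in> MN \<Longrightarrow> \<tau> s X \<in> MN"
  by (rule normal_map_in[OF \<tau>_normal vn])

lemma \<tau>_add: "X \<in> MN \<Longrightarrow> Y \<in> MN \<Longrightarrow> \<tau> s (X + Y) = \<tau> s X + \<tau> s Y"
  and \<tau>_scaleC: "X \<in> MN \<Longrightarrow> \<tau> s (op_scaleC c X) = op_scaleC c (\<tau> s X)"
  using \<tau>_linear[of s] unfolding linear_map_on_def by auto

lemma \<tau>_scaleR: "X \<in> MN \<Longrightarrow> \<tau> s (r *\<^sub>R X) = r *\<^sub>R \<tau> s X"
  by (metis \<tau>_scaleC op_scaleC_of_real)

lemma \<tau>_diff: "X \<in> MN \<Longrightarrow> Y \<in> MN \<Longrightarrow> \<tau> s (X - Y) = \<tau> s X - \<tau> s Y"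
  using \<tau>_add[of "X - Y" Y s] vn_diff[OF vn] by simp

lemma \<tau>_zero: "\<tau> s 0 = 0"
  using \<tau>_diff[of 0 0 s] vn_zero[OF vn] by simp

lemma normal_functional_\<tau>: "normal_functional MN g \<Longrightarrow> normal_functional MN (\<lambda>X. g (\<tau> s X))"
  by (rule normal_functional_normal_map[OF \<tau>_normal \<tau>_linear vn vn])

lemma factor_in:
  "a \<in> M \<Longrightarrow> \<tau>1 s a \<in> M" "b \<in> N \<Longrightarrow> \<tau>2 s b \<in> N"
  using hom1[of s] hom2[of s] unfolding star_hom_def by auto

lemma factor_adj:
  "a \<in> M \<Longrightarrow> op_adj (\<tau>1 s a) = \<tau>1 s (op_adj a)" "b \<in> N \<Longrightarrow> op_adj (\<tau>2 s b) = \<tau>2 s (op_adj b)"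
  using hom1[of s] hom2[of s] unfolding star_hom_def by auto

lemma factor_comp:
  "a \<in> M \<Longrightarrow> a' \<in> M \<Longrightarrow> \<tau>1 s a o\<^sub>L \<tau>1 s a' = \<tau>1 s (a o\<^sub>L a')"
  "b \<in> N \<Longrightarrow> b' \<in> N \<Longrightarrow> \<tau>2 s b o\<^sub>L \<tau>2 s b' = \<tau>2 s (b o\<^sub>L b')"
  using hom1[of s] hom2[of s] unfolding star_hom_def by auto

lemma factor_invariant:
  "a \<in> M \<Longrightarrow> chi1 (\<tau>1 s a) = chi1 a" "b \<in> N \<Longrightarrow> chi2 (\<tau>2 s b) = chi2 b"
  using kms_invariant[OF vn_M kms1, of a s] kms_invariant[OF vn_N kms2, of b s] zero1 zero2
  by auto

lemmas factor_bops = bops_M bops_N bops_M[OF factor_in(1)] bops_N[OF factor_in(2)]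

text \<open>A tensor map is specified by linearity, normality and its values on simple tensors. Compatibility
  with adjoints is inherited from the factors on simple tensors and extended by comparing normal
  functionals.\<close>

lemma \<tau>_adj:
  assumes X: "X \<in> MN"
  shows "op_adj (\<tau> s X) = \<tau> s (op_adj X)"
proof (rule blinfun_eqI, rule cinner_eqI)
  fix u v
  define g where "g = (\<lambda>X::'k \<Rightarrow>\<^sub>L 'k. cinner (amp X (single 0 u)) (single 0 v))"
  have g: "normal_functional MN g" unfolding g_def by (rule normal_functional_coefficient)
  have gX: "g Y = cinner (Y u) v" for Y
  proof -
    have "g Y = (\<Sum>n\<in>{0}. cinner (coord (single 0 (Y u)) n) (coord (single 0 v) n))"
      unfolding g_def amp_single cinner_ell2_def
      by (rule suminf_finite) (auto simp: coord_single cinner.zero_left)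
    thus ?thesis by (simp add: coord_single)
  qed
  note adjMN = vn_adj[OF vn] and bopsMN = vn_bops[OF vn]
  have "cnj (g (op_adj (\<tau> s X))) = cnj (g (\<tau> s (op_adj X)))"
  proof (rule normal_functional_vn_tensor_eqI[OF _ _ _ X])
    show "normal_functional MN (\<lambda>X. cnj (g (op_adj (\<tau> s X))))"
      by (rule normal_functional_\<tau>[OF normal_functional_adj[OF g adjMN bopsMN]])
    show "normal_functional MN (\<lambda>X. cnj (g (\<tau> s (op_adj X))))"
      by (rule normal_functional_adj[OF normal_functional_\<tau>[OF g] adjMN bopsMN])
    show "cnj (g (op_adj (\<tau> s (op_tensor t a b)))) = cnj (g (\<tau> s (op_adj (op_tensor t a b))))"
      if "a \<in> M" "b \<in> N" for a b
      using that by (simp add: \<tau>_tensor op_tensor_adj factor_bops factor_adj vn_adj[OF vn_M]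
          vn_adj[OF vn_N])
  qed
  thus "cinner (op_adj (\<tau> s X) u) v = cinner (\<tau> s (op_adj X) u) v"
    unfolding gX by simp
qed

text \<open>On simple tensors this is the invariance of the two factors. It extends in one argument at a time,
  since each side is a normal functional of its right argument and, by hermitian symmetry, the
  conjugate of one of its left argument.\<close>

lemma invariant_sesquilinear:
  assumes Z: "Z \<in> MN" and W: "W \<in> MN"
  shows "\<psi> (op_adj (\<tau> s Z) o\<^sub>L \<tau> s W) = \<psi> (op_adj Z o\<^sub>L W)"
proof -
  have left: "normal_functional MN (\<lambda>X. \<psi> (op_adj B o\<^sub>L X))" if "B \<in> MN" for B
    using that by (intro normal_functional_left_mult normal vn_comp[OF vn] vn_adj[OF vn] bops)
  have ext: "\<psi> (op_adj (\<tau> s B) o\<^sub>L \<tau> s X) = \<psi> (op_adj B o\<^sub>L X)"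
    if simple: "\<And>a b. a \<in> M \<Longrightarrow> b \<in> N \<Longrightarrow>
        \<psi> (op_adj (\<tau> s B) o\<^sub>L \<tau> s (op_tensor t a b)) = \<psi> (op_adj B o\<^sub>L op_tensor t a b)"
      and B: "B \<in> MN" and X: "X \<in> MN" for B X
    by (rule normal_functional_vn_tensor_eqI[OF normal_functional_\<tau>[OF left[OF \<tau>_in[OF B]]]
          left[OF B] simple X])
  have swap: "\<psi> (op_adj B o\<^sub>L X) = cnj (\<psi> (op_adj X o\<^sub>L B))" if "B \<in> MN" "X \<in> MN" for B X
  proof -
    have "op_adj (op_adj X o\<^sub>L B) = op_adj B o\<^sub>L X"
      using that by (simp add: op_adj_comp op_adj_adj bops bops_adj)
    thus ?thesis using adj[of "op_adj X o\<^sub>L B"] that by (simp add: vn_comp[OF vn] vn_adj[OF vn])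
  qed
  have simple: "\<psi> (op_adj (\<tau> s (op_tensor t a b)) o\<^sub>L \<tau> s (op_tensor t c d)) =
      \<psi> (op_adj (op_tensor t a b) o\<^sub>L op_tensor t c d)"
    if "a \<in> M" "b \<in> N" "c \<in> M" "d \<in> N" for a b c d
  proof -
    have in1: "op_adj a o\<^sub>L c \<in> M" "op_adj b o\<^sub>L d \<in> N"
      using that by (auto intro: vn_comp[OF vn_M] vn_comp[OF vn_N] vn_adj[OF vn_M] vn_adj[OF vn_N])
    have "op_adj (\<tau> s (op_tensor t a b)) o\<^sub>L \<tau> s (op_tensor t c d) =
        op_tensor t (\<tau>1 s (op_adj a o\<^sub>L c)) (\<tau>2 s (op_adj b o\<^sub>L d))"
      using that by (simp add: \<tau>_tensor op_tensor_adj op_tensor_comp factor_bops factor_adj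
          factor_comp vn_adj[OF vn_M] vn_adj[OF vn_N])
    moreover have "op_adj (op_tensor t a b) o\<^sub>L op_tensor t c d =
        op_tensor t (op_adj a o\<^sub>L c) (op_adj b o\<^sub>L d)"
      using that by (simp add: op_tensor_adj op_tensor_comp factor_bops bops_adj)
    ultimately show ?thesis
      using in1 by (simp add: product factor_in factor_invariant)
  qed
  have half: "\<psi> (op_adj (\<tau> s (op_tensor t a b)) o\<^sub>L \<tau> s X) = \<psi> (op_adj (op_tensor t a b) o\<^sub>L X)"
    if "a \<in> M" "b \<in> N" "X \<in> MN" for a b X
    by (rule ext) (use that simple op_tensor_in in auto)
  show ?thesis
  proof (rule ext[OF _ Z W])
    fix a b assume ab: "a \<in> M" "b \<in> N"
    show "\<psi> (op_adj (\<tau> s Z) o\<^sub>L \<tau> s (op_tensor t a b)) = \<psi> (op_adj Z o\<^sub>L op_tensor t a b)"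
      using half[OF ab Z] swap[OF \<tau>_in[OF Z] \<tau>_in[OF op_tensor_in[OF ab]]]
        swap[OF Z op_tensor_in[OF ab]] by simp
  qed
qed

text \<open>Invariance removes the time parameter from the right-hand sides of the Cauchy-Schwarz inequality.\<close>

lemma estimates:
  assumes A: "A \<in> MN" and B: "B \<in> MN"
  shows "(cmod (\<psi> (A o\<^sub>L \<tau> s B)))\<^sup>2 \<le> Re (\<psi> (A o\<^sub>L op_adj A)) * Re (\<psi> (op_adj B o\<^sub>L B))"
    and "(cmod (\<psi> (\<tau> s B o\<^sub>L A)))\<^sup>2 \<le> Re (\<psi> (op_adj A o\<^sub>L A)) * Re (\<psi> (B o\<^sub>L op_adj B))"
proof -
  note adj_in = vn_adj[OF vn]
  have "(cmod (\<psi> (op_adj (op_adj A) o\<^sub>L \<tau> s B)))\<^sup>2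
      \<le> Re (\<psi> (op_adj (\<tau> s B) o\<^sub>L \<tau> s B)) * Re (\<psi> (op_adj (op_adj A) o\<^sub>L op_adj A))"
    by (rule Cauchy_Schwarz[OF \<tau>_in[OF B] adj_in[OF A]])
  thus "(cmod (\<psi> (A o\<^sub>L \<tau> s B)))\<^sup>2 \<le> Re (\<psi> (A o\<^sub>L op_adj A)) * Re (\<psi> (op_adj B o\<^sub>L B))"
    by (simp add: invariant_sesquilinear[OF B B] op_adj_adj bops[OF A] mult.commute)
  have "(cmod (\<psi> (op_adj (op_adj (\<tau> s B)) o\<^sub>L A)))\<^sup>2
      \<le> Re (\<psi> (op_adj A o\<^sub>L A)) * Re (\<psi> (op_adj (op_adj (\<tau> s B)) o\<^sub>L op_adj (\<tau> s B)))"
    by (rule Cauchy_Schwarz[OF A adj_in[OF \<tau>_in[OF B]]])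
  also have "\<psi> (op_adj (op_adj (\<tau> s B)) o\<^sub>L op_adj (\<tau> s B)) = \<psi> (B o\<^sub>L op_adj B)"
    using invariant_sesquilinear[OF adj_in[OF B] adj_in[OF B], of s]
    by (simp add: \<tau>_adj[OF B] op_adj_adj bops[OF B])
  finally show "(cmod (\<psi> (\<tau> s B o\<^sub>L A)))\<^sup>2 \<le> Re (\<psi> (op_adj A o\<^sub>L A)) * Re (\<psi> (B o\<^sub>L op_adj B))"
    by (simp add: op_adj_adj bops[OF \<tau>_in[OF B]])
qed

abbreviation "ST \<equiv> span (simple_tensors t M N)"

lemma span_in: "Z \<in> ST \<Longrightarrow> Z \<in> MN"
  using simple.span_subset_bicommutant unfolding vn_tensor_eq by blast

text \<open>The state is a matrix coefficient of two vectors, so its values at \<open>D\<^sup>* D\<close> and \<open>D D\<^sup>*\<close> are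
  controlled by \<open>D\<close> and \<open>D\<^sup>*\<close> at both vectors.\<close>

lemma approximation:
  assumes X: "X \<in> MN" and e: "e > 0"
  obtains Z where "Z \<in> ST" "Re (\<psi> (op_adj (X - Z) o\<^sub>L (X - Z))) < e"
    "Re (\<psi> ((X - Z) o\<^sub>L op_adj (X - Z))) < e"
proof -
  obtain x y where xy: "\<And>a. a \<in> MN \<Longrightarrow> \<psi> a = cinner (amp a x) y"
    using normal by (auto simp: normal_functional_def)
  have e': "sqrt e > 0" using e by simp
  obtain Z where Z: "Z \<in> ST"
    and n: "norm (amp (X - Z) x) < sqrt e" "norm (amp (X - Z) y) < sqrt e"
      "norm (amp (op_adj (X - Z)) x) < sqrt e" "norm (amp (op_adj (X - Z)) y) < sqrt e"
    by (rule simple.strong_star_density[OF X[unfolded vn_tensor_eq] e'])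
  define D where "D = X - Z"
  have D: "D \<in> MN" "op_adj D \<in> MN"
    unfolding D_def using X span_in[OF Z] by (auto intro: vn_diff[OF vn] vn_adj[OF vn])
  have bound: "Re (cinner u v) < e" if "norm u < sqrt e" "norm v < sqrt e" for u v :: "'k ell2"
  proof -
    have "Re (cinner u v) \<le> norm u * norm v"
      using complex_Re_le_cmod Cauchy_Schwarz_cinner order_trans by blast
    also have "\<dots> < sqrt e * sqrt e" using that by (intro mult_strict_mono') auto
    finally show ?thesis using e by simp
  qed
  have "\<psi> (op_adj D o\<^sub>L D) = cinner (amp D x) (amp D y)"
    using D by (simp add: xy vn_comp[OF vn] amp_comp cinner_amp_adj_left bops)
  moreover have "\<psi> (D o\<^sub>L op_adj D) = cinner (amp (op_adj D) x) (amp (op_adj D) y)"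
    using D by (simp add: xy vn_comp[OF vn] amp_comp cinner_amp_adj_right bops)
  ultimately show ?thesis
    using that[OF Z] bound n unfolding D_def by simp
qed

lemma kms_simple:
  assumes "a \<in> M" "b \<in> N" "c \<in> M" "d \<in> N"
  shows "kms_pair \<psi> \<tau> (op_tensor t a b) (op_tensor t c d)"
proof -
  have "kms_pair chi1 \<tau>1 a c" "kms_pair chi2 \<tau>2 b d"
    using kms1 kms2 assms by (auto simp: quantized_character_iff)
  hence "strip_boundary_values (\<lambda>s. chi1 (a o\<^sub>L \<tau>1 s c) * chi2 (b o\<^sub>L \<tau>2 s d))
      (\<lambda>s. chi1 (\<tau>1 s c o\<^sub>L a) * chi2 (\<tau>2 s d o\<^sub>L b))"
    unfolding kms_pair_def by (rule strip_boundary_values_mult)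
  moreover have "\<psi> (op_tensor t a b o\<^sub>L \<tau> s (op_tensor t c d)) =
      chi1 (a o\<^sub>L \<tau>1 s c) * chi2 (b o\<^sub>L \<tau>2 s d)" for s
    using assms by (simp add: \<tau>_tensor op_tensor_comp factor_bops product factor_in
        vn_comp[OF vn_M] vn_comp[OF vn_N])
  moreover have "\<psi> (\<tau> s (op_tensor t c d) o\<^sub>L op_tensor t a b) =
      chi1 (\<tau>1 s c o\<^sub>L a) * chi2 (\<tau>2 s d o\<^sub>L b)" for s
    using assms by (simp add: \<tau>_tensor op_tensor_comp factor_bops product factor_in
        vn_comp[OF vn_M] vn_comp[OF vn_N])
  ultimately show ?thesis by (simp add: kms_pair_def)
qed

lemmas compose_bilinear =
  bounded_bilinear.add_left[OF bounded_bilinear_blinfun_compose]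
  bounded_bilinear.add_right[OF bounded_bilinear_blinfun_compose]
  bounded_bilinear.diff_left[OF bounded_bilinear_blinfun_compose]
  bounded_bilinear.diff_right[OF bounded_bilinear_blinfun_compose]
  bounded_bilinear.scaleR_left[OF bounded_bilinear_blinfun_compose]
  bounded_bilinear.scaleR_right[OF bounded_bilinear_blinfun_compose]
  bounded_bilinear.zero_left[OF bounded_bilinear_blinfun_compose]
  bounded_bilinear.zero_right[OF bounded_bilinear_blinfun_compose]

lemma subspace_kms_left:
  assumes Y: "Y \<in> MN"
  shows "subspace {X \<in> MN. kms_pair \<psi> \<tau> X Y}"
  unfolding subspace_def
proof (intro conjI ballI allI CollectI)
  note * = vn_comp[OF vn] \<tau>_in[OF Y]
  show "0 \<in> MN" by (rule vn_zero[OF vn])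
  show "kms_pair \<psi> \<tau> 0 Y"
    by (simp add: kms_pair_def compose_bilinear zero strip_boundary_values_const)
  fix X Z assume X: "X \<in> {X \<in> MN. kms_pair \<psi> \<tau> X Y}" and Z: "Z \<in> {X \<in> MN. kms_pair \<psi> \<tau> X Y}"
  show "X + Z \<in> MN" using X Z by (auto intro: vn_add[OF vn])
  show "kms_pair \<psi> \<tau> (X + Z) Y"
    using strip_boundary_values_add[of "\<lambda>s. \<psi> (X o\<^sub>L \<tau> s Y)" "\<lambda>s. \<psi> (\<tau> s Y o\<^sub>L X)"
        "\<lambda>s. \<psi> (Z o\<^sub>L \<tau> s Y)" "\<lambda>s. \<psi> (\<tau> s Y o\<^sub>L Z)"] X Z
    by (simp add: kms_pair_def compose_bilinear add *)
  fix r
  show "r *\<^sub>R X \<in> MN" using X by (auto intro: vn_scaleR[OF vn])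
  show "kms_pair \<psi> \<tau> (r *\<^sub>R X) Y"
    using strip_boundary_values_cmult[of "\<lambda>s. \<psi> (X o\<^sub>L \<tau> s Y)" "\<lambda>s. \<psi> (\<tau> s Y o\<^sub>L X)" "of_real r"] X
    by (simp add: kms_pair_def compose_bilinear scaleR *)
qed

lemma subspace_kms_right:
  assumes X: "X \<in> MN"
  shows "subspace {Y \<in> MN. kms_pair \<psi> \<tau> X Y}"
  unfolding subspace_def
proof (intro conjI ballI allI CollectI)
  note * = vn_comp[OF vn] \<tau>_in
  show "0 \<in> MN" by (rule vn_zero[OF vn])
  show "kms_pair \<psi> \<tau> X 0"
    by (simp add: kms_pair_def compose_bilinear zero \<tau>_zero strip_boundary_values_const)
  fix Y Z assume Y: "Y \<in> {Y \<in> MN. kms_pair \<psi> \<tau> X Y}" and Z: "Z \<in> {Y \<in> MN. kms_pair \<psi> \<tau> X Y}"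
  show "Y + Z \<in> MN" using Y Z by (auto intro: vn_add[OF vn])
  show "kms_pair \<psi> \<tau> X (Y + Z)"
    using strip_boundary_values_add[of "\<lambda>s. \<psi> (X o\<^sub>L \<tau> s Y)" "\<lambda>s. \<psi> (\<tau> s Y o\<^sub>L X)"
        "\<lambda>s. \<psi> (X o\<^sub>L \<tau> s Z)" "\<lambda>s. \<psi> (\<tau> s Z o\<^sub>L X)"] X Y Z
    by (simp add: kms_pair_def compose_bilinear add \<tau>_add *)
  fix r
  show "r *\<^sub>R Y \<in> MN" using Y by (auto intro: vn_scaleR[OF vn])
  show "kms_pair \<psi> \<tau> X (r *\<^sub>R Y)"
    using strip_boundary_values_cmult[of "\<lambda>s. \<psi> (X o\<^sub>L \<tau> s Y)" "\<lambda>s. \<psi> (\<tau> s Y o\<^sub>L X)" "of_real r"] X Y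
    by (simp add: kms_pair_def compose_bilinear scaleR \<tau>_scaleR *)
qed

lemma kms_span:
  assumes X: "X \<in> ST" and Y: "Y \<in> ST"
  shows "kms_pair \<psi> \<tau> X Y"
proof -
  have right: "Y \<in> {Y \<in> MN. kms_pair \<psi> \<tau> X Y}" if "X \<in> simple_tensors t M N" for X
  proof (rule subsetD[OF span_minimal Y])
    show "subspace {Y \<in> MN. kms_pair \<psi> \<tau> X Y}"
      using that by (intro subspace_kms_right span_in span_base)
    show "simple_tensors t M N \<subseteq> {Y \<in> MN. kms_pair \<psi> \<tau> X Y}"
      using that by (auto simp: simple_tensors_def kms_simple op_tensor_in)
  qed
  have "X \<in> {X \<in> MN. kms_pair \<psi> \<tau> X Y}"
  proof (rule subsetD[OF span_minimal X])
    show "subspace {X \<in> MN. kms_pair \<psi> \<tau> X Y}"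
      by (intro subspace_kms_left span_in Y)
    show "simple_tensors t M N \<subseteq> {X \<in> MN. kms_pair \<psi> \<tau> X Y}"
      using right by (auto intro: span_in span_base)
  qed
  thus ?thesis by simp
qed

text \<open>The summand 1 in the denominator admits \<open>K = 0\<close>.\<close>

lemma cmod_le_if_square:
  assumes "(cmod z)\<^sup>2 \<le> K * d" "0 \<le> K" "0 \<le> d" "d < e\<^sup>2 / (K + 1)" "e > 0"
  shows "cmod z \<le> e"
proof -
  have "K * d \<le> (K + 1) * d" using assms by (intro mult_right_mono) auto
  also have "\<dots> \<le> e\<^sup>2" using assms by (simp add: field_simps)
  finally have "(cmod z)\<^sup>2 \<le> e\<^sup>2" using assms(1) by linarith
  thus ?thesis by (rule power2_le_imp_le) (simp add: assms(5) less_imp_le)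
qed

lemma positive_Re: "a \<in> MN \<Longrightarrow> 0 \<le> Re (\<psi> (op_adj a o\<^sub>L a))" "a \<in> MN \<Longrightarrow> 0 \<le> Re (\<psi> (a o\<^sub>L op_adj a))"
  using positive[of a] positive[of "op_adj a"] vn_adj[OF vn, of a]
  by (auto simp: complex_nonneg_Reals_iff op_adj_adj bops)

text \<open>The state is invariant under \<open>\<tau>\<close>, so by the Cauchy-Schwarz inequality the error on both
  boundary lines is bounded independently of the time parameter.\<close>

lemma kms_span_left:
  assumes X: "X \<in> ST" and Y: "Y \<in> MN"
  shows "kms_pair \<psi> \<tau> X Y"
  unfolding kms_pair_def
proof (rule strip_boundary_values_limit)
  fix e :: real assume e: "e > 0"
  have XM: "X \<in> MN" by (rule span_in[OF X])
  define K1 K2 where "K1 = Re (\<psi> (X o\<^sub>L op_adj X))" and "K2 = Re (\<psi> (op_adj X o\<^sub>L X))"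
  have K: "K1 \<ge> 0" "K2 \<ge> 0" using positive_Re[OF XM] by (auto simp: K1_def K2_def)
  define d where "d = min (e\<^sup>2 / (K1 + 1)) (e\<^sup>2 / (K2 + 1))"
  have "d > 0" using K e by (simp add: d_def)
  then obtain Z where Z: "Z \<in> ST" and small: "Re (\<psi> (op_adj (Y - Z) o\<^sub>L (Y - Z))) < d"
    "Re (\<psi> ((Y - Z) o\<^sub>L op_adj (Y - Z))) < d"
    using approximation[OF Y] by metis
  have ZM: "Z \<in> MN" and D: "Y - Z \<in> MN" using span_in[OF Z] Y by (auto intro: vn_diff[OF vn])
  have "cmod (\<psi> (X o\<^sub>L \<tau> s Y) - \<psi> (X o\<^sub>L \<tau> s Z)) \<le> e \<and>
      cmod (\<psi> (\<tau> s Y o\<^sub>L X) - \<psi> (\<tau> s Z o\<^sub>L X)) \<le> e" for s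
  proof
    have "cmod (\<psi> (X o\<^sub>L \<tau> s (Y - Z))) \<le> e"
      by (rule cmod_le_if_square[OF estimates(1)[OF XM D, of s, folded K1_def]])
         (use K small positive_Re[OF D] e in \<open>auto simp: d_def\<close>)
    thus "cmod (\<psi> (X o\<^sub>L \<tau> s Y) - \<psi> (X o\<^sub>L \<tau> s Z)) \<le> e"
      using Y ZM XM by (simp add: \<tau>_diff compose_bilinear diff vn_comp[OF vn] \<tau>_in)
    have "cmod (\<psi> (\<tau> s (Y - Z) o\<^sub>L X)) \<le> e"
      by (rule cmod_le_if_square[OF estimates(2)[OF XM D, of s, folded K2_def]])
         (use K small positive_Re[OF D] e in \<open>auto simp: d_def\<close>)
    thus "cmod (\<psi> (\<tau> s Y o\<^sub>L X) - \<psi> (\<tau> s Z o\<^sub>L X)) \<le> e"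
      using Y ZM XM by (simp add: \<tau>_diff compose_bilinear diff vn_comp[OF vn] \<tau>_in)
  qed
  moreover have "strip_boundary_values (\<lambda>s. \<psi> (X o\<^sub>L \<tau> s Z)) (\<lambda>s. \<psi> (\<tau> s Z o\<^sub>L X))"
    using kms_span[OF X Z] by (simp add: kms_pair_def)
  ultimately show "\<exists>u' v'. strip_boundary_values u' v' \<and>
      (\<forall>s. cmod (\<psi> (X o\<^sub>L \<tau> s Y) - u' s) \<le> e \<and> cmod (\<psi> (\<tau> s Y o\<^sub>L X) - v' s) \<le> e)"
    by (intro exI[of _ "\<lambda>s. \<psi> (X o\<^sub>L \<tau> s Z)"] exI[of _ "\<lambda>s. \<psi> (\<tau> s Z o\<^sub>L X)"]) simp
qed

text \<open>The second approximation, now of the left element, again with an error that is uniform in time.\<close>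

lemma kms:
  assumes X: "X \<in> MN" and Y: "Y \<in> MN"
  shows "kms_pair \<psi> \<tau> X Y"
  unfolding kms_pair_def
proof (rule strip_boundary_values_limit)
  fix e :: real assume e: "e > 0"
  define K1 K2 where "K1 = Re (\<psi> (op_adj Y o\<^sub>L Y))" and "K2 = Re (\<psi> (Y o\<^sub>L op_adj Y))"
  have K: "K1 \<ge> 0" "K2 \<ge> 0" using positive_Re[OF Y] by (auto simp: K1_def K2_def)
  define d where "d = min (e\<^sup>2 / (K1 + 1)) (e\<^sup>2 / (K2 + 1))"
  have "d > 0" using K e by (simp add: d_def)
  then obtain Z where Z: "Z \<in> ST" and small: "Re (\<psi> (op_adj (X - Z) o\<^sub>L (X - Z))) < d"
    "Re (\<psi> ((X - Z) o\<^sub>L op_adj (X - Z))) < d"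
    using approximation[OF X] by metis
  have ZM: "Z \<in> MN" and D: "X - Z \<in> MN" using span_in[OF Z] X by (auto intro: vn_diff[OF vn])
  have "cmod (\<psi> (X o\<^sub>L \<tau> s Y) - \<psi> (Z o\<^sub>L \<tau> s Y)) \<le> e \<and>
      cmod (\<psi> (\<tau> s Y o\<^sub>L X) - \<psi> (\<tau> s Y o\<^sub>L Z)) \<le> e" for s
  proof
    have "cmod (\<psi> ((X - Z) o\<^sub>L \<tau> s Y)) \<le> e"
      by (rule cmod_le_if_square[OF estimates(1)[OF D Y, of s, folded K1_def, unfolded mult.commute[of _ K1]]])
         (use K small positive_Re[OF D] e in \<open>auto simp: d_def\<close>)
    thus "cmod (\<psi> (X o\<^sub>L \<tau> s Y) - \<psi> (Z o\<^sub>L \<tau> s Y)) \<le> e"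
      using X Y ZM by (simp add: compose_bilinear diff vn_comp[OF vn] \<tau>_in)
    have "cmod (\<psi> (\<tau> s Y o\<^sub>L (X - Z))) \<le> e"
      by (rule cmod_le_if_square[OF estimates(2)[OF D Y, of s, folded K2_def, unfolded mult.commute[of _ K2]]])
         (use K small positive_Re[OF D] e in \<open>auto simp: d_def\<close>)
    thus "cmod (\<psi> (\<tau> s Y o\<^sub>L X) - \<psi> (\<tau> s Y o\<^sub>L Z)) \<le> e"
      using X Y ZM by (simp add: compose_bilinear diff vn_comp[OF vn] \<tau>_in)
  qed
  moreover have "strip_boundary_values (\<lambda>s. \<psi> (Z o\<^sub>L \<tau> s Y)) (\<lambda>s. \<psi> (\<tau> s Y o\<^sub>L Z))"
    using kms_span_left[OF Z Y] by (simp add: kms_pair_def)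
  ultimately show "\<exists>u' v'. strip_boundary_values u' v' \<and>
      (\<forall>s. cmod (\<psi> (X o\<^sub>L \<tau> s Y) - u' s) \<le> e \<and> cmod (\<psi> (\<tau> s Y o\<^sub>L X) - v' s) \<le> e)"
    by (intro exI[of _ "\<lambda>s. \<psi> (Z o\<^sub>L \<tau> s Y)"] exI[of _ "\<lambda>s. \<psi> (\<tau> s Y o\<^sub>L Z)"]) simp
qed

end

theorem lemma3p2:
  fixes t :: "'h::chilbert_space \<Rightarrow> 'h \<Rightarrow> 'k::chilbert_space"
    and tl :: "'k \<Rightarrow> 'h \<Rightarrow> 'l::chilbert_space"
    and tr :: "'h \<Rightarrow> 'k \<Rightarrow> 'l"
    and M A :: "('h \<Rightarrow>\<^sub>L 'h) set"
    and \<delta> :: "('h \<Rightarrow>\<^sub>L 'h) \<Rightarrow> ('k \<Rightarrow>\<^sub>L 'k)"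
    and R :: "('h \<Rightarrow>\<^sub>L 'h) \<Rightarrow> ('h \<Rightarrow>\<^sub>L 'h)"
    and \<tau> :: "real \<Rightarrow> ('h \<Rightarrow>\<^sub>L 'h) \<Rightarrow> ('h \<Rightarrow>\<^sub>L 'h)"
    and chi\<^sub>1 chi\<^sub>2 :: "('h \<Rightarrow>\<^sub>L 'h) \<Rightarrow> complex"
  assumes "quantum_group_Wstar t tl tr M A \<delta> R \<tau>"
    and "quantized_character M \<tau> chi\<^sub>1"
    and "quantized_character M \<tau> chi\<^sub>2"
  shows "quantized_character M \<tau> (\<lambda>x. product_state t M M chi\<^sub>1 chi\<^sub>2 (\<delta> x))"
proof -
  interpret G: quantum_group_Wstar t tl tr M A \<delta> R \<tau> by fact
  interpret T: vn_tensor_product t M M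
    by standard (rule G.tensor_t, rule G.vn_M)
  have states: "normal_state M chi\<^sub>1" "normal_state M chi\<^sub>2"
    using assms(2,3) by (auto simp: quantized_character_iff)
  define \<psi> where "\<psi> = product_state t M M chi\<^sub>1 chi\<^sub>2"
  have "\<forall>r. \<exists>f. is_tensor_map t t M M M M (\<tau> r) (\<tau> r) f \<and> (\<forall>x\<in>M. \<delta> (\<tau> r x) = f (\<delta> x))"
    using G.comult_\<tau> by blast
  then obtain \<tau>\<tau> where \<tau>\<tau>: "\<And>r. is_tensor_map t t M M M M (\<tau> r) (\<tau> r) (\<tau>\<tau> r)"
    and \<delta>\<tau>: "\<And>r x. x \<in> M \<Longrightarrow> \<delta> (\<tau> r x) = \<tau>\<tau> r (\<delta> x)"
    by metis
  interpret K: kms_product t M M \<tau> \<tau> chi\<^sub>1 chi\<^sub>2 \<tau>\<tau> \<psi>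
  proof
    show "star_hom M M (\<tau> s)" for s
      using G.\<tau>_automorphism by (auto simp: star_automorphism_def)
  qed (use G.\<tau>_zero assms \<tau>\<tau> T.product_state[OF states] in \<open>auto simp: \<psi>_def\<close>)
  have \<delta>: "\<And>x. x \<in> M \<Longrightarrow> \<delta> x \<in> vn_tensor t M M"
    "\<And>x y. x \<in> M \<Longrightarrow> y \<in> M \<Longrightarrow> \<delta> (x + y) = \<delta> x + \<delta> y"
    "\<And>c x. x \<in> M \<Longrightarrow> \<delta> (op_scaleC c x) = op_scaleC c (\<delta> x)"
    "\<And>x y. x \<in> M \<Longrightarrow> y \<in> M \<Longrightarrow> \<delta> (x o\<^sub>L y) = \<delta> x o\<^sub>L \<delta> y"
    "\<And>x. x \<in> M \<Longrightarrow> \<delta> (op_adj x) = op_adj (\<delta> x)"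
    using G.comult_hom(1) by (auto simp: star_hom_def linear_map_on_def)
  have \<tau>_in: "\<tau> s x \<in> M" if "x \<in> M" for s x
    using K.factor_in(1)[OF that] .
  have "continuous_map (subtopology sigma_weak M) euclidean (\<psi> \<circ> \<delta>)"
    using G.comult_normal K.state unfolding normal_map_def normal_state_def
    by (blast intro: continuous_map_compose)
  hence "normal_state M (\<lambda>x. \<psi> (\<delta> x))"
    unfolding normal_state_def
    by (auto simp: \<delta> K.add K.scaleC K.positive K.unit G.comult_hom(2) o_def vn_adj[OF G.vn_M])
  moreover have "kms_pair (\<lambda>x. \<psi> (\<delta> x)) \<tau> x y" if "x \<in> M" "y \<in> M" for x y
    using K.kms[OF \<delta>(1)[OF that(1)] \<delta>(1)[OF that(2)]] that
    by (simp add: kms_pair_def \<delta> \<delta>\<tau> \<tau>_in)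
  ultimately show ?thesis unfolding \<psi>_def by (simp add: quantized_character_iff)
qed

end
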